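(* Let $\{\mathbb{Q}_\beta\}$ be a family of translation-invariant self-interacting random walks on $\mathbb{Z}^d$ of range at most $L$, as in the context, whose expansion coefficients satisfy the following Assumption (CLT): there exist a non-increasing sequence $\{b_m\}_{m\ge1}$, independent of $\beta$, with $b_1\ge1$, and a constant $\varepsilon_\beta$ with $\lim_{\beta\downarrow0}\varepsilon_\beta=0$, such that for all $m\ge2$: (i) $\hat\pi_m(0)=0$, $|\nabla\hat\pi_m(0)|\le\varepsilon_\beta b_m$, $|\nabla^2\hat\pi_m(0)|\le\varepsilon_\beta mb_m$; (ii) for all $k\in[-\pi,\pi]^d$, $\big|\hat\pi_m(k)-k\cdot\nabla\hat\pi_m(0)\big|\le\varepsilon_\beta|k|^2mb_m$ and $\big|\hat\pi_m(k)-k\cdot\nabla\hat\pi_m(0)-\frac12k^t\nabla^2\hat\pi_m(0)k\big|\le\varepsilon_\beta|k|^3m^2b_m$; moreover $\sum_{m=1}^\infty mb_m<\infty$, and there exists $\gamma\in(0,1/2)$ such that $$d_n\equiv\sum_{m=2}^n mb_m\sum_{l=n+1-m}^n b_{l+1}=o(1)\ \text{ as }n\to\infty,\qquad a_n\equiv\sum_{m=1}^n m^{2+\gamma}b_m\le C_a\sqrt{\frac{n}{\log(n+1)}}\ \text{ for all }n\text{ and some }C_a\ge1.$$ Let $A_n=\sum_{j=1}^na_j$, $D_n=\sum_{j=1}^nd_j$, $E_n=\sum_{m=1}^\infty(m\wedge n)mb_m$. Then there exist $\beta_0=\beta_0(d)>0$, $\theta=\theta(\beta)$ and $\Sigma=\Sigma(\beta)$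 such that, for all $\beta\le\beta_0$: (a) $\mathbb{E}_\beta[\omega_n]=\theta n\,\big[1+O\big(\tfrac1n\big)\big]$; (b) $\mathrm{Var}_\beta(\omega_n)=\Sigma n+O(D_n)+O(E_n)$; (c) there exists $C>0$ such that for every $k\in\mathbb{R}^d$, $$\log\Big(\mathbb{E}_\beta\Big[e^{ik\cdot\frac{(\omega_n-\theta n)}{\sqrt n}}\Big]\Big)=-\tfrac12k^t\Sigma k+O\big(|k|e^{C|k|^2}n^{-1/2}\big)+O\big(|k|^3n^{-3/2}A_n\big)+O\big(|k|^2e^{C|k|^2}n^{-1}(D_n+E_n)\big).$$ The (model-dependent) constants $\theta$ and $\Sigma$ are given by $$\theta=\sum_xxD(x)-i\sum_{m=2}^\infty\nabla\hat\pi_m(0),\qquad\Sigma=\Sigma_{\varnothing}-\theta\theta^t-\sum_{m=2}^\infty\nabla^2\Big[e^{-i\theta\cdot k(m-1)}\hat\pi_m(k)\Big]_{k=0},$$ where $(\Sigma_{\varnothing})_{ij}=\sum_xx_ix_jD(x)$.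
   Context: Notation: $n$ ranges over the positive integers. $O(g)$ denotes a quantity bounded in absolute value by a constant multiple of $g$, the constant not depending on $n$ or $k$. $a\wedge b=\min(a,b)$. Vectors are column vectors. Self-interacting random walks. The parameter $\beta\ge 0$ indexes a family of walks; $\beta$ is suppressed in $p$, $D$, $\pi_m$. A finite path is $\vec{x}_i=(x_0,\dots,x_i)$ with $x_j\in\mathbb{Z}^d$. For every finite path $\vec{x}_i$ a probability mass function $y\mapsto p^{\vec{x}_i}(x_i,y)$ on $\mathbb{Z}^d$ is given (the conditional probability of stepping from $x_i$ to $y$ given the history $\vec{x}_i$). It is translation invariant, i.e. unchanged when the whole path and $y$ are shifted by the same vector, and has finite range: $p^{\vec{x}_i}(x_i,y)=0$ if $|y-x_i|>L$, with $L<\infty$ independent of $\beta$. The walk $\vec\omega=(\omega_0,\omega_1,\dots)$ started at the origin $o$ has law $\mathbb{Q}_\beta$ given by $\mathbb{Q}_\beta(\vec\omega_n=(x_0,\dots,x_n))=\prod_{i=0}^{n-1}p^{\vec{x}_i}(x_i,x_{i+1})$ for $x_0=o$, where $\vec\omega_n=(\omega_0,\dots,\omega_n)$; $\mathbb{E}_\beta$ is its expectation and $\mathrm{Var}_\beta(\omega_n)$ the covariance matrix of $\omega_n$. Write $D(x)=p^{o}(o,x)$. Concatenation. If $\vec\eta_j=(\eta_0,\dots,\eta_j)$ and $\vec{x}_m=(x_0,\dots,x_m)$ with $\eta_j=x_0$, then $\vec\eta_j\circ\vec{x}_m=(\eta_0,\dots,\eta_j,x_1,\dots,x_m)$. Expansion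 coefficients. For $N\ge1$ and $m\ge 2$ let $\mathcal{A}_{m,N}=\{(j_1,\dots,j_N)\in\mathbb{Z}_{\ge0}^N: j_1+\dots+j_N=m-N-1\}$ and set $j_0=0$. For $\vec{j}\in\mathcal{A}_{m,N}$ consider paths $\vec\omega^{(0)}_1=(o,\omega^{(0)}_1)$ and, for $n=1,\dots,N$, $\vec\omega^{(n)}_{j_n+1}=(\omega^{(n)}_0,\dots,\omega^{(n)}_{j_n+1})$ with $\omega^{(n)}_0=\omega^{(n-1)}_{j_{n-1}+1}$; $\vec\omega^{(n)}_i$ denotes the first $i$ steps of $\vec\omega^{(n)}_{j_n+1}$. Put $$\Delta^{(n)}_{j_n+1}=\Big(p^{\vec\omega^{(n-1)}_{j_{n-1}+1}\circ\vec\omega^{(n)}_{j_n}}-p^{\vec\omega^{(n)}_{j_n}}\Big)\big(\omega^{(n)}_{j_n},\omega^{(n)}_{j_n+1}\big),$$ $$\pi_m^{(N)}(y)=\sum_{\vec{j}\in\mathcal{A}_{m,N}}\ \sum_{\vec\omega^{(0)}_1}\sum_{\vec\omega^{(1)}_{j_1+1}}\cdots\sum_{\vec\omega^{(N)}_{j_N+1}} I_{\{\omega^{(N)}_{j_N+1}=y\}}\,D(\omega^{(0)}_1)\prod_{n=1}^N\Delta^{(n)}_{j_n+1}\prod_{i=0}^{j_n-1}p^{\vec\omega^{(n-1)}_{j_{n-1}+1}\circ\vec\omega^{(n)}_{i}}\big(\omega^{(n)}_i,\omega^{(n)}_{i+1}\big),$$ the sums being over all such paths and empty products being $1$; $\pi_m(y)=\sum_{N=1}^\infty\pi_m^{(N)}(y)$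 (the terms with $N+1>m$ vanish). The Fourier transform is $\hat\pi_m(k)=\sum_{x}e^{ik\cdot x}\pi_m(x)$; $\nabla$ and $\nabla^2$ denote the gradient and the matrix of second derivatives in $k$, and the norm of a matrix is the sum of the absolute values of its entries.
   Formalization: (c) is proved, with C and the constants uniform in n and k, for all n ≥ e^{C|k|²}, since for simple random walk the characteristic function vanishes at k = π√n/2; (a) is read as |E[ω_n] − θn| = O(1), since for θ = 0 the product form can fail. *)

theory Defs
  imports "HOL-Probability.Probability"
begin

section \<open>Self-interacting random walks on the integer lattice\<close>

text \<open>
  The lattice is the type \<open>int ^ 'd\<close>, with \<open>d = CARD('d)\<close>. A finite path
  \<open>(x_0, ..., x_i)\<close> is the nonempty list of its \<open>i + 1\<close> vertices. A walk is given by
  \<open>p :: (int ^ 'd) list \<Rightarrow> (int ^ 'd) pmf\<close>: \<open>pmf (p xs) y\<close> is the conditional probability of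
  stepping from \<open>last xs\<close> to \<open>y\<close> given the history \<open>xs\<close>. The value of \<open>p\<close> at the empty list is
  irrelevant.
\<close>

definition rvec :: "int ^ 'd \<Rightarrow> real ^ 'd" where
  "rvec x = (\<chi> i. real_of_int (x $ i))"

definition cvec :: "real ^ 'd \<Rightarrow> complex ^ 'd" where
  "cvec v = (\<chi> i. complex_of_real (v $ i))"

definition cmat :: "real ^ 'd ^ 'd \<Rightarrow> complex ^ 'd ^ 'd" where
  "cmat M = (\<chi> i j. complex_of_real (M $ i $ j))"

definition translation_invariant :: "((int ^ 'd) list \<Rightarrow> (int ^ 'd) pmf) \<Rightarrow> bool" where
  "translation_invariant p \<longleftrightarrow>
     (\<forall>xs v y. xs \<noteq> [] \<longrightarrow> pmf (p (map (\<lambda>x. x + v) xs)) (y + v) = pmf (p xs) y)"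

definition range_at_most :: "((int ^ 'd) list \<Rightarrow> (int ^ 'd) pmf) \<Rightarrow> real \<Rightarrow> bool" where
  "range_at_most p L \<longleftrightarrow>
     (\<forall>xs y. xs \<noteq> [] \<longrightarrow> norm (rvec (y - last xs)) > L \<longrightarrow> pmf (p xs) y = 0)"

text \<open>\<open>Q\<close> is the law on path space of the walk started at the origin.\<close>

definition walk_law :: "((int ^ 'd) list \<Rightarrow> (int ^ 'd) pmf) \<Rightarrow> (nat \<Rightarrow> int ^ 'd) measure \<Rightarrow> bool" where
  "walk_law p Q \<longleftrightarrow>
     prob_space Q \<and> sets Q = sets (PiM UNIV (\<lambda>_. count_space UNIV)) \<and>
     (\<forall>n xs. length xs = n + 1 \<longrightarrow> xs ! 0 = 0 \<longrightarrow>
        measure Q {w \<in> space Q. \<forall>i\<le>n. w i = xs ! i}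
          = (\<Prod>i<n. pmf (p (take (i + 1) xs)) (xs ! (i + 1))))"

definition walk_mean :: "(nat \<Rightarrow> int ^ 'd) measure \<Rightarrow> nat \<Rightarrow> real ^ 'd" where
  "walk_mean Q n = (\<integral>w. rvec (w n) \<partial>Q)"

definition walk_var :: "(nat \<Rightarrow> int ^ 'd) measure \<Rightarrow> nat \<Rightarrow> real ^ 'd ^ 'd" where
  "walk_var Q n = (\<chi> i j.
     \<integral>w. (rvec (w n) $ i - walk_mean Q n $ i) * (rvec (w n) $ j - walk_mean Q n $ j) \<partial>Q)"

text \<open>The characteristic function of \<open>(\<omega>_n - \<theta> n) / \<surd>n\<close>.\<close>

definition scaled_char ::
  "(nat \<Rightarrow> int ^ 'd) measure \<Rightarrow> real ^ 'd \<Rightarrow> nat \<Rightarrow> real ^ 'd \<Rightarrow> complex" where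
  "scaled_char Q \<theta> n k =
     (\<integral>w. exp (\<i> * complex_of_real (k \<bullet> (rvec (w n) - real n *\<^sub>R \<theta>) / sqrt (real n))) \<partial>Q)"

definition step_dist :: "((int ^ 'd) list \<Rightarrow> (int ^ 'd) pmf) \<Rightarrow> int ^ 'd \<Rightarrow> real" where
  "step_dist p x = pmf (p [0]) x"

definition step_mean :: "((int ^ 'd) list \<Rightarrow> (int ^ 'd) pmf) \<Rightarrow> real ^ 'd" where
  "step_mean p = (\<Sum>\<^sub>\<infinity>x. step_dist p x *\<^sub>R rvec x)"

definition step_second_moment :: "((int ^ 'd) list \<Rightarrow> (int ^ 'd) pmf) \<Rightarrow> real ^ 'd ^ 'd" where
  "step_second_moment p = (\<chi> i j. \<Sum>\<^sub>\<infinity>x. rvec x $ i * rvec x $ j * step_dist p x)"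

section \<open>Expansion coefficients\<close>

definition path_concat :: "'a list \<Rightarrow> 'a list \<Rightarrow> 'a list" where
  "path_concat \<eta> x = \<eta> @ tl x"

text \<open>The condition is \<open>j_1 + ... + j_N = m - N - 1\<close>, without truncated subtraction.\<close>

definition index_tuples :: "nat \<Rightarrow> nat \<Rightarrow> nat list set" where
  "index_tuples m N = {js. length js = N \<and> sum_list js + N + 1 = m}"

text \<open>
  The tuples of paths over which the sum runs: \<open>ws ! n\<close> is the \<open>n\<close>-th path, which has
  \<open>j_n + 1\<close> steps, that is \<open>j_n + 2\<close> vertices, where \<open>j_0 = 0\<close> and \<open>j_n = js ! (n - 1)\<close>.
\<close>

definition path_tuples :: "nat list \<Rightarrow> (int ^ 'd) list list set" where
  "path_tuples js = {ws. length ws = length js + 1 \<and>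
     (\<forall>n\<le>length js. length (ws ! n) = (0 # js) ! n + 2) \<and>
     hd (ws ! 0) = 0 \<and>
     (\<forall>n\<in>{1..length js}. hd (ws ! n) = last (ws ! (n - 1)))}"

text \<open>
  In the next two definitions \<open>\<eta>\<close> is the preceding path and \<open>w\<close> has \<open>j + 2\<close> vertices; its first
  \<open>i\<close> steps are \<open>take (i + 1) w\<close>.
\<close>

definition Delta ::
  "((int ^ 'd) list \<Rightarrow> (int ^ 'd) pmf) \<Rightarrow> (int ^ 'd) list \<Rightarrow> nat \<Rightarrow> (int ^ 'd) list \<Rightarrow> real" where
  "Delta p \<eta> j w =
     pmf (p (path_concat \<eta> (take (j + 1) w))) (w ! (j + 1)) - pmf (p (take (j + 1) w)) (w ! (j + 1))"

definition history_prob ::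
  "((int ^ 'd) list \<Rightarrow> (int ^ 'd) pmf) \<Rightarrow> (int ^ 'd) list \<Rightarrow> nat \<Rightarrow> (int ^ 'd) list \<Rightarrow> real" where
  "history_prob p \<eta> j w = (\<Prod>i<j. pmf (p (path_concat \<eta> (take (i + 1) w))) (w ! (i + 1)))"

text \<open>
  By the finite range only finitely many tuples contribute, so the infinite sums below (over path
  tuples, over \<open>N\<close> and over the lattice) are finite sums for the walks considered.
\<close>

definition pi_coeff_N ::
  "((int ^ 'd) list \<Rightarrow> (int ^ 'd) pmf) \<Rightarrow> nat \<Rightarrow> nat \<Rightarrow> int ^ 'd \<Rightarrow> real" where
  "pi_coeff_N p m N y =
     (\<Sum>js\<in>index_tuples m N. \<Sum>\<^sub>\<infinity>ws\<in>path_tuples js.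
        of_bool (last (ws ! N) = y) * step_dist p (ws ! 0 ! 1) *
        (\<Prod>n=1..N. Delta p (ws ! (n - 1)) (js ! (n - 1)) (ws ! n) *
                     history_prob p (ws ! (n - 1)) (js ! (n - 1)) (ws ! n)))"

definition pi_coeff :: "((int ^ 'd) list \<Rightarrow> (int ^ 'd) pmf) \<Rightarrow> nat \<Rightarrow> int ^ 'd \<Rightarrow> real" where
  "pi_coeff p m y = (\<Sum>N. pi_coeff_N p m (Suc N) y)"

definition fourier :: "(int ^ 'd \<Rightarrow> real) \<Rightarrow> real ^ 'd \<Rightarrow> complex" where
  "fourier f k = (\<Sum>\<^sub>\<infinity>x. exp (\<i> * complex_of_real (k \<bullet> rvec x)) * complex_of_real (f x))"

abbreviation pi_hat :: "((int ^ 'd) list \<Rightarrow> (int ^ 'd) pmf) \<Rightarrow> nat \<Rightarrow> real ^ 'd \<Rightarrow> complex" where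
  "pi_hat p m \<equiv> fourier (pi_coeff p m)"

section \<open>Derivatives, norms and bilinear expressions\<close>

definition partial :: "'d \<Rightarrow> (real ^ 'd \<Rightarrow> complex) \<Rightarrow> real ^ 'd \<Rightarrow> complex" where
  "partial i f k = frechet_derivative f (at k) (axis i 1)"

definition grad :: "(real ^ 'd \<Rightarrow> complex) \<Rightarrow> real ^ 'd \<Rightarrow> complex ^ 'd" where
  "grad f k = (\<chi> i. partial i f k)"

definition hessian :: "(real ^ 'd \<Rightarrow> complex) \<Rightarrow> real ^ 'd \<Rightarrow> complex ^ 'd ^ 'd" where
  "hessian f k = (\<chi> i j. partial i (partial j f) k)"

definition mat_norm :: "'a::real_normed_vector ^ 'd ^ 'd \<Rightarrow> real" where
  "mat_norm M = (\<Sum>i\<in>UNIV. \<Sum>j\<in>UNIV. norm (M $ i $ j))"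

definition lin_form :: "real ^ 'd \<Rightarrow> complex ^ 'd \<Rightarrow> complex" where
  "lin_form k v = (\<Sum>i\<in>UNIV. complex_of_real (k $ i) * v $ i)"

definition quad_form :: "real ^ 'd \<Rightarrow> complex ^ 'd ^ 'd \<Rightarrow> complex" where
  "quad_form k M = (\<Sum>i\<in>UNIV. \<Sum>j\<in>UNIV. complex_of_real (k $ i) * M $ i $ j * complex_of_real (k $ j))"

definition outer :: "real ^ 'd \<Rightarrow> real ^ 'd \<Rightarrow> real ^ 'd ^ 'd" where
  "outer u v = (\<chi> i j. u $ i * v $ j)"

section \<open>Sequences built from \<open>b\<close>\<close>

definition d_seq :: "(nat \<Rightarrow> real) \<Rightarrow> nat \<Rightarrow> real" where
  "d_seq b n = (\<Sum>m=2..n. real m * b m * (\<Sum>l=n + 1 - m..n. b (l + 1)))"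

definition a_seq :: "real \<Rightarrow> (nat \<Rightarrow> real) \<Rightarrow> nat \<Rightarrow> real" where
  "a_seq \<gamma> b n = (\<Sum>m=1..n. real m powr (2 + \<gamma>) * b m)"

definition A_seq :: "real \<Rightarrow> (nat \<Rightarrow> real) \<Rightarrow> nat \<Rightarrow> real" where
  "A_seq \<gamma> b n = (\<Sum>j=1..n. a_seq \<gamma> b j)"

definition D_seq :: "(nat \<Rightarrow> real) \<Rightarrow> nat \<Rightarrow> real" where
  "D_seq b n = (\<Sum>j=1..n. d_seq b j)"

definition E_seq :: "(nat \<Rightarrow> real) \<Rightarrow> nat \<Rightarrow> real" where
  "E_seq b n = (\<Sum>m. real (min (Suc m) n) * real (Suc m) * b (Suc m))"

section \<open>The assumption and the three assertions\<close>

text \<open>Items (i) and (ii) of the assumption, for one walk \<open>p\<close> and the constant \<open>\<epsilon>\<close> belonging to it.\<close>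

definition expansion_bounds ::
  "((int ^ 'd) list \<Rightarrow> (int ^ 'd) pmf) \<Rightarrow> real \<Rightarrow> (nat \<Rightarrow> real) \<Rightarrow> bool" where
  "expansion_bounds p \<epsilon> b \<longleftrightarrow> (\<forall>m\<ge>2.
     pi_hat p m 0 = 0 \<and>
     norm (grad (pi_hat p m) 0) \<le> \<epsilon> * b m \<and>
     mat_norm (hessian (pi_hat p m) 0) \<le> \<epsilon> * real m * b m \<and>
     (\<forall>k. (\<forall>i. k $ i \<in> {-pi..pi}) \<longrightarrow>
        cmod (pi_hat p m k - lin_form k (grad (pi_hat p m) 0))
          \<le> \<epsilon> * (norm k)\<^sup>2 * real m * b m \<and>
        cmod (pi_hat p m k - lin_form k (grad (pi_hat p m) 0)
               - 1 / 2 * quad_form k (hessian (pi_hat p m) 0))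
          \<le> \<epsilon> * (norm k) ^ 3 * (real m)\<^sup>2 * b m))"

definition theta_formula :: "((int ^ 'd) list \<Rightarrow> (int ^ 'd) pmf) \<Rightarrow> real ^ 'd \<Rightarrow> bool" where
  "theta_formula p \<theta> \<longleftrightarrow>
     summable (\<lambda>m. grad (pi_hat p (m + 2)) 0) \<and>
     cvec \<theta> = cvec (step_mean p) - \<i> *s (\<Sum>m. grad (pi_hat p (m + 2)) 0)"

definition twisted_hessian ::
  "((int ^ 'd) list \<Rightarrow> (int ^ 'd) pmf) \<Rightarrow> real ^ 'd \<Rightarrow> nat \<Rightarrow> complex ^ 'd ^ 'd" where
  "twisted_hessian p \<theta> m =
     hessian (\<lambda>k. exp (- \<i> * complex_of_real ((\<theta> \<bullet> k) * (real m - 1))) * pi_hat p m k) 0"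

definition covariance_formula ::
  "((int ^ 'd) list \<Rightarrow> (int ^ 'd) pmf) \<Rightarrow> real ^ 'd \<Rightarrow> real ^ 'd ^ 'd \<Rightarrow> bool" where
  "covariance_formula p \<theta> S \<longleftrightarrow>
     summable (\<lambda>m. twisted_hessian p \<theta> (m + 2)) \<and>
     cmat S = cmat (step_second_moment p) - cmat (outer \<theta> \<theta>) - (\<Sum>m. twisted_hessian p \<theta> (m + 2))"

text \<open>
  \<open>\<theta> n [1 + O(1/n)]\<close> for vectors: the error is a vector of norm at most a constant times
  \<open>n * (1/n)\<close>. For \<open>\<theta> = 0\<close> it need not vanish: if the first step has a drift and all later steps
  are those of simple random walk, then \<open>\<theta> = 0\<close> while the mean is a nonzero constant.
\<close>

definition mean_asymptotics :: "(nat \<Rightarrow> int ^ 'd) measure \<Rightarrow> real ^ 'd \<Rightarrow> bool" where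
  "mean_asymptotics Q \<theta> \<longleftrightarrow>
     (\<exists>K. \<forall>n\<ge>1. norm (walk_mean Q n - real n *\<^sub>R \<theta>) \<le> real n * (K * (1 / real n)))"

definition variance_asymptotics ::
  "(nat \<Rightarrow> int ^ 'd) measure \<Rightarrow> real ^ 'd ^ 'd \<Rightarrow> (nat \<Rightarrow> real) \<Rightarrow> bool" where
  "variance_asymptotics Q S b \<longleftrightarrow>
     (\<exists>K. \<forall>n\<ge>1. mat_norm (walk_var Q n - real n *\<^sub>R S) \<le> K * D_seq b n + K * E_seq b n)"

text \<open>
  The expansion of the logarithm holds for every \<open>k\<close> as \<open>n \<rightarrow> \<infinity>\<close>: \<open>C\<close> and \<open>K\<close> do not depend on
  \<open>n\<close> or \<open>k\<close>, and for given \<open>k\<close> all \<open>n\<close> with \<open>exp (C |k|^2) \<le> n\<close> are admitted. Some threshold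
  depending on \<open>k\<close> is unavoidable: for one-dimensional simple random walk the characteristic
  function is \<open>cos (k / \<surd>n) ^ n\<close>, whose logarithm is unbounded near \<open>k = \<surd>n pi / 2\<close>. As
  \<open>Ln 0\<close> is an arbitrary value, nonvanishing is part of the assertion. A real matrix \<open>S\<close> and the
  principal branch lose nothing, since the principal branch has the imaginary part of least modulus.
\<close>

definition log_char_asymptotics ::
  "(nat \<Rightarrow> int ^ 'd) measure \<Rightarrow> real ^ 'd \<Rightarrow> real ^ 'd ^ 'd \<Rightarrow> real \<Rightarrow> (nat \<Rightarrow> real) \<Rightarrow> bool" where
  "log_char_asymptotics Q \<theta> S \<gamma> b \<longleftrightarrow>
     (\<exists>C>0. \<exists>K. \<forall>k. \<forall>n\<ge>1. exp (C * (norm k)\<^sup>2) \<le> real n \<longrightarrow>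
        scaled_char Q \<theta> n k \<noteq> 0 \<and>
        cmod (Ln (scaled_char Q \<theta> n k) - complex_of_real (- 1 / 2 * (k \<bullet> (S *v k))))
          \<le> K * (norm k * exp (C * (norm k)\<^sup>2) * real n powr (- 1 / 2))
            + K * ((norm k) ^ 3 * real n powr (- 3 / 2) * A_seq \<gamma> b n)
            + K * ((norm k)\<^sup>2 * exp (C * (norm k)\<^sup>2) * (1 / real n) * (D_seq b n + E_seq b n)))"

end

theory Submission
  imports Defs
begin

text \<open>
  The argument takes place on the Fourier side, at a fixed small frequency \<open>\<kappa>\<close> (which is \<open>k / \<surd>n\<close> in
  the scaled statement). Put \<open>f_n = E exp (i \<kappa> \<bullet> (\<omega>_n - n \<theta>))\<close>. The expansion turns the walk into a
  linear recursion with memory,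
  \<open>f_(n+1) = g f_n + (sum over 2 \<le> m \<le> n+1 of P_m f_(n+1-m))\<close>, where
  \<open>P_m = exp (- i m \<kappa> \<bullet> \<theta>) pi_hat_m(\<kappa>)\<close> (lemmas \<open>future_recursion\<close> and \<open>centred_char_recursion\<close>). It
  arises by replacing, one step after the other, transition probabilities that remember the
  preceding path by ones that forget it (\<open>psum_telescope\<close>), and by iterating this for the path that
  has been walked in the meantime; what is collected on the way are the coefficients \<open>pi_hat\<close>
  (\<open>pi_hat_eq_expansion_coeff\<close>).

  The vector \<open>\<theta>\<close> and the matrix \<open>\<Sigma>\<close> are what makes the kernel balanced to second order:
  \<open>g - 1 + P_2 + ... + P_(n+1) = - i \<kappa> \<bullet> t_n - \<kappa> \<bullet> \<Sigma> \<kappa> / 2\<close> up to small terms, where \<open>t_n\<close> is a tail of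
  the series for \<open>\<theta>\<close> and is summable in \<open>n\<close> (\<open>bracket_expansion\<close>). Hence the relative increment
  \<open>r_n = f_(n+1) / f_n - 1\<close> is this quantity plus the memory term
  \<open>sum over m of P_m (f_(n+1-m) / f_n - 1)\<close>. The latter is a product of two small factors, and a strong
  induction on \<open>n\<close> shows \<open>r_n = O(|\<kappa>| B_n + |\<kappa>|^2)\<close> with \<open>B_n\<close> a tail of the sum of the \<open>b_m\<close>
  (\<open>increment_le\<close>). The induction closes because \<open>n |\<kappa>|^2 \<le> ln (n+1) / C\<close> with \<open>C\<close> large: then
  \<open>f_(n+1-m) / f_n\<close> grows at most like \<open>m powr \<gamma>\<close>, which is the extra power of \<open>m\<close> in \<open>a_n\<close>, and
  \<open>|\<kappa>| a_n\<close> is small by the growth condition on \<open>a_n\<close>. So the smallness comes from \<open>\<kappa>\<close>, the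
  constants may depend on the walk, and each walk of the family can be treated by itself.

  Summing \<open>Ln (1 + r_j)\<close> over \<open>j < n\<close> gives
  \<open>f_n = exp (- i \<kappa> \<bullet> v_n - n \<kappa> \<bullet> \<Sigma> \<kappa> / 2 + R_n)\<close> with bounded \<open>v_n\<close> and
  \<open>R_n = O(|\<kappa>|^2 E_n + |\<kappa>|^3 A_n)\<close> (\<open>centred_char_exp_representation\<close>), from which all three assertions
  follow. Assertion (c) is the logarithm of this identity. In it the only error of first order in \<open>\<kappa>\<close>
  is exactly linear and imaginary, so comparing with the Taylor expansion of \<open>f_n\<close> at \<open>\<kappa> = 0\<close>, for
  fixed \<open>n\<close>, yields the mean \<open>n \<theta> - v_n\<close>, that is (a), and shows that the error of the variance is
  \<open>O(E_n)\<close>, that is (b) (\<open>cumulants_of_exp_representation\<close>).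
\<close>


section \<open>Finite sums over paths\<close>

definition step_box :: "real \<Rightarrow> (int ^ 'd) set" where
  "step_box L = {v. norm (rvec v) \<le> L}"

lemma rvec_add: "rvec (x + y) = rvec x + rvec y"
  by (simp add: rvec_def vec_eq_iff)

lemma rvec_zero [simp]: "rvec 0 = 0"
  by (simp add: rvec_def vec_eq_iff)

lemma rvec_nth [simp]: "rvec x $ i = real_of_int (x $ i)"
  by (simp add: rvec_def)

lemma finite_step_box: "finite (step_box L :: (int ^ 'd) set)"
proof -
  have "vec_nth ` (step_box L :: (int ^ 'd) set) \<subseteq> PiE UNIV (\<lambda>_. {- \<lceil>L\<rceil>..\<lceil>L\<rceil>})"
  proof safe
    fix v :: "int ^ 'd" and i assume v: "v \<in> step_box L"
    have "\<bar>real_of_int (v $ i)\<bar> \<le> norm (rvec v)" using component_le_norm_cart[of "rvec v" i] by simp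
    with v have "\<bar>real_of_int (v $ i)\<bar> \<le> L" by (simp add: step_box_def)
    then show "v $ i \<in> {- \<lceil>L\<rceil>..\<lceil>L\<rceil>}" by (simp add: abs_le_iff) linarith
  qed auto
  moreover have "finite (PiE (UNIV :: 'd set) (\<lambda>_. {- \<lceil>L\<rceil>..\<lceil>L\<rceil>}))" by (intro finite_PiE) auto
  moreover have "inj_on vec_nth (step_box L :: (int ^ 'd) set)" by (auto simp: inj_on_def vec_eq_iff)
  ultimately show ?thesis by (meson finite_imageD finite_subset)
qed

definition nbrs :: "real \<Rightarrow> (int ^ 'd) list \<Rightarrow> (int ^ 'd) set" where
  "nbrs L xs = (\<lambda>v. last xs + v) ` step_box L"

lemma finite_nbrs [simp]: "finite (nbrs L xs)"
  by (simp add: nbrs_def finite_step_box)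

lemma nbrs_cong: "last xs = last ys \<Longrightarrow> nbrs L xs = nbrs L ys"
  by (simp add: nbrs_def)

lemma mem_nbrs: "y \<in> nbrs L xs \<longleftrightarrow> y - last xs \<in> step_box L"
  by (force simp: nbrs_def image_iff)

text \<open>
  The weighted sum of \<open>F\<close> over all continuations of \<open>xs\<close> by \<open>n\<close> steps of length at most \<open>L\<close>, where
  \<open>k\<close> is an arbitrary, possibly signed, transition kernel that sees the whole path. The recursion
  takes the first step out of the sum, which is the form that induction over the path needs.
\<close>

primrec psum ::
  "real \<Rightarrow> ((int ^ 'd) list \<Rightarrow> int ^ 'd \<Rightarrow> real) \<Rightarrow> nat \<Rightarrow> ((int ^ 'd) list \<Rightarrow> 'v::real_vector) \<Rightarrow> (int ^ 'd) list \<Rightarrow> 'v"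
  where
  "psum L k 0 F xs = F xs"
| "psum L k (Suc n) F xs = (\<Sum>y\<in>nbrs L xs. k xs y *\<^sub>R psum L k n F (xs @ [y]))"

primrec extensions :: "real \<Rightarrow> nat \<Rightarrow> (int ^ 'd) list \<Rightarrow> (int ^ 'd) list set" where
  "extensions L 0 xs = {xs}"
| "extensions L (Suc n) xs = (\<Union>y\<in>nbrs L xs. extensions L n (xs @ [y]))"

lemma finite_extensions [simp]: "finite (extensions L n xs)"
  by (induction n arbitrary: xs) auto

lemma nth_last_of_take:
  "take (length xs) v = xs \<Longrightarrow> xs \<noteq> [] \<Longrightarrow> v ! (length xs - 1) = last xs"
  by (metis diff_less last_conv_nth length_greater_0_conv nth_take zero_less_one)

lemma extensions_iff:
  "xs \<noteq> [] \<Longrightarrow> v \<in> extensions L n xs \<longleftrightarrow>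
    length v = length xs + n \<and> take (length xs) v = xs \<and>
    (\<forall>i. length xs - 1 \<le> i \<longrightarrow> i < length xs - 1 + n \<longrightarrow> v ! (i + 1) - v ! i \<in> step_box L)"
proof (induction n arbitrary: xs)
  case 0
  then show ?case by auto
next
  case (Suc n)
  have "v \<in> extensions L (Suc n) xs \<longleftrightarrow> (\<exists>y. y - last xs \<in> step_box L \<and> length v = length xs + Suc n \<and>
      take (Suc (length xs)) v = xs @ [y] \<and>
      (\<forall>i. length xs \<le> i \<longrightarrow> i < length xs + n \<longrightarrow> v ! (i + 1) - v ! i \<in> step_box L))"
    using Suc.IH[of "xs @ [_]"] by (auto simp: mem_nbrs)
  also have "\<dots> \<longleftrightarrow> length v = length xs + Suc n \<and> take (length xs) v = xs \<and>
    (\<forall>i. length xs - 1 \<le> i \<longrightarrow> i < length xs - 1 + Suc n \<longrightarrow> v ! (i + 1) - v ! i \<in> step_box L)"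
    (is "?L = ?R")
  proof
    assume ?L
    then obtain y where y: "y - last xs \<in> step_box L" and len: "length v = length xs + Suc n"
      and tk: "take (Suc (length xs)) v = xs @ [y]"
      and st: "\<And>i. length xs \<le> i \<Longrightarrow> i < length xs + n \<Longrightarrow> v ! (i + 1) - v ! i \<in> step_box L" by auto
    have tk': "take (length xs) v = xs" "v ! length xs = y"
      using tk len by (auto simp: take_Suc_conv_app_nth)
    obtain l where l: "length xs = Suc l" using Suc.prems by (cases xs) auto
    have "v ! l = last xs" using nth_last_of_take[OF tk'(1) Suc.prems] len l by simp
    then have "v ! (i + 1) - v ! i \<in> step_box L" if "l \<le> i" "i < l + Suc n" for i
      using that st[of i] y tk' by (cases "i = l") (auto simp: l)
    then show ?R using len tk' l by auto
  next
    assume R: ?R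
    obtain l where l: "length xs = Suc l" using Suc.prems by (cases xs) auto
    have "v ! l = last xs" using nth_last_of_take[of xs v] Suc.prems R l by simp
    then have "v ! length xs - last xs \<in> step_box L" using R by (auto simp: l)
    moreover have "take (Suc (length xs)) v = xs @ [v ! length xs]"
      using R by (simp add: take_Suc_conv_app_nth)
    ultimately show ?L using R Suc.prems by (intro exI[of _ "v ! length xs"]) auto
  qed
  finally show ?case .
qed

lemma extensions_disjoint:
  "extensions L n (xs @ [y]) \<inter> extensions L n (xs @ [z]) = {}" if "y \<noteq> z"
proof -
  have "v ! length xs = y" if "v \<in> extensions L n (xs @ [y])" for v y
    using that by (simp add: extensions_iff) (metis nth_append_length nth_take lessI)
  with that show ?thesis by blast
qed

lemma sum_extensions_Suc:
  "(\<Sum>v\<in>extensions L (Suc n) xs. h v) = (\<Sum>y\<in>nbrs L xs. \<Sum>v\<in>extensions L n (xs @ [y]). h v)"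
  unfolding extensions.simps by (intro sum.UNION_disjoint) (auto dest: extensions_disjoint)

lemma extension_nth:
  assumes "v \<in> extensions L n (xs @ [y])"
  shows "take (length xs) v = xs" "v ! length xs = y" "length v = length xs + Suc n"
  using assms by (auto simp: extensions_iff take_Suc_conv_app_nth)

lemma psum_eq_sum:
  assumes "xs \<noteq> []"
  shows "psum L k n F xs = (\<Sum>v\<in>extensions L n xs.
    (\<Prod>i\<in>{length xs - 1..<length xs - 1 + n}. k (take (i + 1) v) (v ! (i + 1))) *\<^sub>R F v)"
  using assms
proof (induction n arbitrary: xs)
  case (Suc n)
  have "(\<Prod>i\<in>{length xs - 1..<length xs - 1 + Suc n}. k (take (i + 1) v) (v ! (i + 1)))
      = k xs y * (\<Prod>i\<in>{length xs..<length xs + n}. k (take (i + 1) v) (v ! (i + 1)))"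
    if "v \<in> extensions L n (xs @ [y])" for v y
  proof -
    obtain l where l: "length xs = Suc l" using Suc.prems by (cases xs) auto
    have "{l..<l + Suc n} = insert l {Suc l..<Suc l + n}" by auto
    then show ?thesis using extension_nth[OF that] by (simp add: l)
  qed
  then show ?case
    unfolding sum_extensions_Suc psum.simps
    by (intro sum.cong refl) (simp add: Suc.IH scaleR_right.sum)
qed simp

text \<open>
  The last step may carry a weight \<open>h\<close> of its own: this is the shape of one factor of the
  coefficients, a product of transition probabilities closed by one difference \<open>Delta\<close>.
\<close>

lemma psum_step_eq_sum:
  assumes "xs \<noteq> []"
  shows "psum L k n (\<lambda>v. \<Sum>y\<in>nbrs L v. h v y *\<^sub>R F (v @ [y])) xs = (\<Sum>v\<in>extensions L (Suc n) xs.
    ((\<Prod>i\<in>{length xs - 1..<length xs - 1 + n}. k (take (i + 1) v) (v ! (i + 1)))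
      * h (take (length xs + n) v) (v ! (length xs + n))) *\<^sub>R F v)"
  using assms
proof (induction n arbitrary: xs)
  case 0
  show ?case unfolding sum_extensions_Suc by simp
next
  case (Suc n)
  have "(\<Prod>i\<in>{length xs - 1..<length xs - 1 + Suc n}. k (take (i + 1) v) (v ! (i + 1)))
      = k xs y * (\<Prod>i\<in>{length xs..<length xs + n}. k (take (i + 1) v) (v ! (i + 1)))"
    if "v \<in> extensions L (Suc n) (xs @ [y])" for v y
  proof -
    obtain l where l: "length xs = Suc l" using Suc.prems by (cases xs) auto
    have "{l..<l + Suc n} = insert l {Suc l..<Suc l + n}" by auto
    then show ?thesis using extension_nth[OF that] by (simp add: l)
  qed
  then show ?case
    unfolding sum_extensions_Suc[where n = "Suc n"] psum.simps
    by (intro sum.cong refl) (simp add: Suc.IH scaleR_right.sum mult.assoc del: extensions.simps)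
qed

lemma psum_sum: "psum L k n (\<lambda>v. \<Sum>i\<in>I. F i v) xs = (\<Sum>i\<in>I. psum L k n (F i) xs)"
proof (induction n arbitrary: xs)
  case (Suc n)
  have "psum L k (Suc n) (\<lambda>v. \<Sum>i\<in>I. F i v) xs
      = (\<Sum>y\<in>nbrs L xs. \<Sum>i\<in>I. k xs y *\<^sub>R psum L k n (F i) (xs @ [y]))"
    by (simp add: Suc scaleR_right.sum)
  then show ?case by (subst (asm) sum.swap) simp
qed simp

lemma psum_mult_right:
  fixes F :: "_ \<Rightarrow> 'a::real_algebra"
  shows "psum L k n (\<lambda>v. F v * c) xs = psum L k n F xs * c"
  by (induction n arbitrary: xs) (simp_all add: sum_distrib_right)

text \<open>
  The source of the expansion. The kernel \<open>k\<close> is replaced by \<open>k'\<close>, beginning with the last step of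
  the path; \<open>j\<close> is the number of steps that still use \<open>k\<close> before the two kernels are subtracted.
\<close>

lemma psum_telescope:
  "psum L k n F xs = psum L k' n F xs +
    (\<Sum>j<n. psum L k j (\<lambda>v. \<Sum>y\<in>nbrs L v. (k v y - k' v y) *\<^sub>R psum L k' (n - 1 - j) F (v @ [y])) xs)"
proof (induction n arbitrary: xs)
  case (Suc n)
  let ?G = "\<lambda>j v. \<Sum>y\<in>nbrs L v. (k v y - k' v y) *\<^sub>R psum L k' (n - 1 - j) F (v @ [y])"
  have "psum L k (Suc n) F xs = (\<Sum>y\<in>nbrs L xs. k xs y *\<^sub>R psum L k' n F (xs @ [y]))
      + (\<Sum>y\<in>nbrs L xs. \<Sum>j<n. k xs y *\<^sub>R psum L k j (?G j) (xs @ [y]))"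
    by (simp add: Suc scaleR_add_right sum.distrib scaleR_right.sum)
  also have "(\<Sum>y\<in>nbrs L xs. k xs y *\<^sub>R psum L k' n F (xs @ [y]))
      = psum L k' (Suc n) F xs + psum L k 0 (\<lambda>v. \<Sum>y\<in>nbrs L v. (k v y - k' v y) *\<^sub>R psum L k' n F (v @ [y])) xs"
    by (simp add: scaleR_diff_left sum_subtractf)
  also have "(\<Sum>y\<in>nbrs L xs. \<Sum>j<n. k xs y *\<^sub>R psum L k j (?G j) (xs @ [y]))
      = (\<Sum>j<n. psum L k (Suc j) (?G j) xs)"
    by (subst sum.swap) simp
  finally show ?case by (simp add: sum.lessThan_Suc_shift add.assoc del: sum.lessThan_Suc)
qed simp


section \<open>The expansion of the endpoint transform\<close>

definition wave :: "real ^ 'd \<Rightarrow> int ^ 'd \<Rightarrow> complex" where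
  "wave k x = exp (\<i> * complex_of_real (k \<bullet> rvec x))"

lemma wave_add: "wave k (x + y) = wave k x * wave k y"
  by (simp add: wave_def rvec_add inner_add_right exp_add ring_distribs)

lemma wave_zero [simp]: "wave k 0 = 1"
  by (simp add: wave_def)

text \<open>
  The index tuples of the coefficients, for all \<open>N\<close> at once: the path of index \<open>j\<close> has \<open>j + 1\<close> steps,
  so \<open>m\<close> is the total number of steps after the first one.
\<close>

definition comps :: "nat \<Rightarrow> nat list set" where
  "comps m = {js. sum_list js + length js = m}"

lemma comps_0 [simp]: "comps 0 = {[]}"
  by (auto simp: comps_def)

lemma comps_Suc: "comps (Suc m) = (\<Union>j\<le>m. (#) j ` comps (m - j))"
proof (intro subset_antisym subsetI)
  fix js assume js: "js \<in> comps (Suc m)"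
  then obtain j js' where "js = j # js'" by (cases js) (auto simp: comps_def)
  with js have "j \<le> m" "js' \<in> comps (m - j)" by (auto simp: comps_def)
  with \<open>js = j # js'\<close> show "js \<in> (\<Union>j\<le>m. (#) j ` comps (m - j))" by blast
qed (auto simp: comps_def)

lemma finite_comps [simp]: "finite (comps m)"
proof (induction m rule: less_induct)
  case (less m)
  then show ?case by (cases m) (auto simp: comps_Suc)
qed

lemma sum_comps_Suc:
  "(\<Sum>js\<in>comps (Suc m). h js) = (\<Sum>j\<le>m. \<Sum>js\<in>comps (m - j). h (j # js))"
  unfolding comps_Suc by (subst sum.UNION_disjoint) (auto simp: sum.reindex)

locale ranged_walk =
  fixes p :: "(int ^ 'd) list \<Rightarrow> (int ^ 'd) pmf" and L :: real
  assumes translation: "translation_invariant p" and range: "range_at_most p L"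
begin

lemma pmf_out_of_range: "xs \<noteq> [] \<Longrightarrow> y - last xs \<notin> step_box L \<Longrightarrow> pmf (p xs) y = 0"
  using range by (auto simp: range_at_most_def step_box_def)

lemma sum_pmf_nbrs: "xs \<noteq> [] \<Longrightarrow> (\<Sum>y\<in>nbrs L xs. pmf (p xs) y) = 1"
  by (rule sum_pmf_eq_1) (auto simp: mem_nbrs set_pmf_eq intro: ccontr dest: pmf_out_of_range)

abbreviation future :: "real ^ 'd \<Rightarrow> nat \<Rightarrow> (int ^ 'd) list \<Rightarrow> complex" where
  "future k n \<equiv> psum L (\<lambda>xs. pmf (p xs)) n (\<lambda>v. wave k (last v))"

text \<open>
  Translation invariance is what allows a path without history to be moved to the origin; its
  starting point contributes only the factor \<open>wave k v\<close>.
\<close>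

lemma future_shift:
  "xs \<noteq> [] \<Longrightarrow> future k n (map (\<lambda>x. x + v) xs) = wave k v * future k n xs"
proof (induction n arbitrary: xs)
  case 0
  then show ?case by (simp add: last_map wave_add)
next
  case (Suc n)
  have nb: "nbrs L (map (\<lambda>x. x + v) xs) = (\<lambda>y. y + v) ` nbrs L xs"
    using Suc.prems by (auto simp: nbrs_def last_map image_image algebra_simps)
  have "future k (Suc n) (map (\<lambda>x. x + v) xs)
      = (\<Sum>y\<in>nbrs L xs. pmf (p (map (\<lambda>x. x + v) xs)) (y + v) *\<^sub>R future k n (map (\<lambda>x. x + v) (xs @ [y])))"
    by (simp add: nb sum.reindex)
  also have "\<dots> = (\<Sum>y\<in>nbrs L xs. pmf (p xs) y *\<^sub>R (wave k v * future k n (xs @ [y])))"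
    using Suc translation by (intro sum.cong) (simp_all add: translation_invariant_def del: map_append)
  finally show ?case by (simp add: sum_distrib_left)
qed

lemma future_single: "future k n [x] = wave k x * future k n [0]"
  using future_shift[where xs = "[0]" and v = x] by simp

definition hist :: "(int ^ 'd) list \<Rightarrow> (int ^ 'd) list \<Rightarrow> int ^ 'd \<Rightarrow> real" where
  "hist \<eta> w = pmf (p (path_concat \<eta> w))"

lemma psum_hist:
  assumes "\<eta> \<noteq> []" "w \<noteq> []" "last \<eta> = hd w"
  shows "psum L (hist \<eta>) n (\<lambda>v. wave k (last v)) w = future k n (path_concat \<eta> w)"
  using assms
proof (induction n arbitrary: w)
  case 0
  then show ?case by (cases w rule: rev_cases) (auto simp: path_concat_def tl_append split: list.splits)
next
  case (Suc n)
  have "last (path_concat \<eta> w) = last w"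
    using Suc.prems by (cases w) (auto simp: path_concat_def)
  then have nb: "nbrs L (path_concat \<eta> w) = nbrs L w" by (rule nbrs_cong)
  have "path_concat \<eta> w @ [y] = path_concat \<eta> (w @ [y])" for y
    using Suc.prems by (cases w) (auto simp: path_concat_def)
  then show ?case using Suc by (simp add: nb hist_def)
qed

text \<open>
  The walk follows the history \<open>\<eta>\<close> for \<open>j\<close> steps and takes step \<open>j + 1\<close> with the difference of the
  probabilities with and without \<open>\<eta>\<close>. The continuation \<open>F\<close> is given only the path that starts at
  the end of \<open>\<eta>\<close>.
\<close>

definition gap :: "(int ^ 'd) list \<Rightarrow> nat \<Rightarrow> ((int ^ 'd) list \<Rightarrow> complex) \<Rightarrow> complex" where
  "gap \<eta> j F = psum L (hist \<eta>) j
     (\<lambda>v. \<Sum>y\<in>nbrs L v. (hist \<eta> v y - pmf (p v) y) *\<^sub>R F (v @ [y])) [last \<eta>]"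

lemma gap_sum: "gap \<eta> j (\<lambda>v. \<Sum>i\<in>I. F i v) = (\<Sum>i\<in>I. gap \<eta> j (F i))"
  unfolding gap_def scaleR_right.sum by (subst sum.swap) (rule psum_sum)

lemma gap_mult_right: "gap \<eta> j (\<lambda>v. F v * c) = gap \<eta> j F * c"
proof -
  have "gap \<eta> j (\<lambda>v. F v * c) = psum L (hist \<eta>) j
      (\<lambda>v. (\<Sum>y\<in>nbrs L v. (hist \<eta> v y - pmf (p v) y) *\<^sub>R F (v @ [y])) * c) [last \<eta>]"
    by (simp add: gap_def sum_distrib_right)
  then show ?thesis by (simp only: psum_mult_right gap_def)
qed

lemma gap_eq_sum:
  "gap \<eta> j F = (\<Sum>w\<in>extensions L (Suc j) [last \<eta>]. (history_prob p \<eta> j w * Delta p \<eta> j w) *\<^sub>R F w)"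
  using psum_step_eq_sum[of "[last \<eta>]" L "hist \<eta>" j "\<lambda>v y. hist \<eta> v y - pmf (p v) y" F]
  by (simp add: gap_def history_prob_def Delta_def hist_def atLeast0LessThan del: extensions.simps)

lemma gap_cong:
  assumes "\<And>w. w \<noteq> [] \<Longrightarrow> F w = G w" shows "gap \<eta> j F = gap \<eta> j G"
proof -
  have "w \<noteq> []" if "w \<in> extensions L (Suc j) [last \<eta>]" for w
    using that by (auto simp: extensions_iff simp del: extensions.simps)
  then show ?thesis unfolding gap_eq_sum using assms by (intro sum.cong refl) simp
qed

text \<open>
  Either \<open>\<eta>\<close> is forgotten throughout, or there is a step where the two transition probabilities
  differ, and from there on only the path walked since the end of \<open>\<eta>\<close> is remembered.
\<close>

lemma future_forget_history:
  assumes "\<eta> \<noteq> []"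
  shows "future k n \<eta> = wave k (last \<eta>) * future k n [0] + (\<Sum>j<n. gap \<eta> j (future k (n - 1 - j)))"
proof -
  have "future k n \<eta> = psum L (hist \<eta>) n (\<lambda>v. wave k (last v)) [last \<eta>]"
    using psum_hist[of \<eta> "[last \<eta>]"] assms by (simp add: path_concat_def)
  also have "\<dots> = future k n [last \<eta>] + (\<Sum>j<n. gap \<eta> j (future k (n - 1 - j)))"
    unfolding gap_def by (rule psum_telescope)
  also have "future k n [last \<eta>] = wave k (last \<eta>) * future k n [0]" by (rule future_single)
  finally show ?thesis .
qed

text \<open>
  The contribution of one tuple of indices. Each path is the history of the next one, and of that one
  only.
\<close>

primrec laces :: "real ^ 'd \<Rightarrow> nat list \<Rightarrow> (int ^ 'd) list \<Rightarrow> complex" where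
  "laces k [] \<eta> = wave k (last \<eta>)"
| "laces k (j # js) \<eta> = gap \<eta> j (laces k js)"

definition lace_sum :: "real ^ 'd \<Rightarrow> nat \<Rightarrow> (int ^ 'd) list \<Rightarrow> complex" where
  "lace_sum k m \<eta> = (\<Sum>js\<in>comps m. laces k js \<eta>)"

lemma lace_sum_0: "lace_sum k 0 \<eta> = wave k (last \<eta>)"
  by (simp add: lace_sum_def)

lemma lace_sum_Suc: "lace_sum k (Suc m) \<eta> = (\<Sum>j\<le>m. gap \<eta> j (lace_sum k (m - j)))"
  unfolding lace_sum_def sum_comps_Suc by (simp add: gap_sum)

text \<open>
  Iteration of the preceding lemma: the path that replaces \<open>\<eta>\<close> as the history is treated in the
  same way until nothing is remembered. Every remembered path has at least one step, so this ends.
\<close>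

lemma future_expansion:
  "\<eta> \<noteq> [] \<Longrightarrow> future k n \<eta> = (\<Sum>m\<le>n. lace_sum k m \<eta> * future k (n - m) [0])"
proof (induction n arbitrary: \<eta> rule: less_induct)
  case (less n)
  show ?case
  proof (cases n)
    case 0
    then show ?thesis using less.prems by (simp add: lace_sum_0)
  next
    case (Suc n')
    have "(\<Sum>j<n. gap \<eta> j (future k (n - 1 - j)))
        = (\<Sum>j\<le>n'. gap \<eta> j (\<lambda>v. \<Sum>m\<le>n' - j. lace_sum k m v * future k (n' - j - m) [0]))"
      unfolding Suc lessThan_Suc_atMost
    proof (intro sum.cong refl gap_cong)
      fix j w assume "j \<in> {..n'}" "(w :: (int ^ 'd) list) \<noteq> []"
      then show "future k (Suc n' - 1 - j) w = (\<Sum>m\<le>n' - j. lace_sum k m w * future k (n' - j - m) [0])"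
        using less.IH[of "n' - j" w] Suc by simp
    qed
    also have "\<dots> = (\<Sum>j\<le>n'. \<Sum>m\<le>n' - j. gap \<eta> j (lace_sum k m) * future k (n' - (j + m)) [0])"
      by (simp add: gap_sum gap_mult_right)
    also have "\<dots> = (\<Sum>(j, m)\<in>(SIGMA j:{..n'}. {..n' - j}). gap \<eta> j (lace_sum k m) * future k (n' - (j + m)) [0])"
      by (subst sum.Sigma) auto
    also have "(SIGMA j:{..n'}. {..n' - j}) = {(j, m). j + m \<le> n'}" by auto
    also have "(\<Sum>(j, m)\<in>{(j, m). j + m \<le> n'}. gap \<eta> j (lace_sum k m) * future k (n' - (j + m)) [0])
       = (\<Sum>M\<le>n'. \<Sum>j\<le>M. gap \<eta> j (lace_sum k (M - j)) * future k (n' - (j + (M - j))) [0])"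
      by (rule sum.triangle_reindex_eq)
    also have "\<dots> = (\<Sum>M\<le>n'. lace_sum k (Suc M) \<eta> * future k (n - Suc M) [0])"
      by (simp add: lace_sum_Suc sum_distrib_right Suc)
    finally show ?thesis
      using future_forget_history[OF less.prems, where k = k and n = n]
      by (simp add: Suc sum.atMost_Suc_shift lace_sum_0 del: sum.atMost_Suc psum.simps)
  qed
qed

text \<open>
  The coefficient of index \<open>m \<ge> 2\<close> turns out to be \<open>pi_hat p m k\<close>; at \<open>m = 1\<close> it is the transform of
  the distribution of a single step.
\<close>

definition expansion_coeff :: "real ^ 'd \<Rightarrow> nat \<Rightarrow> complex" where
  "expansion_coeff k m = (\<Sum>x\<in>nbrs L [0]. step_dist p x *\<^sub>R lace_sum k (m - 1) [0, x])"

lemma expansion_coeff_1: "expansion_coeff k 1 = (\<Sum>x\<in>nbrs L [0]. step_dist p x *\<^sub>R wave k x)"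
  by (simp add: expansion_coeff_def lace_sum_0)

lemma future_recursion:
  "future k (Suc n) [0] = expansion_coeff k 1 * future k n [0] + (\<Sum>m=2..n + 1. expansion_coeff k m * future k (n + 1 - m) [0])"
proof -
  have "future k (Suc n) [0] = (\<Sum>x\<in>nbrs L [0]. step_dist p x *\<^sub>R (\<Sum>m\<le>n. lace_sum k m [0, x] * future k (n - m) [0]))"
    by (simp add: step_dist_def future_expansion[of "[0, _]"])
  also have "\<dots> = (\<Sum>x\<in>nbrs L [0]. \<Sum>m\<le>n. step_dist p x *\<^sub>R lace_sum k m [0, x] * future k (n - m) [0])"
    by (simp add: scaleR_right.sum)
  also have "\<dots> = (\<Sum>m\<le>n. expansion_coeff k (Suc m) * future k (n - m) [0])"
    by (subst sum.swap) (simp add: expansion_coeff_def sum_distrib_right)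
  also have "\<dots> = (\<Sum>m=1..n + 1. expansion_coeff k m * future k (n + 1 - m) [0])"
    by (subst sum.atLeast1_atMost_eq[folded One_nat_def]) (simp add: lessThan_Suc_atMost del: sum.lessThan_Suc)
  also have "\<dots> = expansion_coeff k 1 * future k n [0] + (\<Sum>m=2..n + 1. expansion_coeff k m * future k (n + 1 - m) [0])"
    by (subst sum.atLeast_Suc_atMost) (auto simp: numeral_2_eq_2)
  finally show ?thesis .
qed

end


section \<open>Coefficients as sums over tuples of paths\<close>

text \<open>
  Tuples of paths with steps of length at most \<open>L\<close>. Unlike \<open>path_tuples\<close> this is a finite set, and
  its recursion over the list of indices matches that of \<open>laces\<close>.
\<close>

primrec chains :: "real \<Rightarrow> nat list \<Rightarrow> (int ^ 'd) list \<Rightarrow> (int ^ 'd) list list set" where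
  "chains L [] \<eta> = {[]}"
| "chains L (j # js) \<eta> = (\<Union>w\<in>extensions L (Suc j) [last \<eta>]. (#) w ` chains L js w)"

lemma finite_chains [simp]: "finite (chains L js \<eta>)"
  by (induction js arbitrary: \<eta>) (auto simp del: extensions.simps)

lemma chains_iff:
  "ws \<in> chains L js \<eta> \<longleftrightarrow> length ws = length js \<and>
    (\<forall>n<length js. ws ! n \<in> extensions L (Suc (js ! n)) [last ((\<eta> # ws) ! n)])"
proof (induction js arbitrary: ws \<eta>)
  case (Cons j js)
  show ?case
  proof (cases ws)
    case (Cons w ws')
    have "ws \<in> chains L (j # js) \<eta> \<longleftrightarrow> w \<in> extensions L (Suc j) [last \<eta>] \<and> ws' \<in> chains L js w"
      by (auto simp: Cons simp del: extensions.simps)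
    then show ?thesis
      by (auto simp: Cons Cons.IH All_less_Suc2 simp del: extensions.simps)
  qed (auto simp del: extensions.simps)
qed auto

lemma sum_chains_Cons:
  "(\<Sum>ws\<in>chains L (j # js) \<eta>. h ws)
    = (\<Sum>w\<in>extensions L (Suc j) [last \<eta>]. \<Sum>ws\<in>chains L js w. h (w # ws))"
  unfolding chains.simps by (subst sum.UNION_disjoint) (auto simp: sum.reindex simp del: extensions.simps)

definition chain_weight ::
  "((int ^ 'd) list \<Rightarrow> (int ^ 'd) pmf) \<Rightarrow> nat list \<Rightarrow> (int ^ 'd) list \<Rightarrow> (int ^ 'd) list list \<Rightarrow> real" where
  "chain_weight p js \<eta> ws = (\<Prod>n<length js. Delta p ((\<eta> # ws) ! n) (js ! n) (ws ! n)
     * history_prob p ((\<eta> # ws) ! n) (js ! n) (ws ! n))"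

lemma chain_weight_Cons:
  "chain_weight p (j # js) \<eta> (w # ws) = history_prob p \<eta> j w * Delta p \<eta> j w * chain_weight p js w ws"
  unfolding chain_weight_def by (simp add: prod.lessThan_Suc_shift del: prod.lessThan_Suc)

lemma fourier_sum_of_points:
  assumes "finite I"
  shows "fourier (\<lambda>y. \<Sum>i\<in>I. of_bool (z i = y) * c i) k = (\<Sum>i\<in>I. c i *\<^sub>R wave k (z i))"
proof -
  let ?f = "\<lambda>y. \<Sum>i\<in>I. of_bool (z i = y) * c i"
  have "fourier ?f k = (\<Sum>\<^sub>\<infinity>y\<in>z ` I. wave k y * complex_of_real (?f y))"
    unfolding fourier_def wave_def by (rule infsum_cong_neutral) (auto intro!: sum.neutral)
  also have "\<dots> = (\<Sum>y\<in>z ` I. wave k y * complex_of_real (?f y))"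
    using assms by simp
  also have "\<dots> = (\<Sum>i\<in>I. \<Sum>y\<in>z ` I. if y = z i then c i *\<^sub>R wave k y else 0)"
    by (subst sum.swap) (auto simp: sum_distrib_left scaleR_conv_of_real intro!: sum.cong)
  also have "\<dots> = (\<Sum>i\<in>I. c i *\<^sub>R wave k (z i))"
    using assms by (intro sum.cong refl) (simp add: sum.delta)
  finally show ?thesis .
qed

context ranged_walk
begin

lemma laces_eq_sum:
  "laces k js \<eta> = (\<Sum>ws\<in>chains L js \<eta>. chain_weight p js \<eta> ws *\<^sub>R wave k (last (last (\<eta> # ws))))"
proof (induction js arbitrary: \<eta>)
  case Nil
  then show ?case by (simp add: chain_weight_def)
next
  case (Cons j js)
  show ?case
    unfolding sum_chains_Cons laces.simps gap_eq_sum Cons.IH scaleR_right.sum chain_weight_Cons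
    by simp
qed

definition tuple_weight :: "nat list \<Rightarrow> (int ^ 'd) list list \<Rightarrow> real" where
  "tuple_weight js ws = step_dist p (ws ! 0 ! 1) *
     (\<Prod>n=1..length js. Delta p (ws ! (n - 1)) (js ! (n - 1)) (ws ! n) *
        history_prob p (ws ! (n - 1)) (js ! (n - 1)) (ws ! n))"

lemma tuple_weight_Cons: "tuple_weight js (w # ws) = step_dist p (w ! 1) * chain_weight p js w ws"
  by (simp add: tuple_weight_def chain_weight_def prod.atLeast1_atMost_eq)

lemma sum_first_step:
  "(\<Sum>x\<in>nbrs L [0]. step_dist p x *\<^sub>R laces k js [0, x])
    = (\<Sum>ws\<in>chains L (0 # js) [0]. tuple_weight js ws *\<^sub>R wave k (last (last ws)))"
proof -
  have "extensions L (Suc 0) [0 :: int ^ 'd] = (\<lambda>x. [0, x]) ` nbrs L [0]" by auto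
  moreover have "inj (\<lambda>x. [0 :: int ^ 'd, x])" by (auto simp: inj_on_def)
  ultimately show ?thesis
    unfolding sum_chains_Cons tuple_weight_Cons laces_eq_sum
    by (simp add: sum.reindex inj_on_subset[of _ UNIV] o_def scaleR_right.sum del: extensions.simps)
qed

lemma chains_subset_path_tuples: "chains L (0 # js) [0] \<subseteq> path_tuples js"
proof
  fix ws assume "ws \<in> chains L (0 # js) [0]"
  then have len: "length ws = length js + 1"
    and ext: "\<And>n. n \<le> length js \<Longrightarrow> ws ! n \<in> extensions L (Suc ((0 # js) ! n)) [last (([0] # ws) ! n)]"
    by (auto simp: chains_iff less_Suc_eq_le simp del: extensions.simps chains.simps)
  have 1: "length (ws ! n) = (0 # js) ! n + 2 \<and> hd (ws ! n) = last (([0] # ws) ! n)" if "n \<le> length js" for n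
    using ext[OF that] by (auto simp: extensions_iff simp del: extensions.simps) (cases "ws ! n"; simp)
  show "ws \<in> path_tuples js"
    unfolding path_tuples_def using 1 len by (auto simp: nth_Cons split: nat.splits)
qed

text \<open>
  A step that is too long makes either a transition probability or both terms of a difference
  \<open>Delta\<close> vanish. For the difference it matters that the history ends where the path begins, so
  that both terms concern a step from the same site.
\<close>

lemma tuple_weight_eq_0:
  assumes ws: "ws \<in> path_tuples js" and out: "ws \<notin> chains L (0 # js) [0]"
  shows "tuple_weight js ws = 0"
proof -
  have len: "length ws = length js + 1" and lenw: "\<And>n. n \<le> length js \<Longrightarrow> length (ws ! n) = (0 # js) ! n + 2"
    and hd0: "hd (ws ! 0) = 0" and hdn: "\<And>n. 1 \<le> n \<Longrightarrow> n \<le> length js \<Longrightarrow> hd (ws ! n) = last (ws ! (n - 1))"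
    using ws by (auto simp: path_tuples_def)
  have hd': "hd (ws ! n) = last (([0] # ws) ! n)" if "n \<le> length js" for n
    using hd0 hdn[of n] that by (cases n) auto
  obtain n where n: "n \<le> length js" and ne: "ws ! n \<notin> extensions L (Suc ((0 # js) ! n)) [last (([0] # ws) ! n)]"
    using out len by (auto simp: chains_iff less_Suc_eq_le simp del: extensions.simps chains.simps)
  define w where "w = ws ! n"
  have lw: "length w = (0 # js) ! n + 2" using lenw n by (simp add: w_def)
  then have tk: "take 1 w = [hd w]" by (cases w) auto
  obtain i where i: "i \<le> (0 # js) ! n" and st: "w ! (i + 1) - w ! i \<notin> step_box L"
    using ne lw tk hd'[OF n] by (auto simp: extensions_iff w_def[symmetric] less_Suc_eq_le simp del: extensions.simps)
  have last_take: "last (take (i + 1) w) = w ! i" using i lw by (simp add: take_Suc_conv_app_nth)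
  have tne: "take (i + 1) w \<noteq> []" using lw by auto
  have zero: "pmf (p (take (i + 1) w)) (w ! (i + 1)) = 0"
    using tne st last_take by (intro pmf_out_of_range) auto
  show ?thesis
  proof (cases n)
    case 0
    then have "i = 0" using i by simp
    moreover have "take 1 w = [0]" using tk hd0 by (simp add: w_def 0)
    ultimately have "step_dist p (w ! 1) = 0" using zero by (simp add: step_dist_def)
    then show ?thesis by (simp add: tuple_weight_def w_def 0)
  next
    case (Suc n')
    define \<eta> where "\<eta> = ws ! n'"
    define j where "j = js ! n'"
    have \<eta>: "\<eta> \<noteq> []" using lenw[of n'] n Suc by (auto simp: \<eta>_def)
    have "hd w = last \<eta>" using hd'[OF n] by (simp add: Suc w_def \<eta>_def)
    then have "last (path_concat \<eta> (take (i + 1) w)) = last (take (i + 1) w)"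
      using \<eta> lw by (cases w; cases "take i (tl w)") (auto simp: path_concat_def)
    then have zero': "pmf (p (path_concat \<eta> (take (i + 1) w))) (w ! (i + 1)) = 0"
      using \<eta> st last_take by (intro pmf_out_of_range) (auto simp: path_concat_def)
    have ij: "i \<le> j" using i by (simp add: Suc j_def)
    have "Delta p \<eta> j w * history_prob p \<eta> j w = 0"
    proof (cases "i = j")
      case True
      then show ?thesis using zero zero' by (simp add: Delta_def)
    next
      case False
      then have "history_prob p \<eta> j w = 0"
        unfolding history_prob_def using zero' ij by (intro prod_zero) auto
      then show ?thesis by simp
    qed
    then have "(\<Prod>n=1..length js. Delta p (ws ! (n - 1)) (js ! (n - 1)) (ws ! n) *
        history_prob p (ws ! (n - 1)) (js ! (n - 1)) (ws ! n)) = 0"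
      using n Suc by (intro prod_zero) (auto intro!: bexI[of _ n] simp: w_def \<eta>_def j_def)
    then show ?thesis by (simp add: tuple_weight_def)
  qed
qed

lemma pi_coeff_N_eq:
  "pi_coeff_N p m N y
    = (\<Sum>js\<in>index_tuples m N. \<Sum>ws\<in>chains L (0 # js) [0]. of_bool (last (last ws) = y) * tuple_weight js ws)"
  unfolding pi_coeff_N_def
proof (rule sum.cong[OF refl])
  fix js assume "js \<in> index_tuples m N"
  then have N: "N = length js" by (auto simp: index_tuples_def)
  have "(\<Sum>\<^sub>\<infinity>ws\<in>path_tuples js. of_bool (last (ws ! N) = y) * step_dist p (ws ! 0 ! 1) *
        (\<Prod>n=1..N. Delta p (ws ! (n - 1)) (js ! (n - 1)) (ws ! n) *
                     history_prob p (ws ! (n - 1)) (js ! (n - 1)) (ws ! n)))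
      = (\<Sum>\<^sub>\<infinity>ws\<in>chains L (0 # js) [0]. of_bool (last (last ws) = y) * tuple_weight js ws)"
  proof (rule infsum_cong_neutral)
    fix ws :: "(int ^ 'd) list list" assume "ws \<in> path_tuples js - chains L (0 # js) [0]"
    then have "tuple_weight js ws = 0" using tuple_weight_eq_0 by blast
    then show "of_bool (last (ws ! N) = y) * step_dist p (ws ! 0 ! 1) *
        (\<Prod>n=1..N. Delta p (ws ! (n - 1)) (js ! (n - 1)) (ws ! n) *
                     history_prob p (ws ! (n - 1)) (js ! (n - 1)) (ws ! n)) = 0"
      by (auto simp: tuple_weight_def N)
  next
    fix ws :: "(int ^ 'd) list list" assume "ws \<in> path_tuples js \<inter> chains L (0 # js) [0]"
    then have "last ws = ws ! N" by (subst last_conv_nth) (auto simp: path_tuples_def N)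
    then show "of_bool (last (ws ! N) = y) * step_dist p (ws ! 0 ! 1) *
        (\<Prod>n=1..N. Delta p (ws ! (n - 1)) (js ! (n - 1)) (ws ! n) *
                     history_prob p (ws ! (n - 1)) (js ! (n - 1)) (ws ! n))
       = of_bool (last (last ws) = y) * tuple_weight js ws"
      by (simp add: tuple_weight_def N)
  qed (use chains_subset_path_tuples in blast)
  then show "(\<Sum>\<^sub>\<infinity>ws\<in>path_tuples js. of_bool (last (ws ! N) = y) * step_dist p (ws ! 0 ! 1) *
        (\<Prod>n=1..N. Delta p (ws ! (n - 1)) (js ! (n - 1)) (ws ! n) *
                     history_prob p (ws ! (n - 1)) (js ! (n - 1)) (ws ! n)))
    = (\<Sum>ws\<in>chains L (0 # js) [0]. of_bool (last (last ws) = y) * tuple_weight js ws)" by simp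
qed

text \<open>
  The sum over \<open>N\<close> and over the tuples with \<open>N\<close> entries is a single sum over \<open>comps (m - 1)\<close>. The
  assumption \<open>2 \<le> m\<close> excludes the empty tuple, which would be \<open>N = 0\<close>.
\<close>

lemma pi_coeff_eq:
  assumes "2 \<le> m"
  shows "pi_coeff p m y = (\<Sum>(js, ws)\<in>(SIGMA js:comps (m - 1). chains L (0 # js) [0]).
    of_bool (last (last ws) = y) * tuple_weight js ws)"
proof -
  let ?h = "\<lambda>js. \<Sum>ws\<in>chains L (0 # js) [0]. of_bool (last (last ws) = y) * tuple_weight js ws"
  have ind: "index_tuples m (Suc N) = {js \<in> comps (m - 1). length js - 1 = N}" for N
  proof -
    have "js \<noteq> []" if "sum_list js + length js = m - 1" for js using that assms by auto
    then show ?thesis using assms by (fastforce simp: index_tuples_def comps_def)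
  qed
  have "pi_coeff p m y = (\<Sum>N<m. pi_coeff_N p m (Suc N) y)"
    unfolding pi_coeff_def
  proof (rule suminf_finite)
    fix N assume "N \<notin> {..<m}"
    then have "index_tuples m (Suc N) = {}" by (auto simp: index_tuples_def)
    then show "pi_coeff_N p m (Suc N) y = 0" by (simp add: pi_coeff_N_def)
  qed simp
  also have "\<dots> = (\<Sum>N<m. \<Sum>js\<in>{js \<in> comps (m - 1). length js - 1 = N}. ?h js)"
    by (simp only: pi_coeff_N_eq ind)
  also have "\<dots> = (\<Sum>js\<in>comps (m - 1). ?h js)"
    using assms by (intro sum.group finite_comps) (auto simp: comps_def)
  also have "\<dots> = (\<Sum>(js, ws)\<in>(SIGMA js:comps (m - 1). chains L (0 # js) [0]).
      of_bool (last (last ws) = y) * tuple_weight js ws)"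
    by (rule sum.Sigma) (auto simp del: chains.simps)
  finally show ?thesis .
qed

lemma finite_support_pi_coeff:
  assumes "2 \<le> m"
  shows "finite {y. pi_coeff p m y \<noteq> 0}"
proof (rule finite_subset)
  show "{y. pi_coeff p m y \<noteq> 0}
    \<subseteq> (\<lambda>(js, ws). last (last ws)) ` (SIGMA js:comps (m - 1). chains L (0 # js) [0])" (is "_ \<subseteq> ?A")
  proof
    fix y assume y: "y \<in> {y. pi_coeff p m y \<noteq> 0}"
    show "y \<in> ?A"
    proof (rule ccontr)
      assume "y \<notin> ?A"
      then have "pi_coeff p m y = 0"
        unfolding pi_coeff_eq[OF assms] by (intro sum.neutral) (auto simp del: chains.simps)
      with y show False by simp
    qed
  qed
qed (auto simp del: chains.simps)

lemma pi_hat_eq_expansion_coeff: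
  assumes "2 \<le> m"
  shows "pi_hat p m k = expansion_coeff k m"
proof -
  let ?I = "SIGMA js:comps (m - 1). chains L (0 # js) [0]"
  have "pi_coeff p m = (\<lambda>y. \<Sum>i\<in>?I. of_bool (last (last (snd i)) = y) * tuple_weight (fst i) (snd i))"
    using pi_coeff_eq[OF assms] by (auto simp: fun_eq_iff case_prod_unfold simp del: chains.simps)
  then have "pi_hat p m k = (\<Sum>i\<in>?I. tuple_weight (fst i) (snd i) *\<^sub>R wave k (last (last (snd i))))"
    by (simp only:) (rule fourier_sum_of_points, auto simp del: chains.simps)
  also have "\<dots> = (\<Sum>(js, ws)\<in>?I. tuple_weight js ws *\<^sub>R wave k (last (last ws)))"
    by (simp add: case_prod_unfold del: chains.simps)
  also have "\<dots> = (\<Sum>js\<in>comps (m - 1). \<Sum>ws\<in>chains L (0 # js) [0]. tuple_weight js ws *\<^sub>R wave k (last (last ws)))"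
    by (rule sum.Sigma[symmetric]) (auto simp del: chains.simps)
  also have "\<dots> = (\<Sum>js\<in>comps (m - 1). \<Sum>x\<in>nbrs L [0]. step_dist p x *\<^sub>R laces k js [0, x])"
    by (simp only: sum_first_step)
  also have "\<dots> = expansion_coeff k m"
    unfolding expansion_coeff_def lace_sum_def scaleR_right.sum by (rule sum.swap)
  finally show ?thesis .
qed

end


section \<open>The law of the endpoint\<close>

context ranged_walk
begin

definition path_prob :: "nat \<Rightarrow> (int ^ 'd) list \<Rightarrow> real" where
  "path_prob n v = (\<Prod>i<n. pmf (p (take (i + 1) v)) (v ! (i + 1)))"

lemma path_prob_nonneg: "0 \<le> path_prob n v"
  by (simp add: path_prob_def prod_nonneg)

lemma psum_eq_path_sum:
  "psum L (\<lambda>xs. pmf (p xs)) n F [0] = (\<Sum>v\<in>extensions L n [0]. path_prob n v *\<^sub>R F v)"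
  by (subst psum_eq_sum) (simp_all add: path_prob_def atLeast0LessThan)

lemma sum_path_prob: "(\<Sum>v\<in>extensions L n [0]. path_prob n v) = 1"
proof -
  have "psum L (\<lambda>xs. pmf (p xs)) n (\<lambda>_. 1 :: real) xs = 1" if "xs \<noteq> []" for xs
    using that by (induction n arbitrary: xs) (auto simp: sum_pmf_nbrs)
  from this[of "[0]"] show ?thesis by (simp add: psum_eq_path_sum)
qed

text \<open>
  The cylinder events of the paths with steps of length at most \<open>L\<close> are disjoint and have total
  probability one, so expectations of the endpoint are finite sums.
\<close>

lemma has_bochner_integral_endpoint:
  fixes \<phi> :: "int ^ 'd \<Rightarrow> 'v::{banach, second_countable_topology}"
  assumes "walk_law p Q"
  shows "has_bochner_integral Q (\<lambda>w. \<phi> (w n)) (\<Sum>v\<in>extensions L n [0]. path_prob n v *\<^sub>R \<phi> (last v))"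
proof -
  from assms interpret prob_space Q by (simp add: walk_law_def)
  let ?V = "extensions L n [0 :: int ^ 'd]"
  define C where "C v = {w \<in> space Q. \<forall>i\<le>n. w i = v ! i}" for v :: "(int ^ 'd) list"
  have V: "length v = n + 1" "v ! 0 = 0" if "v \<in> ?V" for v
  proof -
    from that have "length v = n + 1" "take 1 v = [0]" by (auto simp: extensions_iff)
    then show "length v = n + 1" "v ! 0 = 0" by (cases v; auto)+
  qed
  have prob_C: "prob (C v) = path_prob n v" if "v \<in> ?V" for v
    using assms V[OF that] by (simp add: walk_law_def C_def path_prob_def)
  have sets: "sets Q = sets (PiM UNIV (\<lambda>_. count_space UNIV))" using assms by (simp add: walk_law_def)
  have comp: "(\<lambda>w. w i) \<in> measurable Q (count_space UNIV)" for i
    using measurable_component_singleton[of i UNIV "\<lambda>_. count_space UNIV"]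
    by (simp add: measurable_cong_sets[OF sets refl])
  have meas_C: "C v \<in> sets Q" for v
  proof -
    have single: "{w \<in> space Q. w i = v ! i} \<in> sets Q" for i
    proof -
      have "(\<lambda>w. w i) -` {v ! i} \<inter> space Q \<in> sets Q" by (rule measurable_sets[OF comp]) simp
      moreover have "(\<lambda>w. w i) -` {v ! i} \<inter> space Q = {w \<in> space Q. w i = v ! i}" by auto
      ultimately show ?thesis by simp
    qed
    have "{w \<in> space Q. \<forall>i\<in>{..n}. w i = v ! i} \<in> sets Q"
      by (rule sets.sets_Collect_finite_All[OF single]) simp
    then show ?thesis unfolding C_def Ball_def atMost_iff .
  qed
  have eq: "u = v" if "u \<in> ?V" "v \<in> ?V" "w \<in> C u" "w \<in> C v" for u v w
  proof (rule nth_equalityI)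
    show "length u = length v" using V(1)[OF that(1)] V(1)[OF that(2)] by simp
    fix i assume "i < length u"
    then have "i \<le> n" using V(1)[OF that(1)] by simp
    then have "w i = u ! i" "w i = v ! i" using that(3,4) unfolding C_def by blast+
    then show "u ! i = v ! i" by simp
  qed
  have "prob (\<Union>v\<in>?V. C v) = (\<Sum>v\<in>?V. prob (C v))"
    using meas_C eq by (intro finite_measure_finite_Union) (auto simp: disjoint_family_on_def)
  also have "\<dots> = 1" using sum_path_prob[of n] by (simp add: prob_C)
  finally have ae: "AE w in Q. w \<in> (\<Union>v\<in>?V. C v)"
    using meas_C by (subst (asm) prob_eq_1) auto
  have "has_bochner_integral Q (\<lambda>w. \<Sum>v\<in>?V. indicator (C v) w *\<^sub>R \<phi> (last v))
      (\<Sum>v\<in>?V. prob (C v) *\<^sub>R \<phi> (last v))"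
    using meas_C by (intro has_bochner_integral_sum has_bochner_integral_indicator) (auto simp: emeasure_eq_measure less_top[symmetric])
  moreover have "(\<Sum>v\<in>?V. prob (C v) *\<^sub>R \<phi> (last v)) = (\<Sum>v\<in>?V. path_prob n v *\<^sub>R \<phi> (last v))"
    by (simp add: prob_C)
  moreover have "has_bochner_integral Q (\<lambda>w. \<Sum>v\<in>?V. indicator (C v) w *\<^sub>R \<phi> (last v)) x
      \<longleftrightarrow> has_bochner_integral Q (\<lambda>w. \<phi> (w n)) x" for x
  proof (rule has_bochner_integral_cong_AE)
    show "(\<lambda>w. \<phi> (w n)) \<in> borel_measurable Q"
      using comp by (rule measurable_compose) simp
    show "(\<lambda>w. \<Sum>v\<in>?V. indicator (C v) w *\<^sub>R \<phi> (last v)) \<in> borel_measurable Q"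
      using meas_C by measurable
    show "AE w in Q. (\<Sum>v\<in>?V. indicator (C v) w *\<^sub>R \<phi> (last v)) = \<phi> (w n)"
      using ae
    proof eventually_elim
      case (elim w)
      then obtain v where v: "v \<in> ?V" "w \<in> C v" by auto
      have "(\<Sum>u\<in>?V. indicator (C u) w *\<^sub>R \<phi> (last u)) = (\<Sum>u\<in>?V. if u = v then \<phi> (last u) else 0)"
        using eq v by (intro sum.cong refl) (auto simp: indicator_def)
      also have "\<dots> = \<phi> (last v)" using v by simp
      also have "last v = v ! n" using V[OF v(1)] by (subst last_conv_nth) auto
      also have "v ! n = w n" using v by (simp add: C_def)
      finally show ?case .
    qed
  qed
  ultimately show ?thesis by simp
qed

end

section \<open>Trigonometric polynomials\<close>

text \<open>
  Closed under partial derivatives and under the modulation in the definition of \<open>twisted_hessian\<close>,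
  so that gradients and Hessians at the origin can be read off as moments.
\<close>

definition trig :: "'a set \<Rightarrow> ('a \<Rightarrow> complex) \<Rightarrow> ('a \<Rightarrow> real ^ 'd) \<Rightarrow> real ^ 'd \<Rightarrow> complex" where
  "trig A c v k = (\<Sum>x\<in>A. c x * exp (\<i> * complex_of_real (k \<bullet> v x)))"

lemma has_derivative_trig:
  "(trig A c v has_derivative (\<lambda>h. \<Sum>x\<in>A. c x * (exp (\<i> * complex_of_real (k \<bullet> v x)) * (\<i> * complex_of_real (h \<bullet> v x))))) (at k)"
proof -
  have 1: "((\<lambda>k. \<i> * complex_of_real (k \<bullet> v x)) has_derivative (\<lambda>h. \<i> * complex_of_real (h \<bullet> v x))) (at k)" for x
    by (intro derivative_eq_intros) auto
  have 2: "((\<lambda>k. exp (\<i> * complex_of_real (k \<bullet> v x))) has_derivative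
    (\<lambda>h. exp (\<i> * complex_of_real (k \<bullet> v x)) * (\<i> * complex_of_real (h \<bullet> v x)))) (at k)" for x
    using has_derivative_compose[OF 1 DERIV_exp[unfolded has_field_derivative_def]] by simp
  show ?thesis
    unfolding trig_def[abs_def] by (intro has_derivative_sum has_derivative_mult_right 2)
qed

lemma partial_trig: "partial j (trig A c v) = trig A (\<lambda>x. \<i> * complex_of_real (v x $ j) * c x) v"
proof
  fix k
  show "partial j (trig A c v) k = trig A (\<lambda>x. \<i> * complex_of_real (v x $ j) * c x) v k"
    unfolding partial_def frechet_derivative_at[OF has_derivative_trig, symmetric] trig_def
    by (intro sum.cong refl) (simp add: inner_axis' )
qed

lemma grad_trig_0: "grad (trig A c v) 0 = (\<chi> j. \<i> * (\<Sum>x\<in>A. complex_of_real (v x $ j) * c x))"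
  by (simp add: grad_def partial_trig trig_def sum_distrib_left mult.assoc)

lemma hessian_trig_0:
  "hessian (trig A c v) 0 = (\<chi> i j. - (\<Sum>x\<in>A. complex_of_real (v x $ i * v x $ j) * c x))"
  by (simp add: hessian_def partial_trig vec_eq_iff) (simp add: trig_def sum_negf[symmetric] algebra_simps)

lemma fourier_eq_trig:
  assumes "finite {x. f x \<noteq> 0}"
  shows "fourier f = trig {x. f x \<noteq> 0} (\<lambda>x. complex_of_real (f x)) rvec"
proof
  fix k
  have "fourier f k = (\<Sum>\<^sub>\<infinity>x\<in>{x. f x \<noteq> 0}. exp (\<i> * complex_of_real (k \<bullet> rvec x)) * complex_of_real (f x))"
    unfolding fourier_def by (rule infsum_cong_neutral) auto
  then show "fourier f k = trig {x. f x \<noteq> 0} (\<lambda>x. complex_of_real (f x)) rvec k"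
    using assms by (simp add: trig_def mult.commute)
qed

lemma modulated_trig:
  "exp (- \<i> * complex_of_real ((\<theta> \<bullet> k) * t)) * trig A c v k = trig A c (\<lambda>x. v x - t *\<^sub>R \<theta>) k"
  by (simp add: trig_def sum_distrib_left inner_diff_right inner_commute algebra_simps exp_diff exp_minus field_simps)

section \<open>Moments from the exponential representation\<close>

lemma cmod_exp_second_order:
  fixes z :: complex
  shows "cmod (exp z - (1 + z + z\<^sup>2 / 2)) \<le> exp \<bar>Re z\<bar> * cmod z ^ 3"
proof -
  have "cmod (exp z - (\<Sum>k\<le>2. z ^ k / of_nat (fact k))) \<le> exp \<bar>Re z\<bar> * cmod z ^ Suc 2 / fact 2"
    using Taylor_exp[of z 2] by simp
  also have "\<dots> \<le> exp \<bar>Re z\<bar> * cmod z ^ 3" by (simp add: numeral_3_eq_3 numeral_2_eq_2)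
  finally show ?thesis by (simp add: numeral_2_eq_2 add.assoc)
qed

lemma cmod_exp_i_second_order:
  "cmod (exp (\<i> * complex_of_real x) - (1 + \<i> * complex_of_real x - complex_of_real (x\<^sup>2 / 2))) \<le> \<bar>x\<bar> ^ 3"
  using cmod_exp_second_order[of "\<i> * complex_of_real x"] by (simp add: norm_mult power_mult_distrib)

lemma cmod_exp_i_first_order:
  "cmod (exp (\<i> * complex_of_real x) - (1 + \<i> * complex_of_real x)) \<le> x\<^sup>2"
proof -
  have "cmod (exp (\<i> * complex_of_real x) - (\<Sum>k\<le>1. (\<i> * complex_of_real x) ^ k / of_nat (fact k))) \<le> \<bar>x\<bar> ^ Suc 1 / fact 1"
    using Taylor_exp[of "\<i> * complex_of_real x" 1] by (simp add: norm_mult)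
  then show ?thesis by (simp add: power2_eq_square abs_mult)
qed

lemma cmod_exp_i_zeroth_order: "cmod (exp (\<i> * complex_of_real x) - 1) \<le> \<bar>x\<bar>"
  using Taylor_exp[of "\<i> * complex_of_real x" 0] by (simp add: norm_mult)

lemma le_of_eventually_le_linear:
  fixes x E C t\<^sub>0 :: real
  assumes "0 < t\<^sub>0" and le: "\<And>t. 0 < t \<Longrightarrow> t \<le> t\<^sub>0 \<Longrightarrow> x \<le> E + C * t"
  shows "x \<le> E"
proof (rule tendsto_lowerbound)
  show "((\<lambda>t. E + C * t) \<longlongrightarrow> E) (at_right 0)"
    by (auto intro!: tendsto_eq_intros)
  show "\<forall>\<^sub>F t in at_right 0. x \<le> E + C * t"
    using assms by (auto simp: eventually_at_right intro!: exI[of _ t\<^sub>0])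
qed simp

lemma norm_four_terms: "norm (a + b + c - d) \<le> norm a + norm b + norm c + norm d"
  using norm_triangle_ineq4[of "a + b + c" d] norm_triangle_ineq[of "a + b" c] norm_triangle_ineq[of a b]
  by linarith

text \<open>
  Two expansions of the same function of \<open>t\<close> are compared as \<open>t\<close> tends to \<open>0\<close>. All terms of order \<open>t\<close>
  are imaginary and all explicit terms of order \<open>t^2\<close> are real, so the imaginary part determines the
  mean exactly, although the error term is only bounded by \<open>t^2 * E\<close>, and the real part bounds the
  error of the variance by \<open>2 * E\<close>.
\<close>

lemma cumulants_of_exp_representation:
  fixes w y :: "'a \<Rightarrow> real" and \<mu> q E A t\<^sub>0 :: real
  assumes w: "\<And>v. v \<in> V \<Longrightarrow> 0 \<le> w v" "(\<Sum>v\<in>V. w v) = 1"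
    and t0: "0 < t\<^sub>0" and EA: "0 \<le> E" "0 \<le> A"
    and rep: "\<And>t. 0 < t \<Longrightarrow> t \<le> t\<^sub>0 \<Longrightarrow> \<exists>R. (\<Sum>v\<in>V. w v *\<^sub>R exp (\<i> * complex_of_real (t * y v)))
        = exp (\<i> * complex_of_real (t * \<mu>) - complex_of_real (t\<^sup>2 * q / 2) + R) \<and> cmod R \<le> t\<^sup>2 * E + t ^ 3 * A"
  shows "(\<Sum>v\<in>V. w v * y v) = \<mu>"
    and "\<bar>(\<Sum>v\<in>V. w v * (y v)\<^sup>2) - \<mu>\<^sup>2 - q\<bar> \<le> 2 * E"
proof -
  define M\<^sub>1 where "M\<^sub>1 = (\<Sum>v\<in>V. w v * y v)"
  define M\<^sub>2 where "M\<^sub>2 = (\<Sum>v\<in>V. w v * (y v)\<^sup>2)"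
  define M\<^sub>3 where "M\<^sub>3 = (\<Sum>v\<in>V. w v * \<bar>y v\<bar> ^ 3)"
  define c where "c = \<bar>q\<bar> + E + A"
  define D where "D = M\<^sub>3 + A + c * (2 * \<bar>\<mu>\<bar> + c) + exp (\<bar>\<mu>\<bar> + c) * (\<bar>\<mu>\<bar> + c) ^ 3"
  have c0: "0 \<le> c" using EA by (simp add: c_def)
  have key: "cmod (\<i> * complex_of_real (t * (M\<^sub>1 - \<mu>)) - complex_of_real (t\<^sup>2 / 2 * (M\<^sub>2 - \<mu>\<^sup>2 - q))) \<le> t\<^sup>2 * E + D * t ^ 3"
    if t: "0 < t" "t \<le> min 1 t\<^sub>0" for t
  proof -
    let ?F = "\<Sum>v\<in>V. w v *\<^sub>R exp (\<i> * complex_of_real (t * y v))"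
    obtain R where F: "?F = exp (\<i> * complex_of_real (t * \<mu>) - complex_of_real (t\<^sup>2 * q / 2) + R)"
      and R: "cmod R \<le> t\<^sup>2 * E + t ^ 3 * A" using rep[of t] t by auto
    define z where "z = \<i> * complex_of_real (t * \<mu>) - complex_of_real (t\<^sup>2 * q / 2) + R"
    have t32: "t ^ 3 \<le> t\<^sup>2" "t\<^sup>2 \<le> t" using t power_decreasing[of 2 3 t] power_decreasing[of 1 2 t] by auto
    have z1: "cmod (z - \<i> * complex_of_real (t * \<mu>)) \<le> t\<^sup>2 * c"
    proof -
      have "cmod (z - \<i> * complex_of_real (t * \<mu>)) = cmod (R - complex_of_real (t\<^sup>2 * q / 2))"
        by (simp add: z_def)
      also have "\<dots> \<le> cmod R + cmod (complex_of_real (t\<^sup>2 * q / 2))" by (rule norm_triangle_ineq4)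
      also have "\<dots> \<le> t\<^sup>2 * E + t ^ 3 * A + t\<^sup>2 * \<bar>q\<bar>"
        using R t by (intro add_mono) (auto simp: abs_mult norm_mult norm_divide norm_power)
      also have "\<dots> \<le> t\<^sup>2 * E + t\<^sup>2 * A + t\<^sup>2 * \<bar>q\<bar>"
        using t32 EA by (intro add_mono mult_right_mono) auto
      finally show ?thesis by (simp add: c_def algebra_simps)
    qed
    have zn: "cmod z \<le> t * (\<bar>\<mu>\<bar> + c)"
    proof -
      have "cmod z \<le> cmod (z - \<i> * complex_of_real (t * \<mu>)) + cmod (\<i> * complex_of_real (t * \<mu>))"
        by (metis diff_add_cancel norm_triangle_ineq)
      also have "\<dots> \<le> t * c + t * \<bar>\<mu>\<bar>"
        using z1 t32 c0 t by (intro add_mono order_trans[OF z1] mult_right_mono) (auto simp: norm_mult abs_mult)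
      finally show ?thesis by (simp add: algebra_simps)
    qed
    have z2: "cmod (z\<^sup>2 + complex_of_real (t\<^sup>2 * \<mu>\<^sup>2)) \<le> t ^ 3 * (c * (2 * \<bar>\<mu>\<bar> + c))"
    proof -
      have "z\<^sup>2 + complex_of_real (t\<^sup>2 * \<mu>\<^sup>2) = (z - \<i> * complex_of_real (t * \<mu>)) * (z + \<i> * complex_of_real (t * \<mu>))"
        by (simp add: power2_eq_square algebra_simps)
      then have "cmod (z\<^sup>2 + complex_of_real (t\<^sup>2 * \<mu>\<^sup>2))
          = cmod (z - \<i> * complex_of_real (t * \<mu>)) * cmod (z + \<i> * complex_of_real (t * \<mu>))"
        by (simp add: norm_mult)
      also have "\<dots> \<le> (t\<^sup>2 * c) * (t * (\<bar>\<mu>\<bar> + c) + t * \<bar>\<mu>\<bar>)"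
        using z1 zn t c0 by (intro mult_mono order_trans[OF norm_triangle_ineq] add_mono) (auto simp: norm_mult abs_mult)
      finally show ?thesis by (simp add: power2_eq_square power3_eq_cube algebra_simps)
    qed
    have z3: "cmod (exp z - (1 + z + z\<^sup>2 / 2)) \<le> t ^ 3 * (exp (\<bar>\<mu>\<bar> + c) * (\<bar>\<mu>\<bar> + c) ^ 3)"
    proof -
      have "\<bar>Re z\<bar> \<le> \<bar>\<mu>\<bar> + c"
        using abs_Re_le_cmod[of z] zn t c0 mult_right_mono[of t 1 "\<bar>\<mu>\<bar> + c"] by auto
      then have "exp \<bar>Re z\<bar> * cmod z ^ 3 \<le> exp (\<bar>\<mu>\<bar> + c) * (t * (\<bar>\<mu>\<bar> + c)) ^ 3"
        using zn by (intro mult_mono power_mono) auto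
      then show ?thesis using cmod_exp_second_order[of z] by (simp add: power_mult_distrib mult_ac)
    qed
    have F2: "cmod (?F - (1 + \<i> * complex_of_real (t * M\<^sub>1) - complex_of_real (t\<^sup>2 * M\<^sub>2 / 2))) \<le> t ^ 3 * M\<^sub>3"
    proof -
      have "1 + \<i> * complex_of_real (t * M\<^sub>1) - complex_of_real (t\<^sup>2 * M\<^sub>2 / 2)
          = (\<Sum>v\<in>V. w v *\<^sub>R (1 + \<i> * complex_of_real (t * y v) - complex_of_real ((t * y v)\<^sup>2 / 2)))"
        using arg_cong[OF w(2), of complex_of_real]
        by (simp add: scaleR_conv_of_real M\<^sub>1_def M\<^sub>2_def ring_distribs sum.distrib sum_subtractf
            sum_distrib_left sum_divide_distrib power_mult_distrib mult_ac)
      then have "cmod (?F - (1 + \<i> * complex_of_real (t * M\<^sub>1) - complex_of_real (t\<^sup>2 * M\<^sub>2 / 2)))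
         = cmod (\<Sum>v\<in>V. w v *\<^sub>R (exp (\<i> * complex_of_real (t * y v))
             - (1 + \<i> * complex_of_real (t * y v) - complex_of_real ((t * y v)\<^sup>2 / 2))))"
        by (simp add: scaleR_diff_right sum_subtractf)
      also have "\<dots> \<le> (\<Sum>v\<in>V. w v * \<bar>t * y v\<bar> ^ 3)"
      proof (rule sum_norm_le)
        fix v assume "v \<in> V"
        then show "norm (w v *\<^sub>R (exp (\<i> * complex_of_real (t * y v))
             - (1 + \<i> * complex_of_real (t * y v) - complex_of_real ((t * y v)\<^sup>2 / 2)))) \<le> w v * \<bar>t * y v\<bar> ^ 3"
          using mult_left_mono[OF cmod_exp_i_second_order[of "t * y v"] w(1)] w(1) unfolding norm_scaleR by simp
      qed
      also have "\<dots> = t ^ 3 * M\<^sub>3"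
        using t by (simp add: M\<^sub>3_def sum_distrib_left abs_mult power_mult_distrib mult_ac)
      finally show ?thesis .
    qed
    \<comment> \<open>\<open>z\<^sup>2\<close> contributes \<open>- t\<^sup>2 \<mu>\<^sup>2\<close>, which turns the second moment into the variance\<close>
    have "\<i> * complex_of_real (t * (M\<^sub>1 - \<mu>)) - complex_of_real (t\<^sup>2 / 2 * (M\<^sub>2 - \<mu>\<^sup>2 - q))
      = R + (z\<^sup>2 + complex_of_real (t\<^sup>2 * \<mu>\<^sup>2)) / 2 + (exp z - (1 + z + z\<^sup>2 / 2))
        - (?F - (1 + \<i> * complex_of_real (t * M\<^sub>1) - complex_of_real (t\<^sup>2 * M\<^sub>2 / 2)))"
      unfolding F z_def[symmetric] by (simp add: z_def field_simps)
    also have "cmod \<dots> \<le> cmod R + cmod ((z\<^sup>2 + complex_of_real (t\<^sup>2 * \<mu>\<^sup>2)) / 2) + cmod (exp z - (1 + z + z\<^sup>2 / 2))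
        + cmod (?F - (1 + \<i> * complex_of_real (t * M\<^sub>1) - complex_of_real (t\<^sup>2 * M\<^sub>2 / 2)))"
      by (rule norm_four_terms)
    also have "\<dots> \<le> (t\<^sup>2 * E + t ^ 3 * A) + t ^ 3 * (c * (2 * \<bar>\<mu>\<bar> + c)) + t ^ 3 * (exp (\<bar>\<mu>\<bar> + c) * (\<bar>\<mu>\<bar> + c) ^ 3) + t ^ 3 * M\<^sub>3"
    proof (intro add_mono R z3 F2)
      have "cmod ((z\<^sup>2 + complex_of_real (t\<^sup>2 * \<mu>\<^sup>2)) / 2) = cmod (z\<^sup>2 + complex_of_real (t\<^sup>2 * \<mu>\<^sup>2)) / 2"
        by (simp add: norm_divide)
      also have "\<dots> \<le> cmod (z\<^sup>2 + complex_of_real (t\<^sup>2 * \<mu>\<^sup>2))" using norm_ge_zero[of "z\<^sup>2 + complex_of_real (t\<^sup>2 * \<mu>\<^sup>2)"] by linarith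
      also note z2
      finally show "cmod ((z\<^sup>2 + complex_of_real (t\<^sup>2 * \<mu>\<^sup>2)) / 2) \<le> t ^ 3 * (c * (2 * \<bar>\<mu>\<bar> + c))" .
    qed
    finally show ?thesis by (simp add: D_def algebra_simps)
  qed
  have min0: "0 < min 1 t\<^sub>0" using t0 by simp
  have "\<bar>M\<^sub>1 - \<mu>\<bar> \<le> 0"
  proof (rule le_of_eventually_le_linear[OF min0])
    fix t assume t: "0 < t" "t \<le> min 1 t\<^sub>0"
    have "\<bar>t * (M\<^sub>1 - \<mu>)\<bar> \<le> t\<^sup>2 * E + D * t ^ 3"
      using order_trans[OF abs_Im_le_cmod key[OF t]] by simp
    also have "\<dots> \<le> t\<^sup>2 * E + \<bar>D\<bar> * t\<^sup>2"
      using t power_decreasing[of 2 3 t] by (intro add_mono order_refl mult_mono) auto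
    also have "\<bar>t * (M\<^sub>1 - \<mu>)\<bar> = t * \<bar>M\<^sub>1 - \<mu>\<bar>" using t by (simp add: abs_mult)
    finally have "t * \<bar>M\<^sub>1 - \<mu>\<bar> \<le> t * (0 + (E + \<bar>D\<bar>) * t)"
      by (simp add: power2_eq_square algebra_simps)
    then show "\<bar>M\<^sub>1 - \<mu>\<bar> \<le> 0 + (E + \<bar>D\<bar>) * t" using t by simp
  qed
  then show "(\<Sum>v\<in>V. w v * y v) = \<mu>" by (simp add: M\<^sub>1_def)
  have "\<bar>M\<^sub>2 - \<mu>\<^sup>2 - q\<bar> \<le> 2 * E"
  proof (rule le_of_eventually_le_linear[OF min0])
    fix t assume t: "0 < t" "t \<le> min 1 t\<^sub>0"
    have "\<bar>t\<^sup>2 / 2 * (M\<^sub>2 - \<mu>\<^sup>2 - q)\<bar> \<le> t\<^sup>2 * E + D * t ^ 3"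
      using order_trans[OF abs_Re_le_cmod key[OF t]] by simp
    also have "\<bar>t\<^sup>2 / 2 * (M\<^sub>2 - \<mu>\<^sup>2 - q)\<bar> = t\<^sup>2 / 2 * \<bar>M\<^sub>2 - \<mu>\<^sup>2 - q\<bar>" by (simp add: abs_mult)
    finally have "t\<^sup>2 * \<bar>M\<^sub>2 - \<mu>\<^sup>2 - q\<bar> \<le> t\<^sup>2 * (2 * E + (2 * D) * t)"
      by (simp add: power2_eq_square power3_eq_cube algebra_simps)
    then show "\<bar>M\<^sub>2 - \<mu>\<^sup>2 - q\<bar> \<le> 2 * E + (2 * D) * t" using t by simp
  qed
  then show "\<bar>(\<Sum>v\<in>V. w v * (y v)\<^sup>2) - \<mu>\<^sup>2 - q\<bar> \<le> 2 * E" by (simp add: M\<^sub>2_def)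
qed


section \<open>Linear recursions with a small memory kernel\<close>

lemma norm_inverse_prod_minus_one_le:
  fixes r :: "nat \<Rightarrow> complex"
  assumes "\<And>l. l \<in> A \<Longrightarrow> cmod (r l) \<le> 1 / 2"
  shows "cmod (inverse (\<Prod>l\<in>A. 1 + r l) - 1) \<le> exp (\<Sum>l\<in>A. 2 * cmod (r l)) - 1"
proof -
  have z: "cmod (inverse (1 + r l) - 1) \<le> 2 * cmod (r l)" if "l \<in> A" for l
  proof -
    have h: "cmod (1 + r l) \<ge> 1 / 2"
      using assms[OF that] norm_triangle_ineq2[of 1 "- r l"] by simp
    then have nz: "1 + r l \<noteq> 0" by auto
    have "inverse (1 + r l) - 1 = - r l / (1 + r l)"
      using nz by (simp add: field_simps)
    then have "cmod (inverse (1 + r l) - 1) = cmod (r l) / cmod (1 + r l)"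
      by (simp add: norm_divide)
    also have "\<dots> \<le> cmod (r l) / (1 / 2)"
      using h by (intro divide_left_mono) auto
    finally show ?thesis by simp
  qed
  have "cmod (inverse (\<Prod>l\<in>A. 1 + r l) - 1) = cmod ((\<Prod>l\<in>A. 1 + (inverse (1 + r l) - 1)) - 1)"
    by (simp add: prod_inversef[symmetric] o_def)
  also have "\<dots> \<le> (\<Prod>l\<in>A. 1 + cmod (inverse (1 + r l) - 1)) - 1"
    by (rule norm_prod_minus1_le_prod_minus1)
  also have "(\<Prod>l\<in>A. 1 + cmod (inverse (1 + r l) - 1)) \<le> (\<Prod>l\<in>A. exp (2 * cmod (r l)))"
  proof (rule prod_mono)
    fix l assume "l \<in> A"
    then show "0 \<le> 1 + cmod (inverse (1 + r l) - 1) \<and> 1 + cmod (inverse (1 + r l) - 1) \<le> exp (2 * cmod (r l))"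
      using z[of l] exp_ge_add_one_self[of "2 * cmod (r l)"] by (smt (verit) norm_ge_zero)
  qed
  also have "(\<Prod>l\<in>A. exp (2 * cmod (r l))) = exp (\<Sum>l\<in>A. 2 * cmod (r l))"
    by (cases "finite A") (simp_all add: exp_sum)
  finally show ?thesis by simp
qed

text \<open>
  Only the part \<open>y\<close>, which may be large, is multiplied by \<open>exp y\<close>. In the application \<open>x\<close> collects the
  terms of first order in the frequency; a factor \<open>exp y\<close> there would cost a power of the time lag
  that the summability of \<open>m b_m\<close> does not provide.
\<close>

lemma exp_add_minus_one_le:
  fixes x y :: real
  assumes "0 \<le> x" "x \<le> 1" "0 \<le> y"
  shows "exp (x + y) - 1 \<le> 3 * x + 3 * (y * exp y)"
proof -
  have e1: "exp x \<le> 3" using assms e_less_272 by (smt (verit) exp_le_cancel_iff exp_le)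
  have f: "exp t - 1 \<le> t * exp t" for t :: real
  proof -
    have "1 - t \<le> exp (- t)" using exp_ge_add_one_self[of "- t"] by simp
    then have "(1 - t) * exp t \<le> exp (- t) * exp t" by (intro mult_right_mono) auto
    then show ?thesis by (simp add: exp_minus algebra_simps)
  qed
  have "exp (x + y) - 1 = (exp x - 1) + exp x * (exp y - 1)"
    by (simp add: exp_add algebra_simps)
  also have "\<dots> \<le> x * exp x + exp x * (y * exp y)"
    using f[of x] f[of y] by (intro add_mono mult_left_mono) auto
  also have "\<dots> \<le> x * 3 + 3 * (y * exp y)"
    using e1 assms by (intro add_mono mult_left_mono mult_right_mono) auto
  finally show ?thesis by simp
qed

lemma index_times_log_le:
  assumes "1 \<le> m" "m \<le> N"
  shows "real m * (ln (real N + 1) / real N) \<le> ln (real m) + 1"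
proof -
  have pos: "real m > 0" "real N > 0" using assms by auto
  have "ln (real N + 1) \<le> ln (2 * (real m * (real N / real m)))"
    using assms pos by (subst ln_le_cancel_iff) (auto simp: field_simps)
  also have "\<dots> = ln 2 + (ln (real m) + ln (real N / real m))"
    using pos by (simp add: ln_mult ln_div)
  also have "\<dots> \<le> 1 + (ln (real m) + (real N / real m - 1))"
    using pos ln_2_less_1 by (intro add_mono ln_le_minus_one) (auto simp: less_imp_le)
  finally have "ln (real N + 1) \<le> ln (real m) + real N / real m" by simp
  then have "real m / real N * ln (real N + 1) \<le> real m / real N * (ln (real m) + real N / real m)"
    using pos by (intro mult_left_mono) auto
  also have "\<dots> = real m / real N * ln (real m) + 1"
    using pos by (simp add: field_simps)
  also have "\<dots> \<le> 1 * ln (real m) + 1"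
    using assms pos by (intro add_mono mult_right_mono) auto
  finally show ?thesis by (simp add: mult.commute)
qed

text \<open>
  The frequency \<open>t = |\<kappa>|^2\<close> is of order \<open>ln N / N\<close>. Since \<open>m ln N / N\<close> is at most about \<open>ln m\<close> for
  \<open>m \<le> N\<close>, a factor that grows exponentially in \<open>t m\<close> is at most a small power of \<open>m\<close>.
\<close>

lemma exp_index_le_powr:
  assumes "1 \<le> m" "m \<le> N" "0 \<le> c" "c * C \<le> \<gamma>" "\<gamma> < 1" "t \<le> C * (ln (real N + 1) / real N)" "0 \<le> C"
  shows "exp (c * t * real m) \<le> 3 * real m powr \<gamma>"
proof -
  have "c * t * real m \<le> c * (C * (ln (real N + 1) / real N)) * real m"
    using assms by (intro mult_right_mono mult_left_mono) auto
  also have "\<dots> = c * C * (real m * (ln (real N + 1) / real N))" by simp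
  also have "\<dots> \<le> c * C * (ln (real m) + 1)"
    using assms index_times_log_le[of m N] by (intro mult_left_mono) auto
  also have "\<dots> \<le> \<gamma> * (ln (real m) + 1)"
    using assms by (intro mult_right_mono) auto
  also have "\<dots> \<le> \<gamma> * ln (real m) + 1" using assms by (simp add: algebra_simps)
  finally have "exp (c * t * real m) \<le> exp (\<gamma> * ln (real m) + 1)" by simp
  also have "\<dots> = exp 1 * real m powr \<gamma>" using assms by (simp add: exp_add powr_def)
  also have "\<dots> \<le> 3 * real m powr \<gamma>" using exp_le by (intro mult_right_mono) auto
  finally show ?thesis .
qed

text \<open>
  Each \<open>B l\<close> occurs together with \<open>b m\<close> for fewer than \<open>m\<close> values of \<open>j\<close>. In the application this is the
  sum over time of the products of the first-order part of the kernel with the first-order parts of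
  the increments, and it has to stay bounded.
\<close>

lemma sum_window_convolution_le:
  fixes b B :: "nat \<Rightarrow> real"
  assumes b: "\<And>m. 1 \<le> m \<Longrightarrow> 0 \<le> b m" and B: "\<And>n. 0 \<le> B n"
    and Bs: "\<And>n. (\<Sum>l<n. B l) \<le> S" and bs: "\<And>n. (\<Sum>m=2..n. real m * b m) \<le> S"
  shows "(\<Sum>j<N. \<Sum>m=2..j + 1. b m * (\<Sum>l=j + 1 - m..<j. B l)) \<le> S * S"
proof -
  have S: "0 \<le> S" using Bs[of 0] by simp
  have inner: "(\<Sum>j<N. of_bool (m \<le> j + 1) * (\<Sum>l=j + 1 - m..<j. B l)) \<le> real m * S" for m
  proof -
    have "(\<Sum>j<N. of_bool (m \<le> j + 1) * (\<Sum>l=j + 1 - m..<j. B l))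
        \<le> (\<Sum>j<N. \<Sum>l<N. of_bool (l < j \<and> j < l + m) * B l)"
    proof (rule sum_mono)
      fix j assume j: "j \<in> {..<N}"
      have "of_bool (m \<le> j + 1) * (\<Sum>l=j + 1 - m..<j. B l)
         \<le> (\<Sum>l=j + 1 - m..<j. of_bool (l < j \<and> j < l + m) * B l)"
      proof (cases "m \<le> j + 1")
        case True
        then have "(\<Sum>l=j + 1 - m..<j. of_bool (l < j \<and> j < l + m) * B l) = (\<Sum>l=j + 1 - m..<j. B l)"
          by (intro sum.cong) auto
        with True show ?thesis by simp
      next
        case False
        then show ?thesis using B by (simp add: sum_nonneg)
      qed
      also have "\<dots> \<le> (\<Sum>l<N. of_bool (l < j \<and> j < l + m) * B l)"
        using j B by (intro sum_mono2) auto
      finally show "of_bool (m \<le> j + 1) * (\<Sum>l=j + 1 - m..<j. B l) \<le> (\<Sum>l<N. of_bool (l < j \<and> j < l + m) * B l)" .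
    qed
    also have "\<dots> = (\<Sum>l<N. (\<Sum>j<N. of_bool (l < j \<and> j < l + m)) * B l)"
      by (subst sum.swap) (simp add: sum_distrib_right)
    also have "\<dots> \<le> (\<Sum>l<N. real m * B l)"
    proof (intro sum_mono mult_right_mono B)
      fix l
      have "(\<Sum>j<N. of_bool (l < j \<and> j < l + m)) = real (card ({..<N} \<inter> {j. l < j \<and> j < l + m}))"
        by simp
      also have "\<dots> \<le> real (card {l..<l + m})"
        by (intro of_nat_mono card_mono) auto
      finally show "(\<Sum>j<N. of_bool (l < j \<and> j < l + m)) \<le> real m" by simp
    qed
    also have "\<dots> \<le> real m * S"
      using Bs[of N] by (simp add: sum_distrib_left[symmetric] mult_left_mono)
    finally show ?thesis .
  qed
  have "(\<Sum>j<N. \<Sum>m=2..j + 1. b m * (\<Sum>l=j + 1 - m..<j. B l))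
      = (\<Sum>j<N. \<Sum>m=2..N. b m * (of_bool (m \<le> j + 1) * (\<Sum>l=j + 1 - m..<j. B l)))"
    by (intro sum.cong refl sum.mono_neutral_cong_left) auto
  also have "\<dots> = (\<Sum>m=2..N. b m * (\<Sum>j<N. of_bool (m \<le> j + 1) * (\<Sum>l=j + 1 - m..<j. B l)))"
    by (subst sum.swap) (simp add: sum_distrib_left)
  also have "\<dots> \<le> (\<Sum>m=2..N. b m * (real m * S))"
    using inner b by (intro sum_mono mult_left_mono) auto
  also have "\<dots> = (\<Sum>m=2..N. real m * b m) * S" by (simp add: sum_distrib_left mult_ac)
  also have "\<dots> \<le> S * S" using bs S by (intro mult_right_mono) auto
  finally show ?thesis .
qed


lemma one_plus_neq_zero: "cmod z \<le> 1 / 2 \<Longrightarrow> 1 + z \<noteq> 0"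
  by (auto simp: add_eq_0_iff)

text \<open>
  The recursion at a fixed frequency of norm \<open>s\<close>, for the times up to \<open>N\<close>. The kernel \<open>P m\<close> is of first
  order in \<open>s\<close> with weights \<open>b m\<close> and of second order with weights \<open>m b m\<close>. The numbers \<open>B\<close> and \<open>F\<close> stand
  for the tails of the sums of \<open>b m\<close> and \<open>m b m\<close>. The constants are fixed in the order \<open>M\<close>, \<open>K\<close>, \<open>\<delta>\<close>: the
  bound on the increments has a coefficient \<open>M\<close> in front of its first-order part, which produces the
  large coefficient \<open>K\<close> of the second-order part, and \<open>\<delta>\<close> then makes the contributions of \<open>K\<close> itself
  small, together with the bound \<open>\<eta>\<close> on \<open>s a_N\<close>.
\<close>

locale perturbed_recursion =
  fixes f P Lam T :: "nat \<Rightarrow> complex" and g W :: complex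
    and b B F :: "nat \<Rightarrow> real" and s M S \<gamma> \<delta> \<eta> K :: real and N :: nat
  assumes f_0: "f 0 = 1"
    and f_Suc: "\<And>n. n < N \<Longrightarrow> f (Suc n) = g * f n + (\<Sum>m=2..n + 1. P m * f (n + 1 - m))"
    and split: "\<And>n. n < N \<Longrightarrow> g - 1 + (\<Sum>m=2..n + 1. P m) = Lam n + W + T n"
    and P_le: "\<And>m. 2 \<le> m \<Longrightarrow> m \<le> N \<Longrightarrow> cmod (P m) \<le> M * (s * b m + s\<^sup>2 * (real m * b m))"
    and Lam_le: "\<And>n. n < N \<Longrightarrow> cmod (Lam n) \<le> M * (s * B n)"
    and W_le: "cmod W \<le> M * s\<^sup>2"
    and T_le: "\<And>n. n < N \<Longrightarrow> cmod (T n) \<le> M * (s\<^sup>2 * F n + s ^ 3 * a_seq \<gamma> b (n + 1))"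
    and b_nonneg: "\<And>m. 1 \<le> m \<Longrightarrow> 0 \<le> b m"
    and B_nonneg: "\<And>n. 0 \<le> B n" and F_le: "\<And>n. F n \<le> S"
    and B_sum: "\<And>n. (\<Sum>l<n. B l) \<le> S" and b_sum: "\<And>n. (\<Sum>m=2..n. real m * b m) \<le> S"
    and M: "0 \<le> M" and \<gamma>: "0 < \<gamma>" "\<gamma> < 1"
    and K_def: "K = M * (S + 2) + 12 * M\<^sup>2 * S\<^sup>2 + 1"
    and s: "0 \<le> s" "s \<le> \<delta>" "s * a_seq \<gamma> b N \<le> \<eta>" "s\<^sup>2 \<le> \<delta>\<^sup>2 * (ln (real N + 1) / real N)"
    and \<delta>: "\<delta> \<le> 1" "2 * M * S * \<delta> \<le> 1" "M * S * \<delta> + K * \<delta>\<^sup>2 \<le> 1 / 2" "2 * K * \<delta>\<^sup>2 \<le> \<gamma>"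
    and \<eta>: "\<eta> \<le> 1" "36 * M * K * \<eta> \<le> 1"
begin

text \<open>
  With these abbreviations \<open>increment n = Lam n + W + T n + memory n\<close>, and the part of
  the bound on \<open>memory\<close> that is of second order in \<open>s\<close> is a multiple of \<open>s^2 * memory_bound n\<close>.
\<close>

definition increment where "increment n = f (Suc n) / f n - 1"

definition memory where "memory n = (\<Sum>m=2..n + 1. P m * (f (n + 1 - m) / f n - 1))"

definition memory_bound where "memory_bound n = (\<Sum>m=2..n + 1. b m * (\<Sum>l=n + 1 - m..<n. B l))"

lemma S_nonneg: "0 \<le> S" using B_sum[of 0] by simp

lemma K_ge_one: "1 \<le> K"
  unfolding K_def using M S_nonneg by simp

lemma s_le_one: "s \<le> 1" using s \<delta> by linarith

lemma B_le: "B n \<le> S"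
proof -
  have "B n \<le> (\<Sum>l<Suc n. B l)" using B_nonneg by (simp add: sum_nonneg)
  with B_sum[of "Suc n"] show ?thesis by linarith
qed

lemma B_window_le: "(\<Sum>l=k..<n. B l) \<le> S"
proof -
  have "(\<Sum>l=k..<n. B l) \<le> (\<Sum>l<n. B l)" using B_nonneg by (intro sum_mono2) auto
  with B_sum[of n] show ?thesis by linarith
qed

lemma a_mono: "m \<le> n \<Longrightarrow> a_seq \<gamma> b m \<le> a_seq \<gamma> b n"
  unfolding a_seq_def using b_nonneg by (intro sum_mono2) auto

lemma a_nonneg: "0 \<le> a_seq \<gamma> b n"
  unfolding a_seq_def using b_nonneg by (intro sum_nonneg) auto

lemma memory_bound_nonneg: "0 \<le> memory_bound n"
  unfolding memory_bound_def using b_nonneg B_nonneg by (intro sum_nonneg mult_nonneg_nonneg) auto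

lemma memory_bound_le: "memory_bound n \<le> S\<^sup>2"
proof -
  have "memory_bound n \<le> (\<Sum>j<Suc n. memory_bound j)" using memory_bound_nonneg by (simp add: sum_nonneg)
  also have "\<dots> \<le> S * S"
    unfolding memory_bound_def by (rule sum_window_convolution_le[OF b_nonneg B_nonneg B_sum b_sum])
  finally show ?thesis by (simp add: power2_eq_square)
qed

lemma f_telescope:
  assumes "\<And>l. l < n \<Longrightarrow> f l \<noteq> 0" "k \<le> n"
  shows "f n = f k * (\<Prod>l=k..<n. 1 + increment l)"
  using assms(2,1)
proof (induction n rule: dec_induct)
  case (step n)
  then have "f n = f k * (\<Prod>l=k..<n. 1 + increment l)" by simp
  moreover have "f (Suc n) = f n * (1 + increment n)" using step by (simp add: increment_def)
  ultimately show ?case using step by simp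
qed simp

lemma small_ratio: "M * (s * B n) + K * s\<^sup>2 \<le> 1 / 2"
proof -
  have "M * (s * B n) + K * s\<^sup>2 \<le> M * (\<delta> * S) + K * \<delta>\<^sup>2"
    using M s B_le B_nonneg K_ge_one by (intro add_mono mult_left_mono mult_mono power_mono) auto
  then show ?thesis using \<delta>(3) by (simp add: mult_ac)
qed

text \<open>
  The quotient is an inverse product of \<open>m - 1\<close> factors \<open>1 + increment l\<close>. The first-order parts of the
  increments add up to a bounded quantity, the second-order parts to a multiple of \<open>K s^2 m\<close>, whose
  exponential is a power of \<open>m\<close>.
\<close>

lemma quotient_le:
  assumes n: "n < N" and nz: "\<And>l. l \<le> n \<Longrightarrow> f l \<noteq> 0"
    and IH: "\<And>l. l < n \<Longrightarrow> cmod (increment l) \<le> M * (s * B l) + K * s\<^sup>2"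
    and m: "2 \<le> m" "m \<le> n + 1"
  shows "cmod (f (n + 1 - m) / f n - 1)
    \<le> 6 * M * s * (\<Sum>l=n + 1 - m..<n. B l) + 18 * K * s\<^sup>2 * (real m * real m powr \<gamma>)"
proof -
  let ?A = "{n + 1 - m..<n}"
  define x where "x = 2 * M * s * (\<Sum>l\<in>?A. B l)"
  define y where "y = 2 * K * s\<^sup>2 * real m"
  have tel: "f n = f (n + 1 - m) * (\<Prod>l\<in>?A. 1 + increment l)"
    using f_telescope[of n "n + 1 - m"] nz m by simp
  have "f (n + 1 - m) / f n = inverse (\<Prod>l\<in>?A. 1 + increment l)"
    unfolding tel using nz[of "n + 1 - m"] m by (simp add: inverse_eq_divide)
  then have "cmod (f (n + 1 - m) / f n - 1) = cmod (inverse (\<Prod>l\<in>?A. 1 + increment l) - 1)" by simp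
  also have "\<dots> \<le> exp (\<Sum>l\<in>?A. 2 * cmod (increment l)) - 1"
  proof (rule norm_inverse_prod_minus_one_le)
    fix l assume "l \<in> ?A"
    then show "cmod (increment l) \<le> 1 / 2" using IH[of l] small_ratio[of l] by auto
  qed
  finally have 1: "cmod (f (n + 1 - m) / f n - 1) \<le> exp (\<Sum>l\<in>?A. 2 * cmod (increment l)) - 1" .
  have "(\<Sum>l\<in>?A. 2 * cmod (increment l)) \<le> (\<Sum>l\<in>?A. 2 * M * s * B l + 2 * K * s\<^sup>2)"
  proof (rule sum_mono)
    fix l assume "l \<in> ?A"
    then show "2 * cmod (increment l) \<le> 2 * M * s * B l + 2 * K * s\<^sup>2" using IH[of l] by simp
  qed
  also have "\<dots> = x + 2 * K * s\<^sup>2 * real (card ?A)"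
    by (simp add: x_def sum.distrib sum_distrib_left)
  also have "\<dots> \<le> x + y"
    unfolding y_def using K_ge_one m by (intro add_mono mult_left_mono) auto
  finally have 2: "(\<Sum>l\<in>?A. 2 * cmod (increment l)) \<le> x + y" .
  have 3: "exp (x + y) - 1 \<le> 3 * x + 3 * (y * exp y)"
  proof (rule exp_add_minus_one_le)
    have w: "0 \<le> (\<Sum>l\<in>?A. B l)" "(\<Sum>l\<in>?A. B l) \<le> S"
      using B_nonneg B_window_le by (auto intro: sum_nonneg)
    show "0 \<le> x" unfolding x_def using M s w by simp
    have "x \<le> 2 * M * \<delta> * S"
      unfolding x_def using M s w S_nonneg by (intro mult_mono) auto
    then show "x \<le> 1" using \<delta>(2) by (simp add: mult_ac)
    show "0 \<le> y" unfolding y_def using K_ge_one by simp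
  qed
  have "exp y \<le> 3 * real m powr \<gamma>"
    unfolding y_def
    using exp_index_le_powr[of m N "2 * K" "\<delta>\<^sup>2" \<gamma> "s\<^sup>2"] m n K_ge_one s(4) \<delta>(4) \<gamma> by simp
  moreover have "0 \<le> y" unfolding y_def using K_ge_one by simp
  ultimately have "y * exp y \<le> y * (3 * real m powr \<gamma>)" by (rule mult_left_mono)
  moreover have "exp (\<Sum>l\<in>?A. 2 * cmod (increment l)) \<le> exp (x + y)" using 2 by simp
  ultimately have "cmod (f (n + 1 - m) / f n - 1) \<le> 3 * x + 3 * (y * (3 * real m powr \<gamma>))"
    using 1 3 by linarith
  then show ?thesis by (simp add: x_def y_def mult_ac)
qed

lemma memory_le:
  assumes n: "n < N" and nz: "\<And>l. l \<le> n \<Longrightarrow> f l \<noteq> 0"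
    and IH: "\<And>l. l < n \<Longrightarrow> cmod (increment l) \<le> M * (s * B l) + K * s\<^sup>2"
  shows "cmod (memory n) \<le> 6 * M\<^sup>2 * s\<^sup>2 * memory_bound n + 6 * M\<^sup>2 * S\<^sup>2 * s ^ 3 + 36 * M * K * s ^ 3 * a_seq \<gamma> b (n + 1)"
proof -
  have "cmod (memory n) \<le> (\<Sum>m=2..n + 1. cmod (P m * (f (n + 1 - m) / f n - 1)))"
    unfolding memory_def by (rule norm_sum)
  also have "\<dots> \<le> (\<Sum>m=2..n + 1. 6 * M\<^sup>2 * s\<^sup>2 * (b m * (\<Sum>l=n + 1 - m..<n. B l))
       + 6 * M\<^sup>2 * S * s ^ 3 * (real m * b m) + 36 * M * K * s ^ 3 * (real m powr (2 + \<gamma>) * b m))"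
  proof (rule sum_mono)
    fix m assume "m \<in> {2..n + 1}"
    then have m: "2 \<le> m" "m \<le> n + 1" by auto
    define \<beta> where "\<beta> = (\<Sum>l=n + 1 - m..<n. B l)"
    define p where "p = real m powr \<gamma>"
    have \<beta>: "0 \<le> \<beta>" "\<beta> \<le> S" unfolding \<beta>_def using B_nonneg B_window_le by (auto intro: sum_nonneg)
    have bm: "0 \<le> b m" "0 \<le> real m * b m" using b_nonneg m by auto
    have p: "0 \<le> p" unfolding p_def by simp
    have "cmod (P m * (f (n + 1 - m) / f n - 1))
        \<le> (M * (s * b m + s\<^sup>2 * (real m * b m))) * (6 * M * s * \<beta> + 18 * K * s\<^sup>2 * (real m * p))"
      unfolding norm_mult \<beta>_def p_def using P_le[of m] quotient_le[OF n nz IH m] m n bm M s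
      by (intro mult_mono) auto
    also have "\<dots> = 6 * M\<^sup>2 * s\<^sup>2 * (b m * \<beta>) + 6 * M\<^sup>2 * s ^ 3 * (real m * b m) * \<beta>
        + 18 * M * K * s ^ 3 * (real m * p * b m) + 18 * M * K * s ^ 4 * (real m ^ 2 * p * b m)"
      by (simp add: algebra_simps power2_eq_square power3_eq_cube power4_eq_xxxx)
    also have "\<dots> \<le> 6 * M\<^sup>2 * s\<^sup>2 * (b m * \<beta>) + 6 * M\<^sup>2 * s ^ 3 * (real m * b m) * S
        + 18 * M * K * s ^ 3 * (real m ^ 2 * p * b m) + 18 * M * K * s ^ 3 * (real m ^ 2 * p * b m)"
    proof (intro add_mono order_refl mult_left_mono mult_right_mono \<beta> bm p)
      show "real m \<le> (real m)\<^sup>2" using m by (simp add: power2_eq_square)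
      show "s ^ 4 \<le> s ^ 3" using s s_le_one by (intro power_decreasing) auto
    qed (use M s K_ge_one p bm in auto)
    also have "\<dots> = 6 * M\<^sup>2 * s\<^sup>2 * (b m * \<beta>) + 6 * M\<^sup>2 * S * s ^ 3 * (real m * b m)
        + 36 * M * K * s ^ 3 * (real m powr (2 + \<gamma>) * b m)"
      using m by (simp add: p_def powr_add)
    finally show "cmod (P m * (f (n + 1 - m) / f n - 1)) \<le> 6 * M\<^sup>2 * s\<^sup>2 * (b m * (\<Sum>l=n + 1 - m..<n. B l))
       + 6 * M\<^sup>2 * S * s ^ 3 * (real m * b m) + 36 * M * K * s ^ 3 * (real m powr (2 + \<gamma>) * b m)"
      unfolding \<beta>_def .
  qed
  also have "\<dots> = 6 * M\<^sup>2 * s\<^sup>2 * memory_bound n + 6 * M\<^sup>2 * S * s ^ 3 * (\<Sum>m=2..n + 1. real m * b m)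
      + 36 * M * K * s ^ 3 * (\<Sum>m=2..n + 1. real m powr (2 + \<gamma>) * b m)"
    by (simp only: sum.distrib sum_distrib_left[symmetric] memory_bound_def)
  also have "\<dots> \<le> 6 * M\<^sup>2 * s\<^sup>2 * memory_bound n + 6 * M\<^sup>2 * S * s ^ 3 * S + 36 * M * K * s ^ 3 * a_seq \<gamma> b (n + 1)"
  proof (intro add_mono order_refl mult_left_mono b_sum)
    show "(\<Sum>m=2..n + 1. real m powr (2 + \<gamma>) * b m) \<le> a_seq \<gamma> b (n + 1)"
      unfolding a_seq_def using b_nonneg by (intro sum_mono2) auto
  qed (use M s K_ge_one S_nonneg in auto)
  finally show ?thesis by (simp add: power2_eq_square mult_ac)
qed

lemma increment_eq:
  assumes "n < N" "f n \<noteq> 0"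
  shows "increment n = Lam n + W + T n + memory n"
proof -
  have "increment n = g - 1 + (\<Sum>m=2..n + 1. P m * (f (n + 1 - m) / f n))"
    using assms f_Suc[of n] by (simp add: increment_def add_divide_distrib sum_divide_distrib)
  also have "\<dots> = (g - 1 + (\<Sum>m=2..n + 1. P m)) + memory n"
    by (simp add: memory_def sum_subtractf algebra_simps)
  finally show ?thesis using split[OF assms(1)] by simp
qed

text \<open>
  The heart of the argument. Under the induction hypothesis the memory term is
  \<open>O(s^2)\<close> with a coefficient that depends on \<open>M\<close> and \<open>S\<close> only, up to a term \<open>36 M K s^3 a\<close> that is at most
  \<open>s^2\<close>; so \<open>K\<close> can be reproduced.
\<close>

lemma increment_le:
  "n < N \<Longrightarrow> f n \<noteq> 0 \<and> cmod (increment n) \<le> M * (s * B n) + K * s\<^sup>2"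
proof (induction n rule: less_induct)
  case (less n)
  have nz: "f l \<noteq> 0" if "l \<le> n" for l
  proof (cases "l < n")
    case True then show ?thesis using less by auto
  next
    case False
    have "1 + increment j \<noteq> 0" if "j < n" for j
    proof -
      have "cmod (increment j) \<le> 1 / 2" using less.IH[of j] less.prems that small_ratio[of j] by auto
      then show ?thesis by (rule one_plus_neq_zero)
    qed
    moreover have "f n = f 0 * (\<Prod>j=0..<n. 1 + increment j)"
      using less by (intro f_telescope) auto
    ultimately show ?thesis using False that by (auto simp: f_0)
  qed
  have a: "a_seq \<gamma> b (n + 1) \<le> a_seq \<gamma> b N" using less.prems by (intro a_mono) auto
  have s3: "s ^ 3 = s\<^sup>2 * s" by (simp add: power2_eq_square power3_eq_cube)
  have sa: "s * a_seq \<gamma> b (n + 1) \<le> \<eta>"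
    using mult_left_mono[OF a s(1)] s(3) by linarith
  have memory: "cmod (memory n) \<le> 6 * M\<^sup>2 * s\<^sup>2 * memory_bound n + 6 * M\<^sup>2 * S\<^sup>2 * s ^ 3 + 36 * M * K * s ^ 3 * a_seq \<gamma> b (n + 1)"
    using less nz by (intro memory_le) auto
  also have "\<dots> = s\<^sup>2 * (6 * M\<^sup>2 * memory_bound n + 6 * M\<^sup>2 * S\<^sup>2 * s + 36 * M * K * (s * a_seq \<gamma> b (n + 1)))"
    by (simp add: s3 algebra_simps)
  also have "\<dots> \<le> s\<^sup>2 * (6 * M\<^sup>2 * S\<^sup>2 + 6 * M\<^sup>2 * S\<^sup>2 * 1 + 36 * M * K * \<eta>)"
    using sa memory_bound_le s_le_one M K_ge_one by (intro mult_left_mono add_mono) auto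
  also have "\<dots> \<le> s\<^sup>2 * (12 * M\<^sup>2 * S\<^sup>2 + 1)" using \<eta> by (intro mult_left_mono) auto
  finally have X': "cmod (memory n) \<le> s\<^sup>2 * (12 * M\<^sup>2 * S\<^sup>2 + 1)" .
  have "cmod (T n) \<le> M * (s\<^sup>2 * F n + s ^ 3 * a_seq \<gamma> b (n + 1))"
    using T_le less.prems by simp
  also have "\<dots> = s\<^sup>2 * (M * (F n + s * a_seq \<gamma> b (n + 1)))"
    by (simp add: s3 algebra_simps)
  also have "\<dots> \<le> s\<^sup>2 * (M * (S + 1))"
    using M F_le sa \<eta> by (intro mult_left_mono add_mono) auto
  finally have T': "cmod (T n) \<le> s\<^sup>2 * (M * (S + 1))" .
  have "cmod (increment n) \<le> cmod (Lam n) + cmod W + cmod (T n) + cmod (memory n)"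
    using increment_eq[of n] nz[of n] less.prems
    by (metis norm_triangle_mono order_refl)
  also have "\<dots> \<le> M * (s * B n) + M * s\<^sup>2 + s\<^sup>2 * (M * (S + 1)) + s\<^sup>2 * (12 * M\<^sup>2 * S\<^sup>2 + 1)"
    using X' T' Lam_le less.prems W_le by (intro add_mono) auto
  also have "\<dots> = M * (s * B n) + K * s\<^sup>2" unfolding K_def by (simp add: algebra_simps)
  finally show ?case using nz[of n] by simp
qed

text \<open>
  Summation of \<open>Ln (1 + increment j)\<close>. The quadratic error of the logarithm is of order \<open>s^2 B_j^2 + s^4\<close>,
  and \<open>B_j^2 \<le> S B_j\<close> is summable, while \<open>N s^4\<close> is absorbed by \<open>s^3 A_N\<close>, as \<open>A_N \<ge> N\<close>.
\<close>

lemma exp_representation: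
  assumes N: "1 \<le> N" and b1: "1 \<le> b 1" and E: "(\<Sum>n<N. F n) \<le> E" "1 \<le> E"
  shows "\<exists>R. f N = exp ((\<Sum>j<N. Lam j) + of_nat N * W + R) \<and>
    cmod R \<le> (M + 6 * M\<^sup>2 * S\<^sup>2 + 36 * M * K + 4 * M\<^sup>2 * S\<^sup>2 + 4 * K\<^sup>2) * (s\<^sup>2 * E)
      + (M + 6 * M\<^sup>2 * S\<^sup>2 + 36 * M * K + 4 * M\<^sup>2 * S\<^sup>2 + 4 * K\<^sup>2) * (s ^ 3 * A_seq \<gamma> b N)"
proof -
  define R where "R = (\<Sum>j<N. T j + memory j + (Ln (1 + increment j) - increment j))"
  have half: "cmod (increment j) \<le> 1 / 2" if "j < N" for j
    using increment_le[OF that] small_ratio[of j] by linarith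
  have nz: "1 + increment j \<noteq> 0" if "j < N" for j
    using half[OF that] by (rule one_plus_neq_zero)
  have "f N = f 0 * (\<Prod>j=0..<N. 1 + increment j)" using increment_le by (intro f_telescope) auto
  also have "\<dots> = (\<Prod>j<N. exp (Ln (1 + increment j)))"
    using nz by (simp add: f_0 atLeast0LessThan)
  also have "\<dots> = exp (\<Sum>j<N. Ln (1 + increment j))" by (simp add: exp_sum)
  also have "(\<Sum>j<N. Ln (1 + increment j)) = (\<Sum>j<N. Lam j + W + (T j + memory j + (Ln (1 + increment j) - increment j)))"
    using increment_eq increment_le by (intro sum.cong) auto
  also have "\<dots> = (\<Sum>j<N. Lam j) + of_nat N * W + R"
    by (simp add: sum.distrib R_def)
  finally have 1: "f N = exp ((\<Sum>j<N. Lam j) + of_nat N * W + R)" .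
  have s3: "s ^ 3 = s\<^sup>2 * s" by (simp add: power2_eq_square power3_eq_cube)
  have s43: "s ^ 4 \<le> s ^ 3" using s s_le_one by (intro power_decreasing) auto
  have term_le: "cmod (T j + memory j + (Ln (1 + increment j) - increment j)) \<le>
      M * s\<^sup>2 * F j + 6 * M\<^sup>2 * s\<^sup>2 * memory_bound j + 4 * M\<^sup>2 * S * s\<^sup>2 * B j
      + (M + 36 * M * K) * s ^ 3 * a_seq \<gamma> b (j + 1) + (6 * M\<^sup>2 * S\<^sup>2 + 4 * K\<^sup>2) * s ^ 3" if j: "j < N" for j
  proof -
    have "cmod (Ln (1 + increment j) - increment j) \<le> (cmod (increment j))\<^sup>2 / (1 - cmod (increment j))"
      using half[OF j] by (intro Ln_approx_linear) auto
    also have "\<dots> \<le> (cmod (increment j))\<^sup>2 / (1 / 2)"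
      using half[OF j] by (intro divide_left_mono) auto
    also have "\<dots> = 2 * (cmod (increment j))\<^sup>2" by simp
    also have "\<dots> \<le> 2 * (M * (s * B j) + K * s\<^sup>2)\<^sup>2"
      using increment_le[OF j] by (intro mult_left_mono power_mono) auto
    also have "\<dots> \<le> 2 * (2 * (M * (s * B j))\<^sup>2 + 2 * (K * s\<^sup>2)\<^sup>2)"
      using sum_squares_bound[of "M * (s * B j)" "K * s\<^sup>2"] by (simp add: power2_sum)
    also have "\<dots> = 4 * M\<^sup>2 * s\<^sup>2 * (B j * B j) + 4 * K\<^sup>2 * s ^ 4"
      by (simp add: power2_eq_square power4_eq_xxxx algebra_simps)
    also have "\<dots> \<le> 4 * M\<^sup>2 * s\<^sup>2 * (S * B j) + 4 * K\<^sup>2 * s ^ 3"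
      using s43 B_le B_nonneg by (intro add_mono mult_left_mono mult_right_mono) auto
    finally have L: "cmod (Ln (1 + increment j) - increment j) \<le> 4 * M\<^sup>2 * s\<^sup>2 * (S * B j) + 4 * K\<^sup>2 * s ^ 3" .
    have "cmod (T j + memory j + (Ln (1 + increment j) - increment j)) \<le> cmod (T j) + cmod (memory j) + cmod (Ln (1 + increment j) - increment j)"
      by (metis norm_triangle_mono order_refl)
    also have "\<dots> \<le> M * (s\<^sup>2 * F j + s ^ 3 * a_seq \<gamma> b (j + 1))
      + (6 * M\<^sup>2 * s\<^sup>2 * memory_bound j + 6 * M\<^sup>2 * S\<^sup>2 * s ^ 3 + 36 * M * K * s ^ 3 * a_seq \<gamma> b (j + 1))
      + (4 * M\<^sup>2 * s\<^sup>2 * (S * B j) + 4 * K\<^sup>2 * s ^ 3)"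
      using L T_le[OF j] memory_le[OF j] increment_le j by (intro add_mono) auto
    finally show ?thesis by (simp add: algebra_simps)
  qed
  have "cmod R \<le> (\<Sum>j<N. cmod (T j + memory j + (Ln (1 + increment j) - increment j)))"
    unfolding R_def by (rule norm_sum)
  also have "\<dots> \<le> (\<Sum>j<N. M * s\<^sup>2 * F j + 6 * M\<^sup>2 * s\<^sup>2 * memory_bound j + 4 * M\<^sup>2 * S * s\<^sup>2 * B j
      + (M + 36 * M * K) * s ^ 3 * a_seq \<gamma> b (j + 1) + (6 * M\<^sup>2 * S\<^sup>2 + 4 * K\<^sup>2) * s ^ 3)"
    using term_le by (intro sum_mono) auto
  also have "\<dots> = M * s\<^sup>2 * (\<Sum>j<N. F j) + 6 * M\<^sup>2 * s\<^sup>2 * (\<Sum>j<N. memory_bound j) + 4 * M\<^sup>2 * S * s\<^sup>2 * (\<Sum>j<N. B j)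
      + (M + 36 * M * K) * s ^ 3 * A_seq \<gamma> b N + (6 * M\<^sup>2 * S\<^sup>2 + 4 * K\<^sup>2) * s ^ 3 * real N"
  proof -
    have "A_seq \<gamma> b N = (\<Sum>j<N. a_seq \<gamma> b (j + 1))"
      unfolding A_seq_def by (simp add: sum.atLeast1_atMost_eq)
    then show ?thesis by (simp only: sum.distrib sum_distrib_left[symmetric] sum_constant card_lessThan mult.commute[of "of_nat N"])
  qed
  also have "\<dots> \<le> M * s\<^sup>2 * E + 6 * M\<^sup>2 * s\<^sup>2 * (S\<^sup>2 * E) + 4 * M\<^sup>2 * S * s\<^sup>2 * (S * E)
      + (M + 36 * M * K) * s ^ 3 * A_seq \<gamma> b N + (6 * M\<^sup>2 * S\<^sup>2 + 4 * K\<^sup>2) * s ^ 3 * A_seq \<gamma> b N"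
  proof (intro add_mono order_refl mult_left_mono E)
    have "(\<Sum>j<N. memory_bound j) \<le> S * S"
      unfolding memory_bound_def by (rule sum_window_convolution_le[OF b_nonneg B_nonneg B_sum b_sum])
    also have "\<dots> \<le> S * S * E" using mult_left_mono[OF E(2), of "S * S"] S_nonneg by simp
    finally show "(\<Sum>j<N. memory_bound j) \<le> S\<^sup>2 * E" by (simp add: power2_eq_square)
    show "(\<Sum>j<N. B j) \<le> S * E"
      using B_sum[of N] mult_left_mono[OF E(2) S_nonneg] by simp
    have a1: "1 \<le> a_seq \<gamma> b j" if "1 \<le> j" for j
      using a_mono[OF that] b1 by (simp add: a_seq_def)
    have "real N = (\<Sum>j=1..N. 1)" by simp
    also have "\<dots> \<le> A_seq \<gamma> b N" unfolding A_seq_def using a1 by (intro sum_mono) auto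
    finally show "real N \<le> A_seq \<gamma> b N" .
  qed (use M s S_nonneg K_ge_one in auto)
  also have "\<dots> \<le> (M + 6 * M\<^sup>2 * S\<^sup>2 + 36 * M * K + 4 * M\<^sup>2 * S\<^sup>2 + 4 * K\<^sup>2) * (s\<^sup>2 * E)
      + (M + 6 * M\<^sup>2 * S\<^sup>2 + 36 * M * K + 4 * M\<^sup>2 * S\<^sup>2 + 4 * K\<^sup>2) * (s ^ 3 * A_seq \<gamma> b N)"
  proof -
    have "0 \<le> A_seq \<gamma> b N" unfolding A_seq_def using a_nonneg by (intro sum_nonneg) auto
    then have "0 \<le> s ^ 3 * A_seq \<gamma> b N" "0 \<le> s\<^sup>2 * E" using s E by auto
    then have "0 \<le> (36 * M * K + 4 * K\<^sup>2) * (s\<^sup>2 * E)" "0 \<le> 4 * M\<^sup>2 * S\<^sup>2 * (s ^ 3 * A_seq \<gamma> b N)"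
      using M K_ge_one by auto
    then show ?thesis by (simp add: algebra_simps power2_eq_square)
  qed
  finally show ?thesis using 1 by blast
qed

end


section \<open>Tails of the bounding sequence\<close>

text \<open>
  Exchanging the two sums counts the term \<open>c m\<close> once for each \<open>n < N\<close> with \<open>n \<le> m\<close>. This is where the
  minimum in the definition of \<open>E_seq\<close> comes from.
\<close>

lemma sum_tails_eq:
  fixes c :: "nat \<Rightarrow> real"
  assumes c: "summable c" "\<And>m. 0 \<le> c m"
  shows "summable (\<lambda>m. real (min (m + 1) N) * c m)"
    and "(\<Sum>n<N. \<Sum>m. c (m + n)) = (\<Sum>m. real (min (m + 1) N) * c m)"
proof -
  have s1: "summable (\<lambda>m. real (min (m + 1) N) * c m)" for N
    by (rule summable_comparison_test'[where N = 0 and g = "\<lambda>m. real N * c m"])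
      (use c in \<open>auto intro!: summable_mult mult_right_mono\<close>)
  then show "summable (\<lambda>m. real (min (m + 1) N) * c m)" .
  show "(\<Sum>n<N. \<Sum>m. c (m + n)) = (\<Sum>m. real (min (m + 1) N) * c m)"
  proof (induction N)
    case (Suc N)
    have s2: "summable (\<lambda>m. of_bool (N \<le> m) * c m)"
      by (rule summable_comparison_test'[where N = 0 and g = c]) (use c in auto)
    have "(\<Sum>m. of_bool (N \<le> m) * c m) = (\<Sum>m. c (m + N))"
      using suminf_split_initial_segment[OF s2, of N] by simp
    moreover have "(\<Sum>m. real (min (m + 1) N) * c m) + (\<Sum>m. of_bool (N \<le> m) * c m)
        = (\<Sum>m. real (min (m + 1) (Suc N)) * c m)"
      unfolding suminf_add[OF s1 s2]
      by (intro arg_cong[where f = suminf] ext) (auto simp: min_def algebra_simps)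
    ultimately show ?case using Suc by simp
  qed simp
qed

locale decaying_sequence =
  fixes b :: "nat \<Rightarrow> real"
  assumes b_antimono: "\<And>m n. 1 \<le> m \<Longrightarrow> m \<le> n \<Longrightarrow> b n \<le> b m"
    and b_1: "1 \<le> b 1"
    and summable_weighted: "summable (\<lambda>m. real (Suc m) * b (Suc m))"
begin

text \<open>
  A negative value would persist by monotonicity and contradict that \<open>m b_m\<close> tends to \<open>0\<close>.
\<close>

lemma b_nonneg: "0 \<le> b m" if "1 \<le> m"
proof (rule ccontr)
  assume "\<not> 0 \<le> b m"
  then have neg: "b m < 0" by simp
  have "real (Suc n) * b (Suc n) \<le> b m" if "n \<ge> m" for n
  proof -
    have "b (Suc n) \<le> b m" using \<open>1 \<le> m\<close> that by (intro b_antimono) auto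
    then have "real (Suc n) * b (Suc n) \<le> real (Suc n) * b m" by (intro mult_left_mono) auto
    also have "\<dots> \<le> 1 * b m" using neg by (intro mult_right_mono_neg) auto
    finally show ?thesis by simp
  qed
  then have "0 \<le> b m"
    using summable_LIMSEQ_zero[OF summable_weighted] by (intro LIMSEQ_le_const2) auto
  with neg show False by simp
qed

definition total :: real where "total = (\<Sum>m. real (Suc m) * b (Suc m))"
definition tail :: "nat \<Rightarrow> real" where "tail n = (\<Sum>m. b (m + n + 2))"
definition weighted_tail :: "nat \<Rightarrow> real" where
  "weighted_tail n = (\<Sum>m. real (m + n + 2) * b (m + n + 2))"

lemma summable_weighted_shift: "summable (\<lambda>m. real (m + n + 2) * b (m + n + 2))"
  using summable_ignore_initial_segment[OF summable_weighted, of "n + 1"] by simp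

lemma summable_shift: "summable (\<lambda>m. b (m + n + 2))"
proof (rule summable_comparison_test'[where N = 0, OF summable_weighted_shift])
  fix m
  have "1 * b (m + n + 2) \<le> real (m + n + 2) * b (m + n + 2)"
    using b_nonneg by (intro mult_right_mono) auto
  then show "norm (b (m + n + 2)) \<le> real (m + n + 2) * b (m + n + 2)" using b_nonneg[of "m + n + 2"] by simp
qed

lemma tail_nonneg: "0 \<le> tail n"
  unfolding tail_def using b_nonneg summable_shift by (intro suminf_nonneg) auto

lemma weighted_tail_nonneg: "0 \<le> weighted_tail n"
  unfolding weighted_tail_def using b_nonneg summable_weighted_shift by (intro suminf_nonneg mult_nonneg_nonneg) auto

lemma weighted_tail_le: "weighted_tail n \<le> total"
proof -
  have "total = (\<Sum>m. real (Suc (m + (n + 1))) * b (Suc (m + (n + 1)))) + (\<Sum>m<n + 1. real (Suc m) * b (Suc m))"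
    unfolding total_def by (rule suminf_split_initial_segment[OF summable_weighted])
  moreover have "0 \<le> (\<Sum>m<n + 1. real (Suc m) * b (Suc m))"
    using b_nonneg by (intro sum_nonneg mult_nonneg_nonneg) auto
  ultimately show ?thesis by (simp add: weighted_tail_def)
qed

lemma tail_sum_le: "(\<Sum>l<n. tail l) \<le> total"
proof -
  have "(\<Sum>l<n. tail l) = (\<Sum>m. real (min (m + 1) n) * b (m + 2))"
    unfolding tail_def using sum_tails_eq(2)[of "\<lambda>m. b (m + 2)" n] summable_shift[of 0] b_nonneg
    by (simp add: add.assoc)
  also have "\<dots> \<le> weighted_tail 0"
    unfolding weighted_tail_def
    using sum_tails_eq(1)[of "\<lambda>m. b (m + 2)" n] summable_shift[of 0] summable_weighted_shift[of 0] b_nonneg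
    by (intro suminf_le mult_mono) auto
  also have "\<dots> \<le> total" by (rule weighted_tail_le)
  finally show ?thesis .
qed

lemma weighted_sum_le: "(\<Sum>m=2..n. real m * b m) \<le> total"
proof -
  have "(\<Sum>m=2..n. real m * b m) \<le> (\<Sum>m=1..n. real m * b m)"
    using b_nonneg by (intro sum_mono2) auto
  also have "\<dots> = (\<Sum>m<n. real (Suc m) * b (Suc m))"
    by (subst sum.atLeast1_atMost_eq[folded One_nat_def]) simp
  also have "\<dots> \<le> total"
    unfolding total_def using b_nonneg by (intro sum_le_suminf summable_weighted mult_nonneg_nonneg) auto
  finally show ?thesis .
qed

lemma E_seq_split:
  "E_seq b n = real (min 1 n) * b 1 + (\<Sum>m. real (min (m + 2) n) * (real (m + 2) * b (m + 2)))"
  "summable (\<lambda>m. real (min (m + 2) n) * (real (m + 2) * b (m + 2)))"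
proof -
  have s: "summable (\<lambda>m. real (min (m + 1) n) * (real (Suc m) * b (Suc m)))"
    using sum_tails_eq(1)[OF summable_weighted] b_nonneg by simp
  show "E_seq b n = real (min 1 n) * b 1 + (\<Sum>m. real (min (m + 2) n) * (real (m + 2) * b (m + 2)))"
    using suminf_split_head[OF s] by (simp add: E_seq_def mult.assoc)
  show "summable (\<lambda>m. real (min (m + 2) n) * (real (m + 2) * b (m + 2)))"
    using summable_ignore_initial_segment[OF s, of 1] by simp
qed

lemma weighted_tail_sum_le: "(\<Sum>j<n. weighted_tail j) \<le> E_seq b n"
proof -
  have "(\<Sum>j<n. weighted_tail j) = (\<Sum>m. real (min (m + 1) n) * (real (m + 2) * b (m + 2)))"
    unfolding weighted_tail_def
    using sum_tails_eq(2)[of "\<lambda>m. real (m + 2) * b (m + 2)" n] summable_weighted_shift[of 0] b_nonneg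
    by (simp add: add.assoc)
  also have "\<dots> \<le> (\<Sum>m. real (min (m + 2) n) * (real (m + 2) * b (m + 2)))"
    using sum_tails_eq(1)[of "\<lambda>m. real (m + 2) * b (m + 2)" n] summable_weighted_shift[of 0] b_nonneg E_seq_split(2)
    by (intro suminf_le mult_right_mono) auto
  also have "\<dots> \<le> E_seq b n"
    using b_1 by (simp add: E_seq_split(1))
  finally show ?thesis .
qed

lemma E_seq_ge_one: "1 \<le> E_seq b n" if "1 \<le> n"
proof -
  have "0 \<le> (\<Sum>m. real (min (m + 2) n) * (real (m + 2) * b (m + 2)))"
    using E_seq_split(2) b_nonneg by (intro suminf_nonneg) auto
  then show ?thesis using b_1 that by (simp add: E_seq_split(1))
qed

end

section \<open>Moments of the expansion coefficients\<close>

lemma norm_i_cvec: "norm (\<i> *s cvec v) = norm v"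
  by (simp add: norm_vec_def L2_set_def cvec_def norm_mult)

lemma bounded_linear_i_cvec: "bounded_linear (\<lambda>v :: real ^ 'd. \<i> *s cvec v)"
  unfolding linear_conv_bounded_linear[symmetric]
  by (rule linearI) (simp_all add: cvec_def vec_eq_iff algebra_simps scaleR_conv_of_real[where 'a = complex])

lemma bounded_linear_cmat: "bounded_linear (cmat :: real ^ 'd ^ 'd \<Rightarrow> _)"
  unfolding linear_conv_bounded_linear[symmetric]
  by (rule linearI) (simp_all add: cmat_def vec_eq_iff scaleR_conv_of_real[where 'a = complex])

lemma bounded_linear_quadratic: "bounded_linear (\<lambda>M :: real ^ 'd ^ 'd. k \<bullet> (M *v k))"
  unfolding linear_conv_bounded_linear[symmetric]
  by (rule linearI) (simp_all add: matrix_vector_mult_add_rdistrib inner_add_right scaleR_matrix_vector_assoc[symmetric])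

lemma inner_matrix_eq: "k \<bullet> (M *v k) = (\<Sum>i\<in>UNIV. \<Sum>j\<in>UNIV. k $ i * M $ i $ j * k $ j)"
  for k :: "real ^ 'd"
  by (simp add: inner_vec_def matrix_vector_mult_def sum_distrib_left mult.assoc)

lemma abs_quadratic_le: "\<bar>k \<bullet> (M *v k)\<bar> \<le> (norm k)\<^sup>2 * mat_norm M" for k :: "real ^ 'd"
proof -
  have "\<bar>k \<bullet> (M *v k)\<bar> \<le> (\<Sum>i\<in>UNIV. \<Sum>j\<in>UNIV. \<bar>k $ i * M $ i $ j * k $ j\<bar>)"
    unfolding inner_matrix_eq by (intro order_trans[OF sum_abs] sum_mono sum_abs)
  also have "\<dots> \<le> (\<Sum>i\<in>UNIV. \<Sum>j\<in>UNIV. (norm k)\<^sup>2 * \<bar>M $ i $ j\<bar>)"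
  proof (intro sum_mono)
    fix i j
    have "\<bar>k $ i\<bar> * \<bar>k $ j\<bar> \<le> norm k * norm k"
      using component_le_norm_cart by (intro mult_mono) auto
    then have "\<bar>k $ i\<bar> * \<bar>k $ j\<bar> * \<bar>M $ i $ j\<bar> \<le> norm k * norm k * \<bar>M $ i $ j\<bar>"
      by (intro mult_right_mono) auto
    then show "\<bar>k $ i * M $ i $ j * k $ j\<bar> \<le> (norm k)\<^sup>2 * \<bar>M $ i $ j\<bar>"
      by (simp add: abs_mult power2_eq_square mult_ac)
  qed
  finally show ?thesis by (simp add: mat_norm_def sum_distrib_left)
qed

lemma norm_le_mat_norm: "norm M \<le> mat_norm M" for M :: "real ^ 'd ^ 'd"
proof -
  have "norm M \<le> (\<Sum>i\<in>UNIV. norm (M $ i))" unfolding norm_vec_def by (rule L2_set_le_sum) simp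
  also have "\<dots> \<le> (\<Sum>i\<in>UNIV. \<Sum>j\<in>UNIV. norm (M $ i $ j))"
    by (intro sum_mono) (use norm_le_l1_cart in auto)
  finally show ?thesis by (simp add: mat_norm_def)
qed

locale expansion_walk = ranged_walk p L + decaying_sequence b
  for p :: "(int ^ 'd) list \<Rightarrow> (int ^ 'd) pmf" and L b +
  fixes e :: real
  assumes e_nonneg: "0 \<le> e" and bounds: "expansion_bounds p e b"
begin

definition pi_support :: "nat \<Rightarrow> (int ^ 'd) set" where "pi_support m = {x. pi_coeff p m x \<noteq> 0}"

text \<open>
  The first and second moments of \<open>pi_coeff p m\<close>: the gradient of \<open>pi_hat\<close> at the origin is
  \<open>\<i> drift_coeff\<close> and its Hessian there is \<open>- second_coeff\<close>.
\<close>

definition drift_coeff :: "nat \<Rightarrow> real ^ 'd" where "drift_coeff m = (\<Sum>x\<in>pi_support m. pi_coeff p m x *\<^sub>R rvec x)"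

definition second_coeff :: "nat \<Rightarrow> real ^ 'd ^ 'd" where
  "second_coeff m = (\<chi> i j. \<Sum>x\<in>pi_support m. rvec x $ i * rvec x $ j * pi_coeff p m x)"

lemma pi_hat_trig: "2 \<le> m \<Longrightarrow> pi_hat p m = trig (pi_support m) (\<lambda>x. complex_of_real (pi_coeff p m x)) rvec"
  unfolding pi_support_def by (rule fourier_eq_trig) (rule finite_support_pi_coeff)

lemma sum_pi_coeff: "2 \<le> m \<Longrightarrow> (\<Sum>x\<in>pi_support m. pi_coeff p m x) = 0"
proof -
  assume m: "2 \<le> m"
  then have "pi_hat p m 0 = 0" using bounds by (simp add: expansion_bounds_def)
  then have "complex_of_real (\<Sum>x\<in>pi_support m. pi_coeff p m x) = 0" unfolding pi_hat_trig[OF m] by (simp add: trig_def)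
  then show ?thesis by (simp only: of_real_eq_0_iff)
qed

lemma grad_eq: "2 \<le> m \<Longrightarrow> grad (pi_hat p m) 0 = \<i> *s cvec (drift_coeff m)"
  by (simp add: pi_hat_trig grad_trig_0 drift_coeff_def cvec_def vec_eq_iff sum_component mult.commute)

lemma hessian_eq: "2 \<le> m \<Longrightarrow> hessian (pi_hat p m) 0 = - cmat (second_coeff m)"
  by (simp add: pi_hat_trig hessian_trig_0 second_coeff_def cmat_def vec_eq_iff)

lemma drift_coeff_le: "2 \<le> m \<Longrightarrow> norm (drift_coeff m) \<le> e * b m"
  using bounds by (simp add: expansion_bounds_def grad_eq norm_i_cvec)

lemma second_coeff_le: "2 \<le> m \<Longrightarrow> mat_norm (second_coeff m) \<le> e * real m * b m"
  using bounds by (simp add: expansion_bounds_def hessian_eq) (simp add: mat_norm_def cmat_def)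

lemma lin_form_grad: "2 \<le> m \<Longrightarrow> lin_form k (grad (pi_hat p m) 0) = \<i> * complex_of_real (k \<bullet> drift_coeff m)"
  by (simp add: grad_eq lin_form_def inner_vec_def cvec_def sum_distrib_left mult_ac)

lemma quad_form_hessian:
  "2 \<le> m \<Longrightarrow> quad_form k (hessian (pi_hat p m) 0) = - complex_of_real (k \<bullet> (second_coeff m *v k))"
  by (simp add: hessian_eq quad_form_def inner_matrix_eq cmat_def sum_negf mult_ac)

lemma abs_drift_coeff_le: "\<bar>k \<bullet> drift_coeff m\<bar> \<le> e * (norm k * b m)" if "2 \<le> m"
proof -
  have "\<bar>k \<bullet> drift_coeff m\<bar> \<le> norm k * norm (drift_coeff m)" by (rule Cauchy_Schwarz_ineq2)
  also have "\<dots> \<le> norm k * (e * b m)" using drift_coeff_le[OF that] by (intro mult_left_mono) auto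
  finally show ?thesis by (simp add: mult_ac)
qed

lemma abs_second_coeff_le: "\<bar>k \<bullet> (second_coeff m *v k)\<bar> \<le> e * ((norm k)\<^sup>2 * (real m * b m))" if "2 \<le> m"
proof -
  have "\<bar>k \<bullet> (second_coeff m *v k)\<bar> \<le> (norm k)\<^sup>2 * mat_norm (second_coeff m)" by (rule abs_quadratic_le)
  also have "\<dots> \<le> (norm k)\<^sup>2 * (e * real m * b m)" using second_coeff_le[OF that] by (intro mult_left_mono) auto
  finally show ?thesis by (simp add: mult_ac)
qed

lemma first_remainder_le:
  assumes "2 \<le> m" "norm k \<le> 1"
  shows "cmod (pi_hat p m k - \<i> * complex_of_real (k \<bullet> drift_coeff m)) \<le> e * ((norm k)\<^sup>2 * (real m * b m))"
    and "cmod (pi_hat p m k - \<i> * complex_of_real (k \<bullet> drift_coeff m) + complex_of_real (k \<bullet> (second_coeff m *v k) / 2))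
      \<le> e * (norm k ^ 3 * ((real m)\<^sup>2 * b m))"
proof -
  have "k $ i \<in> {-pi..pi}" for i
    using component_le_norm_cart[of k i] assms(2) pi_gt3 by (auto simp: abs_le_iff)
  then have 1: "cmod (pi_hat p m k - lin_form k (grad (pi_hat p m) 0)) \<le> e * (norm k)\<^sup>2 * real m * b m"
    and 2: "cmod (pi_hat p m k - lin_form k (grad (pi_hat p m) 0)
               - 1 / 2 * quad_form k (hessian (pi_hat p m) 0)) \<le> e * (norm k) ^ 3 * (real m)\<^sup>2 * b m"
    using bounds assms(1) unfolding expansion_bounds_def by blast+
  show "cmod (pi_hat p m k - \<i> * complex_of_real (k \<bullet> drift_coeff m)) \<le> e * ((norm k)\<^sup>2 * (real m * b m))"
    using 1 by (simp add: lin_form_grad assms mult_ac)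
  show "cmod (pi_hat p m k - \<i> * complex_of_real (k \<bullet> drift_coeff m) + complex_of_real (k \<bullet> (second_coeff m *v k) / 2))
      \<le> e * (norm k ^ 3 * ((real m)\<^sup>2 * b m))"
    using 2 by (simp add: lin_form_grad quad_form_hessian assms mult_ac)
qed

lemma summable_drift_coeff: "summable (\<lambda>m. drift_coeff (m + 2))"
  by (rule summable_comparison_test'[where N = 0, OF summable_mult[OF summable_shift[of 0], of e]]) (use drift_coeff_le in auto)

definition \<theta> :: "real ^ 'd" where "\<theta> = step_mean p + (\<Sum>m. drift_coeff (m + 2))"

lemma theta_formula: "theta_formula p \<theta>"
  unfolding theta_formula_def
proof
  have eq: "(\<lambda>m. grad (pi_hat p (m + 2)) 0) = (\<lambda>m. \<i> *s cvec (drift_coeff (m + 2)))" by (simp add: grad_eq)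
  show "summable (\<lambda>m. grad (pi_hat p (m + 2)) 0)"
    unfolding eq by (rule bounded_linear.summable[OF bounded_linear_i_cvec summable_drift_coeff])
  have "(\<Sum>m. grad (pi_hat p (m + 2)) 0) = \<i> *s cvec (\<Sum>m. drift_coeff (m + 2))"
    unfolding eq by (rule bounded_linear.suminf[OF bounded_linear_i_cvec summable_drift_coeff, symmetric])
  then show "cvec \<theta> = cvec (step_mean p) - \<i> *s (\<Sum>m. grad (pi_hat p (m + 2)) 0)"
    by (simp add: \<theta>_def cvec_def vec_eq_iff)
qed

text \<open>
  The second moment of \<open>pi_coeff p m\<close> about \<open>(m - 1) \<theta>\<close>. The term with \<open>\<theta> \<theta>\<^sup>t\<close> is absent because
  \<open>pi_coeff p m\<close> has total mass zero.
\<close>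

definition twisted_coeff :: "nat \<Rightarrow> real ^ 'd ^ 'd" where
  "twisted_coeff m = (\<chi> i j. second_coeff m $ i $ j - (real m - 1) * (\<theta> $ i * drift_coeff m $ j + drift_coeff m $ i * \<theta> $ j))"

lemma twisted_hessian_eq: "2 \<le> m \<Longrightarrow> twisted_hessian p \<theta> m = - cmat (twisted_coeff m)"
proof -
  assume m: "2 \<le> m"
  let ?t = "real m - 1"
  have "(\<Sum>x\<in>pi_support m. (rvec x - ?t *\<^sub>R \<theta>) $ i * (rvec x - ?t *\<^sub>R \<theta>) $ j * pi_coeff p m x) = twisted_coeff m $ i $ j" for i j
  proof -
    have "(\<Sum>x\<in>pi_support m. (rvec x - ?t *\<^sub>R \<theta>) $ i * (rvec x - ?t *\<^sub>R \<theta>) $ j * pi_coeff p m x)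
      = (\<Sum>x\<in>pi_support m. rvec x $ i * rvec x $ j * pi_coeff p m x - ?t * (\<theta> $ i * (pi_coeff p m x * rvec x $ j)
          + (pi_coeff p m x * rvec x $ i) * \<theta> $ j) + ?t * ?t * \<theta> $ i * \<theta> $ j * pi_coeff p m x)"
      by (intro sum.cong refl) (simp add: algebra_simps)
    also have "\<dots> = twisted_coeff m $ i $ j + ?t * ?t * \<theta> $ i * \<theta> $ j * (\<Sum>x\<in>pi_support m. pi_coeff p m x)"
      by (simp add: twisted_coeff_def second_coeff_def drift_coeff_def sum.distrib sum_subtractf sum_distrib_left sum_distrib_right distrib_left)
    finally show ?thesis by (simp add: sum_pi_coeff[OF m])
  qed
  then show ?thesis
    unfolding twisted_hessian_def pi_hat_trig[OF m] modulated_trig hessian_trig_0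
    by (simp add: vec_eq_iff cmat_def flip: of_real_mult of_real_sum)
qed

lemma twisted_coeff_quadratic: "k \<bullet> (twisted_coeff m *v k) = k \<bullet> (second_coeff m *v k) - 2 * (real m - 1) * (k \<bullet> \<theta>) * (k \<bullet> drift_coeff m)"
proof -
  have "k \<bullet> (twisted_coeff m *v k) = (\<Sum>i\<in>UNIV. \<Sum>j\<in>UNIV. k $ i * second_coeff m $ i $ j * k $ j
     - (real m - 1) * ((k $ i * \<theta> $ i) * (k $ j * drift_coeff m $ j) + (k $ i * drift_coeff m $ i) * (k $ j * \<theta> $ j)))"
    unfolding inner_matrix_eq twisted_coeff_def by (intro sum.cong refl) (simp add: algebra_simps)
  also have "\<dots> = k \<bullet> (second_coeff m *v k) - (real m - 1) * ((k \<bullet> \<theta>) * (k \<bullet> drift_coeff m) + (k \<bullet> drift_coeff m) * (k \<bullet> \<theta>))"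
  proof -
    have "(k \<bullet> u) * (k \<bullet> v) = (\<Sum>i\<in>UNIV. \<Sum>j\<in>UNIV. (k $ i * u $ i) * (k $ j * v $ j))" for u v
      by (simp add: inner_vec_def sum_product)
    then show ?thesis
      unfolding inner_matrix_eq by (simp only: sum_subtractf sum.distrib sum_distrib_left[symmetric])
  qed
  finally show ?thesis by (simp add: algebra_simps)
qed

lemma twisted_coeff_le: "2 \<le> m \<Longrightarrow> norm (twisted_coeff m) \<le> e * (1 + 2 * real CARD('d) * real CARD('d) * norm \<theta>) * (real m * b m)"
proof -
  assume m: "2 \<le> m"
  have bm: "0 \<le> real m * b m" "0 \<le> b m" using b_nonneg m by auto
  have "mat_norm (twisted_coeff m) \<le> (\<Sum>i\<in>UNIV. \<Sum>j\<in>UNIV. \<bar>second_coeff m $ i $ j\<bar> + 2 * (real m * (norm \<theta> * (e * b m))))"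
    unfolding mat_norm_def
  proof (intro sum_mono)
    fix i j
    have drift_coeff: "norm (drift_coeff m $ i) \<le> e * b m" for i using component_le_norm_cart[of "drift_coeff m" i] drift_coeff_le[OF m] by simp
    have "\<bar>\<theta> $ i * drift_coeff m $ j + drift_coeff m $ i * \<theta> $ j\<bar> \<le> norm \<theta> * (e * b m) + (e * b m) * norm \<theta>"
      using drift_coeff component_le_norm_cart e_nonneg bm
      by (intro order_trans[OF abs_triangle_ineq] add_mono) (auto simp: abs_mult intro!: mult_mono)
    then have "\<bar>real m - 1\<bar> * \<bar>\<theta> $ i * drift_coeff m $ j + drift_coeff m $ i * \<theta> $ j\<bar> \<le> real m * (norm \<theta> * (e * b m) + (e * b m) * norm \<theta>)"
      using m by (intro mult_mono) auto
    then have "\<bar>(real m - 1) * (\<theta> $ i * drift_coeff m $ j + drift_coeff m $ i * \<theta> $ j)\<bar> \<le> 2 * (real m * (norm \<theta> * (e * b m)))"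
      unfolding abs_mult by (simp add: algebra_simps)
    then show "norm (twisted_coeff m $ i $ j) \<le> \<bar>second_coeff m $ i $ j\<bar> + 2 * (real m * (norm \<theta> * (e * b m)))"
      by (simp add: twisted_coeff_def)
  qed
  also have "\<dots> = mat_norm (second_coeff m) + 2 * real CARD('d) * real CARD('d) * (real m * (norm \<theta> * (e * b m)))"
    by (simp add: mat_norm_def sum.distrib)
  also have "\<dots> \<le> e * real m * b m + 2 * real CARD('d) * real CARD('d) * (real m * (norm \<theta> * (e * b m)))"
    using second_coeff_le[OF m] by simp
  finally have "mat_norm (twisted_coeff m) \<le> e * (1 + 2 * real CARD('d) * real CARD('d) * norm \<theta>) * (real m * b m)"
    by (simp add: algebra_simps)
  then show ?thesis using norm_le_mat_norm order_trans by blast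
qed

lemma summable_twisted_coeff: "summable (\<lambda>m. twisted_coeff (m + 2))"
  by (rule summable_comparison_test'[where N = 0, OF summable_mult[OF summable_weighted_shift[of 0],
    of "e * (1 + 2 * real CARD('d) * real CARD('d) * norm \<theta>)"]]) (use twisted_coeff_le[of "_ + 2"] in simp)

definition \<Sigma> :: "real ^ 'd ^ 'd" where
  "\<Sigma> = step_second_moment p - outer \<theta> \<theta> + (\<Sum>m. twisted_coeff (m + 2))"

lemma covariance_formula: "covariance_formula p \<theta> \<Sigma>"
  unfolding covariance_formula_def
proof
  have eq: "(\<lambda>m. twisted_hessian p \<theta> (m + 2)) = (\<lambda>m. - cmat (twisted_coeff (m + 2)))" by (simp add: twisted_hessian_eq)
  have s: "summable (\<lambda>m. cmat (twisted_coeff (m + 2)))" by (rule bounded_linear.summable[OF bounded_linear_cmat summable_twisted_coeff])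
  show "summable (\<lambda>m. twisted_hessian p \<theta> (m + 2))"
    unfolding eq using s by (rule summable_minus)
  have "(\<Sum>m. twisted_hessian p \<theta> (m + 2)) = - cmat (\<Sum>m. twisted_coeff (m + 2))"
    unfolding eq suminf_minus[OF s] bounded_linear.suminf[OF bounded_linear_cmat summable_twisted_coeff] ..
  then show "cmat \<Sigma> = cmat (step_second_moment p) - cmat (outer \<theta> \<theta>) - (\<Sum>m. twisted_hessian p \<theta> (m + 2))"
    by (simp add: \<Sigma>_def cmat_def vec_eq_iff)
qed

end


section \<open>Second-order balance of the kernel\<close>

context expansion_walk
begin

lemma nbrs_origin: "nbrs L [0] = step_box L"
  by (auto simp: mem_nbrs)

lemma step_dist_out: "x \<notin> step_box L \<Longrightarrow> step_dist p x = 0"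
  using pmf_out_of_range[of "[0]" x] by (simp add: step_dist_def)

lemma sum_step_dist: "(\<Sum>x\<in>step_box L. step_dist p x) = 1"
  using sum_pmf_nbrs[of "[0]"] by (simp add: nbrs_origin step_dist_def)

lemma step_mean_eq: "step_mean p = (\<Sum>x\<in>step_box L. step_dist p x *\<^sub>R rvec x)"
proof -
  have "step_mean p = (\<Sum>\<^sub>\<infinity>x\<in>step_box L. step_dist p x *\<^sub>R rvec x)"
    unfolding step_mean_def by (rule infsum_cong_neutral) (auto simp: step_dist_out)
  then show ?thesis by (simp add: finite_step_box)
qed

lemma step_second_moment_eq:
  "step_second_moment p $ i $ j = (\<Sum>x\<in>step_box L. rvec x $ i * rvec x $ j * step_dist p x)"
proof -
  have "step_second_moment p $ i $ j = (\<Sum>\<^sub>\<infinity>x\<in>step_box L. rvec x $ i * rvec x $ j * step_dist p x)"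
    unfolding step_second_moment_def vec_lambda_beta by (rule infsum_cong_neutral) (auto simp: step_dist_out)
  then show ?thesis by (simp add: finite_step_box)
qed

lemma step_second_moment_quadratic:
  "k \<bullet> (step_second_moment p *v k) = (\<Sum>x\<in>step_box L. step_dist p x * (k \<bullet> rvec x)\<^sup>2)"
proof -
  have "k \<bullet> (step_second_moment p *v k)
      = (\<Sum>i\<in>UNIV. \<Sum>j\<in>UNIV. \<Sum>x\<in>step_box L. step_dist p x * ((k $ i * rvec x $ i) * (k $ j * rvec x $ j)))"
    unfolding inner_matrix_eq step_second_moment_eq sum_distrib_left sum_distrib_right
    by (intro sum.cong refl) (simp add: mult_ac)
  also have "\<dots> = (\<Sum>i\<in>UNIV. \<Sum>x\<in>step_box L. \<Sum>j\<in>UNIV. step_dist p x * ((k $ i * rvec x $ i) * (k $ j * rvec x $ j)))"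
    by (intro sum.cong refl sum.swap)
  also have "\<dots> = (\<Sum>x\<in>step_box L. \<Sum>i\<in>UNIV. \<Sum>j\<in>UNIV. step_dist p x * ((k $ i * rvec x $ i) * (k $ j * rvec x $ j)))"
    by (rule sum.swap)
  also have "\<dots> = (\<Sum>x\<in>step_box L. step_dist p x * (k \<bullet> rvec x)\<^sup>2)"
    unfolding power2_eq_square inner_vec_def sum_product by (simp add: sum_distrib_left)
  finally show ?thesis .
qed

lemma first_step_expansion:
  "cmod (exp (- \<i> * complex_of_real (k \<bullet> \<theta>)) * expansion_coeff k 1
      - (1 + \<i> * complex_of_real (k \<bullet> step_mean p - k \<bullet> \<theta>)
         - complex_of_real ((k \<bullet> (step_second_moment p *v k) - 2 * (k \<bullet> \<theta>) * (k \<bullet> step_mean p) + (k \<bullet> \<theta>)\<^sup>2) / 2)))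
    \<le> norm k ^ 3 * (\<bar>L\<bar> + norm \<theta>) ^ 3"
proof -
  define u where "u = k \<bullet> \<theta>"
  define y where "y x = k \<bullet> rvec x - u" for x
  let ?D = "step_dist p" and ?X = "step_box L :: (int ^ 'd) set"
  have D0: "0 \<le> ?D x" for x by (simp add: step_dist_def)
  have "exp (- \<i> * complex_of_real u) * expansion_coeff k 1 = (\<Sum>x\<in>?X. ?D x *\<^sub>R exp (\<i> * complex_of_real (y x)))"
    by (simp add: expansion_coeff_1[unfolded One_nat_def] nbrs_origin wave_def y_def sum_distrib_left exp_diff exp_minus right_diff_distrib field_simps)
  moreover have "1 + \<i> * complex_of_real (k \<bullet> step_mean p - u)
         - complex_of_real ((k \<bullet> (step_second_moment p *v k) - 2 * u * (k \<bullet> step_mean p) + u\<^sup>2) / 2)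
      = (\<Sum>x\<in>?X. ?D x *\<^sub>R (1 + \<i> * complex_of_real (y x) - complex_of_real ((y x)\<^sup>2 / 2)))"
  proof -
    have m1: "(\<Sum>x\<in>?X. ?D x * y x) = k \<bullet> step_mean p - u"
      using sum_step_dist
      by (simp add: y_def step_mean_eq inner_sum_right right_diff_distrib sum_subtractf sum_distrib_right[symmetric])
    have "(\<Sum>x\<in>?X. ?D x * (y x)\<^sup>2)
        = (\<Sum>x\<in>?X. ?D x * (k \<bullet> rvec x)\<^sup>2 - 2 * u * (?D x * (k \<bullet> rvec x)) + u\<^sup>2 * ?D x)"
      by (intro sum.cong refl) (simp add: y_def power2_eq_square algebra_simps)
    also have "\<dots> = k \<bullet> (step_second_moment p *v k) - 2 * u * (k \<bullet> step_mean p) + u\<^sup>2"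
      unfolding sum.distrib sum_subtractf sum_distrib_left[symmetric] sum_step_dist
      by (simp add: step_second_moment_quadratic step_mean_eq inner_sum_right)
    finally have m2: "(\<Sum>x\<in>?X. ?D x * (y x)\<^sup>2) = k \<bullet> (step_second_moment p *v k) - 2 * u * (k \<bullet> step_mean p) + u\<^sup>2" .
    have "(\<Sum>x\<in>?X. ?D x *\<^sub>R (1 + \<i> * complex_of_real (y x) - complex_of_real ((y x)\<^sup>2 / 2)))
      = complex_of_real (\<Sum>x\<in>?X. ?D x) + \<i> * complex_of_real (\<Sum>x\<in>?X. ?D x * y x) - complex_of_real ((\<Sum>x\<in>?X. ?D x * (y x)\<^sup>2) / 2)"
      by (simp add: scaleR_conv_of_real ring_distribs sum.distrib sum_subtractf sum_distrib_left sum_divide_distrib mult_ac)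
    then show ?thesis unfolding m1 m2 sum_step_dist by simp
  qed
  ultimately have "cmod (exp (- \<i> * complex_of_real u) * expansion_coeff k 1
      - (1 + \<i> * complex_of_real (k \<bullet> step_mean p - u)
         - complex_of_real ((k \<bullet> (step_second_moment p *v k) - 2 * u * (k \<bullet> step_mean p) + u\<^sup>2) / 2)))
    = cmod (\<Sum>x\<in>?X. ?D x *\<^sub>R (exp (\<i> * complex_of_real (y x))
        - (1 + \<i> * complex_of_real (y x) - complex_of_real ((y x)\<^sup>2 / 2))))"
    by (simp only: scaleR_diff_right sum_subtractf)
  also have "\<dots> \<le> (\<Sum>x\<in>?X. ?D x * (norm k ^ 3 * (\<bar>L\<bar> + norm \<theta>) ^ 3))"
  proof (rule sum_norm_le)
    fix x assume "x \<in> ?X"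
    then have "norm (rvec x) \<le> \<bar>L\<bar>" by (simp add: step_box_def)
    then have "norm (rvec x - \<theta>) \<le> \<bar>L\<bar> + norm \<theta>" using norm_triangle_ineq4[of "rvec x" \<theta>] by linarith
    then have "norm k * norm (rvec x - \<theta>) \<le> norm k * (\<bar>L\<bar> + norm \<theta>)" by (intro mult_left_mono) auto
    moreover have "\<bar>y x\<bar> \<le> norm k * norm (rvec x - \<theta>)"
      unfolding y_def u_def inner_diff_right[symmetric] by (rule Cauchy_Schwarz_ineq2)
    ultimately have "\<bar>y x\<bar> ^ 3 \<le> (norm k * (\<bar>L\<bar> + norm \<theta>)) ^ 3" by (intro power_mono) auto
    then have "\<bar>y x\<bar> ^ 3 \<le> norm k ^ 3 * (\<bar>L\<bar> + norm \<theta>) ^ 3" by (simp add: power_mult_distrib)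
    then have "cmod (exp (\<i> * complex_of_real (y x)) - (1 + \<i> * complex_of_real (y x) - complex_of_real ((y x)\<^sup>2 / 2)))
        \<le> norm k ^ 3 * (\<bar>L\<bar> + norm \<theta>) ^ 3"
      using cmod_exp_i_second_order[of "y x"] by linarith
    then show "cmod (?D x *\<^sub>R (exp (\<i> * complex_of_real (y x)) - (1 + \<i> * complex_of_real (y x) - complex_of_real ((y x)\<^sup>2 / 2))))
        \<le> ?D x * (norm k ^ 3 * (\<bar>L\<bar> + norm \<theta>) ^ 3)"
      unfolding norm_scaleR using D0[of x] by (simp add: mult_left_mono)
  qed
  also have "\<dots> = norm k ^ 3 * (\<bar>L\<bar> + norm \<theta>) ^ 3"
    by (simp add: sum_distrib_right[symmetric] sum_step_dist)
  finally show ?thesis by (simp add: u_def)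
qed

definition twisted_pi :: "real ^ 'd \<Rightarrow> nat \<Rightarrow> complex" where
  "twisted_pi k m = exp (- \<i> * complex_of_real (k \<bullet> \<theta> * real m)) * pi_hat p m k"

lemma twisted_pi_le:
  assumes "2 \<le> m" "norm k \<le> 1"
  shows "cmod (twisted_pi k m) \<le> e * (norm k * b m + (norm k)\<^sup>2 * (real m * b m))"
proof -
  have "cmod (twisted_pi k m) = cmod (pi_hat p m k)" by (simp add: twisted_pi_def norm_mult)
  also have "\<dots> \<le> cmod (pi_hat p m k - \<i> * complex_of_real (k \<bullet> drift_coeff m)) + cmod (\<i> * complex_of_real (k \<bullet> drift_coeff m))"
    by (metis diff_add_cancel norm_triangle_ineq)
  also have "\<dots> \<le> e * ((norm k)\<^sup>2 * (real m * b m)) + e * (norm k * b m)"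
    using first_remainder_le(1)[OF assms] abs_drift_coeff_le[OF assms(1), of k] by (intro add_mono) (auto simp: norm_mult)
  finally show ?thesis by (simp add: algebra_simps)
qed

lemma twisted_pi_expansion:
  assumes m: "2 \<le> m" and k: "norm k \<le> 1"
  shows "cmod (twisted_pi k m - (\<i> * complex_of_real (k \<bullet> drift_coeff m) - complex_of_real (k \<bullet> (second_coeff m *v k) / 2)
      + complex_of_real (k \<bullet> \<theta> * (real m * (k \<bullet> drift_coeff m)))))
    \<le> e * (1 + norm \<theta> + (norm \<theta>)\<^sup>2) * (norm k ^ 3 * ((real m)\<^sup>2 * b m))"
proof -
  define u where "u = k \<bullet> \<theta>"
  define Q where "Q = k \<bullet> drift_coeff m"
  define h where "h = k \<bullet> (second_coeff m *v k)"
  define \<rho> where "\<rho> = pi_hat p m k - \<i> * complex_of_real Q + complex_of_real (h / 2)"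
  define E where "E = exp (- \<i> * complex_of_real (u * real m))"
  have E_alt: "E = exp (\<i> * complex_of_real (- (u * real m)))" by (simp add: E_def)
  have bm: "0 \<le> b m" using b_nonneg m by simp
  have um: "\<bar>u * real m\<bar> \<le> norm k * norm \<theta> * real m"
    unfolding abs_mult u_def using Cauchy_Schwarz_ineq2[of k \<theta>] by (simp add: mult_right_mono)
  have eq: "twisted_pi k m - (\<i> * complex_of_real Q - complex_of_real (h / 2) + complex_of_real (u * (real m * Q)))
    = E * \<rho> + (E - (1 + \<i> * complex_of_real (- (u * real m)))) * (\<i> * complex_of_real Q)
      - (E - 1) * complex_of_real (h / 2)"
    by (simp add: twisted_pi_def E_def \<rho>_def u_def[symmetric] algebra_simps)
  have 1: "cmod (E * \<rho>) \<le> e * (norm k ^ 3 * ((real m)\<^sup>2 * b m))"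
    using first_remainder_le(2)[OF m k] by (simp add: norm_mult E_def \<rho>_def Q_def h_def)
  have 2: "cmod ((E - (1 + \<i> * complex_of_real (- (u * real m)))) * (\<i> * complex_of_real Q))
      \<le> e * (norm \<theta>)\<^sup>2 * (norm k ^ 3 * ((real m)\<^sup>2 * b m))"
  proof -
    have "cmod (E - (1 + \<i> * complex_of_real (- (u * real m)))) \<le> (u * real m)\<^sup>2"
      unfolding E_alt using cmod_exp_i_first_order[of "- (u * real m)"] by simp
    also have "\<dots> \<le> (norm k * norm \<theta> * real m)\<^sup>2"
      using um power_mono[OF um, of 2] by simp
    finally have "cmod (E - (1 + \<i> * complex_of_real (- (u * real m)))) * \<bar>Q\<bar>
        \<le> (norm k * norm \<theta> * real m)\<^sup>2 * (e * (norm k * b m))"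
      unfolding Q_def using abs_drift_coeff_le[OF m] by (intro mult_mono) auto
    then show ?thesis by (simp add: norm_mult power2_eq_square power3_eq_cube mult_ac)
  qed
  have 3: "cmod ((E - 1) * complex_of_real (h / 2)) \<le> e * norm \<theta> * (norm k ^ 3 * ((real m)\<^sup>2 * b m))"
  proof -
    have "cmod (E - 1) \<le> norm k * norm \<theta> * real m"
      unfolding E_alt using cmod_exp_i_zeroth_order[of "- (u * real m)"] um by simp
    moreover have "\<bar>h / 2\<bar> \<le> e * ((norm k)\<^sup>2 * (real m * b m))"
      unfolding h_def using abs_second_coeff_le[OF m, of k] by simp
    ultimately have "cmod (E - 1) * \<bar>h / 2\<bar> \<le> (norm k * norm \<theta> * real m) * (e * ((norm k)\<^sup>2 * (real m * b m)))"
      by (intro mult_mono) auto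
    moreover have "cmod ((E - 1) * complex_of_real (h / 2)) = cmod (E - 1) * \<bar>h / 2\<bar>"
      by (simp only: norm_mult norm_of_real)
    ultimately show ?thesis by (simp add: power2_eq_square power3_eq_cube mult_ac)
  qed
  have "cmod (twisted_pi k m - (\<i> * complex_of_real Q - complex_of_real (h / 2) + complex_of_real (u * (real m * Q))))
    \<le> cmod (E * \<rho>) + cmod ((E - (1 + \<i> * complex_of_real (- (u * real m)))) * (\<i> * complex_of_real Q))
      + cmod ((E - 1) * complex_of_real (h / 2))"
    unfolding eq by (rule order_trans[OF norm_triangle_ineq4 add_right_mono[OF norm_triangle_ineq]])
  also have "\<dots> \<le> e * (norm k ^ 3 * ((real m)\<^sup>2 * b m)) + e * (norm \<theta>)\<^sup>2 * (norm k ^ 3 * ((real m)\<^sup>2 * b m))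
      + e * norm \<theta> * (norm k ^ 3 * ((real m)\<^sup>2 * b m))"
    using 1 2 3 by (intro add_mono)
  finally show ?thesis by (simp add: u_def Q_def h_def algebra_simps)
qed

definition drift_tail :: "nat \<Rightarrow> real ^ 'd" where "drift_tail n = (\<Sum>m. drift_coeff (m + n + 2))"

lemma summable_drift_coeff_shift: "summable (\<lambda>m. drift_coeff (m + n + 2))"
  using summable_ignore_initial_segment[OF summable_drift_coeff, of n] by (simp add: add_ac)

lemma drift_tail_le: "norm (drift_tail n) \<le> e * tail n"
proof -
  have le: "norm (drift_coeff (m + n + 2)) \<le> e * b (m + n + 2)" for m by (rule drift_coeff_le) simp
  have s: "summable (\<lambda>m. e * b (m + n + 2))" by (rule summable_mult[OF summable_shift])
  have "norm (drift_tail n) \<le> (\<Sum>m. e * b (m + n + 2))"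
    unfolding drift_tail_def using le s by (rule norm_suminf_le)
  then show ?thesis unfolding tail_def suminf_mult[OF summable_shift] .
qed

lemma suminf_split_at:
  fixes x :: "nat \<Rightarrow> 'v::real_normed_vector"
  assumes "summable (\<lambda>m. x (m + 2))"
  shows "(\<Sum>m. x (m + 2)) = (\<Sum>m=2..n + 1. x m) + (\<Sum>m. x (m + n + 2))"
proof -
  have "(\<Sum>m<n. x (m + 2)) = (\<Sum>m=2..n + 1. x m)"
    by (rule sum.reindex_bij_witness[of _ "\<lambda>m. m - 2" "\<lambda>m. m + 2"]) auto
  then show ?thesis using suminf_split_initial_segment[OF assms, of n] by (simp add: add_ac)
qed

text \<open>
  With the sum over \<open>m\<close> extended to infinity, \<open>\<theta>\<close> is the vector for which the terms of first order
  cancel, and those of second order then add up to the form of \<open>\<Sigma>\<close>. What remains are the tails, beyond \<open>n + 1\<close>, of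
  the series for \<open>\<theta>\<close> and for \<open>\<Sigma>\<close>, and third-order remainders. The tail of the first-order series is
  kept as an explicit linear function of \<open>k\<close> rather than estimated, since it determines the mean.
\<close>

lemma bracket_expansion:
  fixes k :: "real ^ 'd"
  assumes k: "norm k \<le> 1" and \<gamma>: "0 \<le> \<gamma>"
    and M: "M = e * (1 + norm \<theta> + (norm \<theta>)\<^sup>2) + (\<bar>L\<bar> + norm \<theta>) ^ 3 + mat_norm \<Sigma>"
  shows "cmod (exp (- \<i> * complex_of_real (k \<bullet> \<theta>)) * expansion_coeff k 1 - 1 + (\<Sum>m=2..n + 1. twisted_pi k m)
      - (- \<i> * complex_of_real (k \<bullet> drift_tail n)) - complex_of_real (- (k \<bullet> (\<Sigma> *v k)) / 2))
    \<le> M * ((norm k)\<^sup>2 * weighted_tail n + norm k ^ 3 * a_seq \<gamma> b (n + 1))"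
proof -
  define u where "u = k \<bullet> \<theta>"
  define Q where "Q m = k \<bullet> drift_coeff m" for m
  define h where "h m = k \<bullet> (second_coeff m *v k)" for m
  define \<kappa> where "\<kappa> = k \<bullet> step_mean p"
  define s2 where "s2 = k \<bullet> (step_second_moment p *v k)"
  define g where "g = exp (- \<i> * complex_of_real (k \<bullet> \<theta>)) * expansion_coeff k 1"
  define c where "c = e * (1 + norm \<theta> + (norm \<theta>)\<^sup>2)"
  have c0: "0 \<le> c" using e_nonneg by (simp add: c_def)
  have sQ: "summable (\<lambda>m. Q (m + 2))"
    unfolding Q_def by (rule bounded_linear.summable[OF bounded_linear_inner_right summable_drift_coeff])
  have sh: "summable (\<lambda>m. h (m + 2))"
    by (rule summable_comparison_test'[where N = 0, OF summable_mult[OF summable_weighted_shift[of 0], of "e * (norm k)\<^sup>2"]])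
      (use abs_second_coeff_le[of "_ + 2" k] in \<open>simp add: h_def mult_ac\<close>)
  have sj: "summable (\<lambda>m. real (m + 2) * Q (m + 2))"
  proof (rule summable_comparison_test'[where N = 0, OF summable_mult[OF summable_weighted_shift[of 0], of "e * norm k"]])
    fix m
    show "norm (real (m + 2) * Q (m + 2)) \<le> e * norm k * (real (m + 0 + 2) * b (m + 0 + 2))"
      using mult_left_mono[OF abs_drift_coeff_le[of "m + 2" k], of "real (m + 2)"] by (simp add: Q_def abs_mult mult_ac)
  qed
  have twisted_sum: "(\<Sum>m. k \<bullet> (twisted_coeff (m + 2) *v k)) = k \<bullet> ((\<Sum>m. twisted_coeff (m + 2)) *v k)"
    by (rule bounded_linear.suminf[OF bounded_linear_quadratic summable_twisted_coeff, symmetric])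
  \<comment> \<open>the three series cut at \<open>n + 1\<close>\<close>
  define Q1 h1 j1 where "Q1 = (\<Sum>m=2..n + 1. Q m)" and "h1 = (\<Sum>m=2..n + 1. h m)" and "j1 = (\<Sum>m=2..n + 1. real m * Q m)"
  define Q2 h2 j2 where "Q2 = (\<Sum>m. Q (m + n + 2))" and "h2 = (\<Sum>m. h (m + n + 2))"
    and "j2 = (\<Sum>m. real (m + n + 2) * Q (m + n + 2))"
  have Q2: "k \<bullet> drift_tail n = Q2"
    unfolding drift_tail_def Q2_def Q_def
    by (rule bounded_linear.suminf[OF bounded_linear_inner_right summable_drift_coeff_shift])
  have u_eq: "u = \<kappa> + (Q1 + Q2)"
  proof -
    have "k \<bullet> (\<Sum>m. drift_coeff (m + 2)) = (\<Sum>m. Q (m + 2))"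
      unfolding Q_def by (rule bounded_linear.suminf[OF bounded_linear_inner_right summable_drift_coeff])
    then show ?thesis using suminf_split_at[OF sQ, of n]
      by (simp add: u_def \<theta>_def inner_add_right \<kappa>_def Q1_def Q2_def)
  qed
  have V_eq: "k \<bullet> (\<Sigma> *v k) = s2 - u\<^sup>2 + ((h1 + h2) - 2 * u * ((j1 + j2) - (Q1 + Q2)))"
  proof -
    have "(\<Sum>m. k \<bullet> (twisted_coeff (m + 2) *v k)) = (\<Sum>m. h (m + 2) - 2 * u * (real (m + 2) * Q (m + 2) - Q (m + 2)))"
      by (intro arg_cong[where f = suminf] ext) (simp add: twisted_coeff_quadratic h_def Q_def u_def algebra_simps)
    also have "\<dots> = (\<Sum>m. h (m + 2)) - 2 * u * ((\<Sum>m. real (m + 2) * Q (m + 2)) - (\<Sum>m. Q (m + 2)))"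
    proof -
      have sd: "summable (\<lambda>m. real (m + 2) * Q (m + 2) - Q (m + 2))" by (rule summable_diff[OF sj sQ])
      show ?thesis
        by (simp only: suminf_diff[OF sh summable_mult[OF sd], symmetric] suminf_mult[OF sd] suminf_diff[OF sj sQ, symmetric])
    qed
    also have "\<dots> = (h1 + h2) - 2 * u * ((j1 + j2) - (Q1 + Q2))"
      using suminf_split_at[OF sh, of n] suminf_split_at[OF sQ, of n] suminf_split_at[of "\<lambda>m. real m * Q m" n] sj
      by (simp add: h1_def h2_def j1_def j2_def Q1_def Q2_def)
    finally have "k \<bullet> ((\<Sum>m. twisted_coeff (m + 2)) *v k) = (h1 + h2) - 2 * u * ((j1 + j2) - (Q1 + Q2))"
      using twisted_sum by simp
    moreover have "k \<bullet> (outer \<theta> \<theta> *v k) = u\<^sup>2"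
      unfolding inner_matrix_eq outer_def unfolding u_def power2_eq_square inner_vec_def sum_product by (simp add: mult_ac)
    moreover have "k \<bullet> (\<Sigma> *v k) = k \<bullet> (step_second_moment p *v k) - k \<bullet> (outer \<theta> \<theta> *v k) + k \<bullet> ((\<Sum>m. twisted_coeff (m + 2)) *v k)"
      by (simp add: \<Sigma>_def matrix_vector_mult_add_rdistrib matrix_vector_mult_diff_rdistrib inner_add_right inner_diff_right)
    ultimately show ?thesis by (simp add: s2_def)
  qed
  \<comment> \<open>third-order remainders of the first step and of the kernel\<close>
  define \<tau>\<^sub>0 where "\<tau>\<^sub>0 = g - (1 + \<i> * complex_of_real (\<kappa> - u) - complex_of_real ((s2 - 2 * u * \<kappa> + u\<^sup>2) / 2))"
  define \<tau> where "\<tau> m = twisted_pi k m - (\<i> * complex_of_real (Q m) - complex_of_real (h m / 2) + complex_of_real (u * (real m * Q m)))" for m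
  have sum_P: "(\<Sum>m=2..n + 1. twisted_pi k m) = \<i> * complex_of_real Q1 - complex_of_real (h1 / 2) + complex_of_real (u * j1) + (\<Sum>m=2..n + 1. \<tau> m)"
  proof -
    have "(\<Sum>m=2..n + 1. twisted_pi k m) = (\<Sum>m=2..n + 1. \<i> * complex_of_real (Q m) - complex_of_real (h m / 2) + complex_of_real (u * (real m * Q m)) + \<tau> m)"
      by (simp add: \<tau>_def)
    then show ?thesis
      by (simp only: sum.distrib sum_subtractf sum_distrib_left[symmetric] of_real_sum[symmetric] sum_divide_distrib[symmetric] Q1_def h1_def j1_def)
  qed
  have "g - 1 + (\<Sum>m=2..n + 1. twisted_pi k m) - (- \<i> * complex_of_real (k \<bullet> drift_tail n)) - complex_of_real (- (k \<bullet> (\<Sigma> *v k)) / 2)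
     = complex_of_real (h2 / 2 - u * j2) + \<tau>\<^sub>0 + (\<Sum>m=2..n + 1. \<tau> m)"
    unfolding sum_P Q2 V_eq \<tau>\<^sub>0_def u_eq by (simp add: field_simps power2_eq_square)
  also have "cmod \<dots> \<le> \<bar>h2 / 2 - u * j2\<bar> + cmod \<tau>\<^sub>0 + cmod (\<Sum>m=2..n + 1. \<tau> m)"
    by (metis norm_of_real norm_triangle_ineq order_trans add_right_mono)
  \<comment> \<open>the factor \<open>1\<close> is to be replaced by \<open>a_seq \<gamma> b (n + 1)\<close>, which is at least \<open>b 1 \<ge> 1\<close>\<close>
  also have "\<dots> \<le> c * ((norm k)\<^sup>2 * weighted_tail n) + norm k ^ 3 * (\<bar>L\<bar> + norm \<theta>) ^ 3 * 1
      + c * (norm k ^ 3 * (\<Sum>m=2..n + 1. (real m)\<^sup>2 * b m))"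
  proof (intro add_mono)
    have "\<bar>h2\<bar> \<le> e * (norm k)\<^sup>2 * weighted_tail n"
    proof -
      have "norm h2 \<le> (\<Sum>m. e * (norm k)\<^sup>2 * (real (m + n + 2) * b (m + n + 2)))"
        unfolding h2_def
      proof (rule norm_suminf_le)
        fix m show "norm (h (m + n + 2)) \<le> e * (norm k)\<^sup>2 * (real (m + n + 2) * b (m + n + 2))"
          using abs_second_coeff_le[of "m + n + 2" k] by (simp add: h_def mult_ac)
      qed (rule summable_mult[OF summable_weighted_shift])
      then show ?thesis unfolding weighted_tail_def suminf_mult[OF summable_weighted_shift] real_norm_def .
    qed
    moreover have "\<bar>j2\<bar> \<le> e * norm k * weighted_tail n"
    proof -
      have "norm j2 \<le> (\<Sum>m. e * norm k * (real (m + n + 2) * b (m + n + 2)))"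
        unfolding j2_def
      proof (rule norm_suminf_le)
        fix m show "norm (real (m + n + 2) * Q (m + n + 2)) \<le> e * norm k * (real (m + n + 2) * b (m + n + 2))"
          using mult_left_mono[OF abs_drift_coeff_le[of "m + n + 2" k], of "real (m + n + 2)"] by (simp add: Q_def abs_mult mult_ac)
      qed (rule summable_mult[OF summable_weighted_shift])
      then show ?thesis unfolding weighted_tail_def suminf_mult[OF summable_weighted_shift] real_norm_def .
    qed
    moreover have "\<bar>u\<bar> \<le> norm k * norm \<theta>" unfolding u_def by (rule Cauchy_Schwarz_ineq2)
    ultimately have "\<bar>u\<bar> * \<bar>j2\<bar> \<le> (norm k * norm \<theta>) * (e * norm k * weighted_tail n)"
      by (intro mult_mono) auto
    then have "\<bar>u * j2\<bar> \<le> e * norm \<theta> * ((norm k)\<^sup>2 * weighted_tail n)"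
      by (simp add: abs_mult power2_eq_square mult_ac)
    moreover have "\<bar>h2 / 2 - u * j2\<bar> \<le> \<bar>h2\<bar> + \<bar>u * j2\<bar>" by linarith
    ultimately have "\<bar>h2 / 2 - u * j2\<bar> \<le> e * (1 + norm \<theta>) * ((norm k)\<^sup>2 * weighted_tail n)"
      using \<open>\<bar>h2\<bar> \<le> e * (norm k)\<^sup>2 * weighted_tail n\<close> by (simp add: algebra_simps)
    also have "\<dots> \<le> c * ((norm k)\<^sup>2 * weighted_tail n)"
      unfolding c_def using e_nonneg weighted_tail_nonneg by (intro mult_right_mono mult_left_mono) auto
    finally show "\<bar>h2 / 2 - u * j2\<bar> \<le> c * ((norm k)\<^sup>2 * weighted_tail n)" .
    show "cmod \<tau>\<^sub>0 \<le> norm k ^ 3 * (\<bar>L\<bar> + norm \<theta>) ^ 3 * 1"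
      unfolding \<tau>\<^sub>0_def g_def u_def \<kappa>_def s2_def using first_step_expansion[of k] by simp
    show "cmod (\<Sum>m=2..n + 1. \<tau> m) \<le> c * (norm k ^ 3 * (\<Sum>m=2..n + 1. (real m)\<^sup>2 * b m))"
      unfolding sum_distrib_left \<tau>_def c_def u_def Q_def h_def
      using twisted_pi_expansion k by (intro sum_norm_le) auto
  qed
  also have "\<dots> \<le> M * ((norm k)\<^sup>2 * weighted_tail n) + norm k ^ 3 * (\<bar>L\<bar> + norm \<theta>) ^ 3 * a_seq \<gamma> b (n + 1)
      + c * (norm k ^ 3 * a_seq \<gamma> b (n + 1))"
  proof (intro add_mono mult_left_mono mult_right_mono)
    have mn: "0 \<le> mat_norm \<Sigma>" unfolding mat_norm_def by (intro sum_nonneg) auto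
    then show "c \<le> M" by (simp add: M c_def)
    show "0 \<le> (norm k)\<^sup>2 * weighted_tail n" using weighted_tail_nonneg by simp
    have sq: "(real m)\<^sup>2 * b m \<le> real m powr (2 + \<gamma>) * b m" if "1 \<le> m" for m
    proof -
      have "(real m)\<^sup>2 = real m powr 2" using that by simp
      also have "\<dots> \<le> real m powr (2 + \<gamma>)" using that \<gamma> by (intro powr_mono) auto
      finally show ?thesis using b_nonneg[OF that] by (rule mult_right_mono)
    qed
    have "(\<Sum>m=2..n + 1. (real m)\<^sup>2 * b m) \<le> (\<Sum>m=2..n + 1. real m powr (2 + \<gamma>) * b m)"
      using sq by (intro sum_mono) auto
    also have "\<dots> \<le> a_seq \<gamma> b (n + 1)"
      unfolding a_seq_def using b_nonneg by (intro sum_mono2) auto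
    finally show "(\<Sum>m=2..n + 1. (real m)\<^sup>2 * b m) \<le> a_seq \<gamma> b (n + 1)" .
    have "1 \<le> (\<Sum>m\<in>{1}. real m powr (2 + \<gamma>) * b m)" using b_1 by simp
    also have "\<dots> \<le> a_seq \<gamma> b (n + 1)"
      unfolding a_seq_def using b_nonneg by (intro sum_mono2) auto
    finally show "1 \<le> a_seq \<gamma> b (n + 1)" .
  qed (use c0 in auto)
  also have "\<dots> \<le> M * ((norm k)\<^sup>2 * weighted_tail n + norm k ^ 3 * a_seq \<gamma> b (n + 1))"
  proof -
    have "0 \<le> mat_norm \<Sigma>" unfolding mat_norm_def by (intro sum_nonneg) auto
    moreover have "0 \<le> norm k ^ 3 * a_seq \<gamma> b (n + 1)"
      unfolding a_seq_def using b_nonneg by (intro mult_nonneg_nonneg sum_nonneg) auto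
    ultimately have "0 \<le> mat_norm \<Sigma> * (norm k ^ 3 * a_seq \<gamma> b (n + 1))" by simp
    then show ?thesis unfolding M c_def[symmetric] by (simp add: algebra_simps)
  qed
  finally show ?thesis unfolding g_def .
qed

end


section \<open>The characteristic function as an exponential\<close>

text \<open>
  \<open>Ln (exp z)\<close> and \<open>z\<close> have the same real part, and among all logarithms of \<open>exp z\<close> the principal one has
  the imaginary part of least modulus. So the imaginary part of the exponent need not be bounded by
  \<open>pi\<close> in order to estimate the logarithm of the characteristic function.
\<close>

lemma cmod_Ln_exp_minus_real_le:
  "cmod (Ln (exp z) - complex_of_real x) \<le> cmod (z - complex_of_real x)"
proof -
  have Re: "Re (Ln (exp z)) = Re z" by simp
  have Im: "\<bar>Im (Ln (exp z))\<bar> \<le> \<bar>Im z\<bar>"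
  proof (cases "- pi < Im z \<and> Im z \<le> pi")
    case False
    moreover have "- pi < Im (Ln (exp z))" "Im (Ln (exp z)) \<le> pi"
      using mpi_less_Im_Ln[of "exp z"] Im_Ln_le_pi[of "exp z"] by auto
    ultimately show ?thesis by linarith
  qed simp
  have "(Im (Ln (exp z)))\<^sup>2 \<le> (Im z)\<^sup>2" using Im by (simp only: abs_le_square_iff)
  then show ?thesis unfolding cmod_def by (intro real_sqrt_le_mono) (simp add: Re)
qed

text \<open>
  Polarization: the form is evaluated at unit vectors and at sums of two of them.
\<close>

lemma entries_le_of_quadratic_le:
  fixes D :: "real ^ 'd ^ 'd"
  assumes sym: "\<And>i j. D $ i $ j = D $ j $ i" and c: "0 \<le> c" and le: "\<And>k. \<bar>k \<bullet> (D *v k)\<bar> \<le> c * (norm k)\<^sup>2"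
  shows "mat_norm D \<le> real CARD('d) * real CARD('d) * (3 * c)"
proof -
  have ax: "axis i 1 \<bullet> (D *v axis j 1) = D $ i $ j" for i j
    by (simp add: inner_axis' matrix_vector_mul_component inner_axis)
  have "\<bar>D $ i $ j\<bar> \<le> 3 * c" for i j
  proof -
    let ?u = "axis i 1 :: real ^ 'd" and ?v = "axis j 1 :: real ^ 'd"
    have d: "\<bar>D $ i $ i\<bar> \<le> c" for i
      using le[of "axis i 1"] by (simp add: ax)
    have "(?u + ?v) \<bullet> (D *v (?u + ?v)) = D $ i $ i + D $ j $ j + 2 * D $ i $ j"
      by (simp add: inner_add_left inner_add_right matrix_vector_right_distrib ax sym[of j i])
    moreover have "norm (?u + ?v) \<le> 2" using norm_triangle_ineq[of ?u ?v] by simp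
    then have "(norm (?u + ?v))\<^sup>2 \<le> 2\<^sup>2" by (intro power_mono) auto
    then have "c * (norm (?u + ?v))\<^sup>2 \<le> c * 4" using c by (intro mult_left_mono) auto
    ultimately have "\<bar>D $ i $ i + D $ j $ j + 2 * D $ i $ j\<bar> \<le> 4 * c" using le[of "?u + ?v"] by simp
    then show ?thesis using d[of i] d[of j] by linarith
  qed
  then have "mat_norm D \<le> (\<Sum>i\<in>(UNIV :: 'd set). \<Sum>j\<in>(UNIV :: 'd set). 3 * c)"
    unfolding mat_norm_def by (intro sum_mono) auto
  then show ?thesis by simp
qed

context expansion_walk
begin

definition total_drift :: "nat \<Rightarrow> real ^ 'd" where "total_drift N = (\<Sum>j<N. drift_tail j)"

lemma total_drift_le: "norm (total_drift N) \<le> e * total"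
proof -
  have "norm (total_drift N) \<le> (\<Sum>j<N. e * tail j)"
    unfolding total_drift_def using drift_tail_le by (intro sum_norm_le) auto
  also have "\<dots> \<le> e * total"
    unfolding sum_distrib_left[symmetric] using tail_sum_le e_nonneg by (intro mult_left_mono) auto
  finally show ?thesis .
qed

definition centred_char :: "nat \<Rightarrow> real ^ 'd \<Rightarrow> complex" where
  "centred_char N k = (\<Sum>v\<in>extensions L N [0]. path_prob N v *\<^sub>R exp (\<i> * complex_of_real (k \<bullet> (rvec (last v) - real N *\<^sub>R \<theta>))))"

lemma centred_char_eq: "centred_char N k = exp (- \<i> * complex_of_real (k \<bullet> \<theta> * real N)) * future k N [0]"
  unfolding psum_eq_path_sum centred_char_def sum_distrib_left
  by (intro sum.cong refl) (simp add: wave_def inner_diff_right right_diff_distrib exp_diff exp_minus field_simps)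

lemma centred_char_recursion:
  "centred_char (Suc n) k = exp (- \<i> * complex_of_real (k \<bullet> \<theta>)) * expansion_coeff k 1 * centred_char n k
    + (\<Sum>m=2..n + 1. twisted_pi k m * centred_char (n + 1 - m) k)"
proof -
  let ?E = "\<lambda>n. exp (- \<i> * complex_of_real (k \<bullet> \<theta> * real n))"
  have E_add: "?E (a + b) = ?E a * ?E b" for a b
    by (simp add: exp_add[symmetric] algebra_simps)
  have "centred_char (Suc n) k = ?E (Suc n) * (expansion_coeff k 1 * future k n [0] + (\<Sum>m=2..n + 1. expansion_coeff k m * future k (n + 1 - m) [0]))"
    by (simp only: centred_char_eq future_recursion)
  also have "\<dots> = ?E (Suc n) * expansion_coeff k 1 * future k n [0] + (\<Sum>m=2..n + 1. ?E (Suc n) * expansion_coeff k m * future k (n + 1 - m) [0])"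
    by (simp only: ring_distribs sum_distrib_left mult.assoc)
  also have "?E (Suc n) * expansion_coeff k 1 * future k n [0] = exp (- \<i> * complex_of_real (k \<bullet> \<theta>)) * expansion_coeff k 1 * centred_char n k"
    using E_add[of 1 n] by (simp add: centred_char_eq mult_ac)
  also have "(\<Sum>m=2..n + 1. ?E (Suc n) * expansion_coeff k m * future k (n + 1 - m) [0]) = (\<Sum>m=2..n + 1. twisted_pi k m * centred_char (n + 1 - m) k)"
  proof (rule sum.cong[OF refl])
    fix m assume m: "m \<in> {2..n + 1}"
    then have "?E (Suc n) = ?E m * ?E (n + 1 - m)" using E_add[of m "n + 1 - m"] by simp
    then show "?E (Suc n) * expansion_coeff k m * future k (n + 1 - m) [0] = twisted_pi k m * centred_char (n + 1 - m) k"
      using m by (simp only: twisted_pi_def centred_char_eq pi_hat_eq_expansion_coeff atLeastAtMost_iff mult_ac)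
  qed
  finally show ?thesis .
qed

text \<open>
  The frequencies are restricted to \<open>n |k|^2 \<le> ln (n + 1) / C\<close>. With \<open>ln (n + 1)\<close> instead of \<open>ln n\<close> they
  contain a neighbourhood of the origin also for \<open>n = 1\<close>, which the moments require.
\<close>

lemma centred_char_exp_representation:
  assumes \<gamma>: "0 < \<gamma>" "\<gamma> < 1" and C\<^sub>a: "1 \<le> C\<^sub>a"
    and a_le: "\<And>n. 1 \<le> n \<Longrightarrow> a_seq \<gamma> b n \<le> C\<^sub>a * sqrt (real n / ln (real n + 1))"
  shows "\<exists>C>0. \<exists>K\<ge>0. \<forall>N\<ge>1. \<forall>k. C * (norm k)\<^sup>2 \<le> ln (real N + 1) / real N \<longrightarrow>
    (\<exists>R. centred_char N k = exp (- \<i> * complex_of_real (k \<bullet> total_drift N)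
           - complex_of_real (real N * (k \<bullet> (\<Sigma> *v k)) / 2) + R) \<and>
      cmod R \<le> K * ((norm k)\<^sup>2 * E_seq b N) + K * (norm k ^ 3 * A_seq \<gamma> b N))"
proof -
  define M where "M = e * (1 + norm \<theta> + (norm \<theta>)\<^sup>2) + (\<bar>L\<bar> + norm \<theta>) ^ 3 + mat_norm \<Sigma>"
  define K where "K = M * (total + 2) + 12 * M\<^sup>2 * total\<^sup>2 + 1"
  define c where "c = 36 * M * K"
  \<comment> \<open>apart from \<open>1\<close>, each term of the minimum serves one of the bounds \<open>d2\<close>, \<open>d3\<close>, \<open>d4\<close> below\<close>
  define \<delta> where "\<delta> = min 1 (min (1 / (4 * (M * total) + 1)) (min (\<gamma> / (4 * K)) (1 / (C\<^sub>a * (c + 1)))))"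
  define K' where "K' = M + 6 * M\<^sup>2 * total\<^sup>2 + 36 * M * K + 4 * M\<^sup>2 * total\<^sup>2 + 4 * K\<^sup>2"
  have mn: "0 \<le> mat_norm \<Sigma>" unfolding mat_norm_def by (intro sum_nonneg) auto
  have M0: "0 \<le> M" and eM: "e \<le> M" and \<Sigma>M: "mat_norm \<Sigma> \<le> M"
  proof -
    have "0 \<le> (\<bar>L\<bar> + norm \<theta>) ^ 3" by simp
    moreover have "e * 1 \<le> e * (1 + norm \<theta> + (norm \<theta>)\<^sup>2)" using e_nonneg by (intro mult_left_mono) auto
    ultimately show "0 \<le> M" "e \<le> M" "mat_norm \<Sigma> \<le> M" using e_nonneg mn unfolding M_def by linarith+
  qed
  have t0: "0 \<le> total" using weighted_tail_nonneg[of 0] weighted_tail_le[of 0] by linarith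
  have K1: "1 \<le> K" using M0 t0 by (simp add: K_def)
  have c0: "0 \<le> c" using M0 K1 by (simp add: c_def)
  have MS: "0 \<le> M * total" using M0 t0 by simp
  have Cc: "0 < C\<^sub>a * (c + 1)" using C\<^sub>a c0 by simp
  have \<delta>0: "0 < \<delta>" using MS \<gamma> K1 Cc by (simp add: \<delta>_def)
  have \<delta>1: "\<delta> \<le> 1" and \<delta>2: "\<delta> \<le> 1 / (4 * (M * total) + 1)" and \<delta>3: "\<delta> \<le> \<gamma> / (4 * K)" and \<delta>4: "\<delta> \<le> 1 / (C\<^sub>a * (c + 1))"
    unfolding \<delta>_def by linarith+
  have d2: "4 * (M * total * \<delta>) \<le> 1"
  proof -
    have "\<delta> * (4 * (M * total) + 1) \<le> 1" using \<delta>2 MS by (simp add: pos_le_divide_eq)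
    then show ?thesis using \<delta>0 by (simp add: algebra_simps)
  qed
  have d3: "4 * (K * \<delta>) \<le> \<gamma>" using \<delta>3 K1 by (simp add: pos_le_divide_eq mult_ac)
  have d3': "K * \<delta>\<^sup>2 \<le> K * \<delta>" using K1 \<delta>0 \<delta>1 by (simp add: power2_eq_square)
  have d4: "(C\<^sub>a * \<delta>) * (c + 1) \<le> 1" using \<delta>4 Cc by (simp add: pos_le_divide_eq mult_ac)
  have \<eta>0: "0 \<le> C\<^sub>a * \<delta>" using C\<^sub>a \<delta>0 by simp
  have d4': "C\<^sub>a * \<delta> \<le> 1" "c * (C\<^sub>a * \<delta>) \<le> 1"
    using d4 \<eta>0 mult_nonneg_nonneg[OF \<eta>0 c0] by (simp_all add: algebra_simps)
  have main: "\<exists>R. centred_char N k = exp (- \<i> * complex_of_real (k \<bullet> total_drift N)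
           - complex_of_real (real N * (k \<bullet> (\<Sigma> *v k)) / 2) + R) \<and>
      cmod R \<le> K' * ((norm k)\<^sup>2 * E_seq b N) + K' * (norm k ^ 3 * A_seq \<gamma> b N)"
    if N: "1 \<le> N" and k: "1 / \<delta>\<^sup>2 * (norm k)\<^sup>2 \<le> ln (real N + 1) / real N" for N and k :: "real ^ 'd"
  proof -
    have s2: "(norm k)\<^sup>2 \<le> \<delta>\<^sup>2 * (ln (real N + 1) / real N)"
      using k \<delta>0 by (simp add: field_simps)
    have lnN: "0 < ln (real N + 1)" "ln (real N + 1) \<le> real N"
      using N ln_add_one_self_le_self[of "real N"] by (auto simp: add.commute)
    have "(norm k)\<^sup>2 \<le> \<delta>\<^sup>2 * 1"
      using s2 lnN N by (elim order_trans, intro mult_left_mono) auto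
    then have s\<delta>: "norm k \<le> \<delta>" using \<delta>0 by (simp add: power2_le_iff_abs_le)
    have k1: "norm k \<le> 1" using s\<delta> \<delta>1 by simp
    \<comment> \<open>the growth condition on \<open>a_seq\<close> is exactly inverse to the size of the frequencies\<close>
    have sa: "norm k * a_seq \<gamma> b N \<le> C\<^sub>a * \<delta>"
    proof -
      have "norm k \<le> sqrt (\<delta>\<^sup>2 * (ln (real N + 1) / real N))" using s2 by (intro real_le_rsqrt)
      then have "norm k \<le> \<delta> * sqrt (ln (real N + 1) / real N)"
        using \<delta>0 by (simp only: real_sqrt_mult real_sqrt_abs abs_of_pos)
      then have "norm k * a_seq \<gamma> b N \<le> (\<delta> * sqrt (ln (real N + 1) / real N)) * (C\<^sub>a * sqrt (real N / ln (real N + 1)))"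
        using a_le[OF N] b_nonneg \<delta>0 lnN by (intro mult_mono) (auto simp: a_seq_def intro!: sum_nonneg)
      also have "\<dots> = C\<^sub>a * \<delta> * (sqrt (ln (real N + 1) / real N * (real N / ln (real N + 1))))"
        by (simp only: real_sqrt_mult mult_ac)
      also have "\<dots> = C\<^sub>a * \<delta>" using lnN N by simp
      finally show ?thesis .
    qed
    interpret perturbed_recursion "\<lambda>n. centred_char n k" "twisted_pi k" "\<lambda>n. - \<i> * complex_of_real (k \<bullet> drift_tail n)"
      "\<lambda>n. exp (- \<i> * complex_of_real (k \<bullet> \<theta>)) * expansion_coeff k 1 - 1 + (\<Sum>m=2..n + 1. twisted_pi k m)
      - (- \<i> * complex_of_real (k \<bullet> drift_tail n)) - complex_of_real (- (k \<bullet> (\<Sigma> *v k)) / 2)"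
      "exp (- \<i> * complex_of_real (k \<bullet> \<theta>)) * expansion_coeff k 1" "complex_of_real (- (k \<bullet> (\<Sigma> *v k)) / 2)"
      b tail weighted_tail "norm k" M total \<gamma> \<delta> "C\<^sub>a * \<delta>" K N
    proof
      show "centred_char 0 k = 1" by (simp add: centred_char_eq)
      show "centred_char (Suc n) k = exp (- \<i> * complex_of_real (k \<bullet> \<theta>)) * expansion_coeff k 1 * centred_char n k
        + (\<Sum>m=2..n + 1. twisted_pi k m * centred_char (n + 1 - m) k)" for n by (rule centred_char_recursion)
      show "cmod (twisted_pi k m) \<le> M * (norm k * b m + (norm k)\<^sup>2 * (real m * b m))" if "2 \<le> m" for m
        using twisted_pi_le[OF that k1] b_nonneg[of m] that
          mult_right_mono[OF eM, of "norm k * b m + (norm k)\<^sup>2 * (real m * b m)"] by auto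
      show "cmod (- \<i> * complex_of_real (k \<bullet> drift_tail n)) \<le> M * (norm k * tail n)" for n
      proof -
        have "\<bar>k \<bullet> drift_tail n\<bar> \<le> norm k * norm (drift_tail n)" by (rule Cauchy_Schwarz_ineq2)
        also have "\<dots> \<le> norm k * (M * tail n)"
          using drift_tail_le[of n] mult_right_mono[OF eM tail_nonneg[of n]] by (intro mult_left_mono) auto
        finally show ?thesis by (simp add: norm_mult mult_ac)
      qed
      show "cmod (complex_of_real (- (k \<bullet> (\<Sigma> *v k)) / 2)) \<le> M * (norm k)\<^sup>2"
      proof -
        have "\<bar>k \<bullet> (\<Sigma> *v k)\<bar> \<le> (norm k)\<^sup>2 * M"
          using abs_quadratic_le[of k \<Sigma>] mult_left_mono[OF \<Sigma>M, of "(norm k)\<^sup>2"] by simp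
        then show ?thesis unfolding norm_of_real by (simp add: mult.commute)
      qed
      show "cmod (exp (- \<i> * complex_of_real (k \<bullet> \<theta>)) * expansion_coeff k 1 - 1 + (\<Sum>m=2..n + 1. twisted_pi k m)
          - (- \<i> * complex_of_real (k \<bullet> drift_tail n)) - complex_of_real (- (k \<bullet> (\<Sigma> *v k)) / 2))
        \<le> M * ((norm k)\<^sup>2 * weighted_tail n + norm k ^ 3 * a_seq \<gamma> b (n + 1))" for n
        using \<gamma> by (intro bracket_expansion[OF k1 _ M_def]) simp
      show "K = M * (total + 2) + 12 * M\<^sup>2 * total\<^sup>2 + 1" by (rule K_def)
      show "2 * M * total * \<delta> \<le> 1" "M * total * \<delta> + K * \<delta>\<^sup>2 \<le> 1 / 2" "2 * K * \<delta>\<^sup>2 \<le> \<gamma>"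
      proof -
        have "0 \<le> M * total * \<delta>" using MS \<delta>0 by simp
        moreover have "2 * M * total * \<delta> = 2 * (M * total * \<delta>)" "2 * K * \<delta>\<^sup>2 = 2 * (K * \<delta>\<^sup>2)" by simp_all
        ultimately show "2 * M * total * \<delta> \<le> 1" "M * total * \<delta> + K * \<delta>\<^sup>2 \<le> 1 / 2" "2 * K * \<delta>\<^sup>2 \<le> \<gamma>"
          using d2 d3 d3' \<gamma> by linarith+
      qed
      show "36 * M * K * (C\<^sub>a * \<delta>) \<le> 1" using d4' by (simp add: c_def)
    qed (use b_nonneg tail_nonneg weighted_tail_le tail_sum_le weighted_sum_le M0 \<gamma> s\<delta> sa s2 \<delta>1 d4' in auto)
    have "(\<Sum>j<N. - \<i> * complex_of_real (k \<bullet> drift_tail j)) + of_nat N * complex_of_real (- (k \<bullet> (\<Sigma> *v k)) / 2)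
       = - \<i> * complex_of_real (k \<bullet> total_drift N) - complex_of_real (real N * (k \<bullet> (\<Sigma> *v k)) / 2)"
      by (simp add: total_drift_def inner_sum_right sum_distrib_left)
    then show ?thesis
      using exp_representation[OF N b_1 weighted_tail_sum_le E_seq_ge_one[OF N]] unfolding K'_def[symmetric] by simp
  qed
  have "0 \<le> K'" using M0 K1 by (simp add: K'_def)
  moreover have "0 < 1 / \<delta>\<^sup>2" using \<delta>0 by simp
  ultimately show ?thesis using main by blast
qed

end


section \<open>Mean, variance and logarithm of the characteristic function\<close>

context expansion_walk
begin

lemma mean_eq:
  assumes "walk_law p Q"
  shows "walk_mean Q N = (\<Sum>v\<in>extensions L N [0]. path_prob N v *\<^sub>R rvec (last v))"
  unfolding walk_mean_def by (rule has_bochner_integral_integral_eq[OF has_bochner_integral_endpoint[OF assms]])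

lemma inner_mean:
  assumes "walk_law p Q"
  shows "(\<Sum>v\<in>extensions L N [0]. path_prob N v * (k \<bullet> (rvec (last v) - real N *\<^sub>R \<theta>)))
    = k \<bullet> (walk_mean Q N - real N *\<^sub>R \<theta>)"
  using sum_path_prob[of N]
  by (simp add: mean_eq[OF assms] inner_diff_right inner_sum_right right_diff_distrib sum_subtractf sum_distrib_right[symmetric])

lemma var_eq:
  assumes "walk_law p Q"
  shows "walk_var Q N $ i $ j = (\<Sum>v\<in>extensions L N [0]. path_prob N v *
    ((rvec (last v) $ i - walk_mean Q N $ i) * (rvec (last v) $ j - walk_mean Q N $ j)))"
proof -
  have "walk_var Q N $ i $ j = (\<integral>w. (\<lambda>x. (rvec x $ i - walk_mean Q N $ i) * (rvec x $ j - walk_mean Q N $ j)) (w N) \<partial>Q)"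
    by (simp add: walk_var_def)
  also have "\<dots> = (\<Sum>v\<in>extensions L N [0]. path_prob N v *\<^sub>R
    (\<lambda>x. (rvec x $ i - walk_mean Q N $ i) * (rvec x $ j - walk_mean Q N $ j)) (last v))"
    by (rule has_bochner_integral_integral_eq[OF has_bochner_integral_endpoint[OF assms]])
  finally show ?thesis by simp
qed

lemma var_quadratic:
  assumes "walk_law p Q"
  shows "k \<bullet> (walk_var Q N *v k)
    = (\<Sum>v\<in>extensions L N [0]. path_prob N v * (k \<bullet> (rvec (last v) - real N *\<^sub>R \<theta>))\<^sup>2)
      - (k \<bullet> (walk_mean Q N - real N *\<^sub>R \<theta>))\<^sup>2"
proof -
  let ?V = "extensions L N [0 :: int ^ 'd]" and ?m = "walk_mean Q N"
  define y where "y v = k \<bullet> (rvec (last v) - real N *\<^sub>R \<theta>)" for v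
  define \<mu> where "\<mu> = k \<bullet> (?m - real N *\<^sub>R \<theta>)"
  have "k \<bullet> (walk_var Q N *v k) = (\<Sum>i\<in>UNIV. \<Sum>j\<in>UNIV. \<Sum>v\<in>?V. path_prob N v *
      ((k $ i * (rvec (last v) - ?m) $ i) * (k $ j * (rvec (last v) - ?m) $ j)))"
    unfolding inner_matrix_eq var_eq[OF assms] sum_distrib_left sum_distrib_right
    by (intro sum.cong refl) (simp add: mult_ac)
  also have "\<dots> = (\<Sum>i\<in>UNIV. \<Sum>v\<in>?V. \<Sum>j\<in>UNIV. path_prob N v *
      ((k $ i * (rvec (last v) - ?m) $ i) * (k $ j * (rvec (last v) - ?m) $ j)))"
    by (intro sum.cong refl sum.swap)
  also have "\<dots> = (\<Sum>v\<in>?V. \<Sum>i\<in>UNIV. \<Sum>j\<in>UNIV. path_prob N v *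
      ((k $ i * (rvec (last v) - ?m) $ i) * (k $ j * (rvec (last v) - ?m) $ j)))"
    by (rule sum.swap)
  also have "\<dots> = (\<Sum>v\<in>?V. path_prob N v * (k \<bullet> (rvec (last v) - ?m))\<^sup>2)"
    unfolding power2_eq_square inner_vec_def sum_product by (simp add: sum_distrib_left)
  also have "\<dots> = (\<Sum>v\<in>?V. path_prob N v * (y v)\<^sup>2 - 2 * \<mu> * (path_prob N v * y v) + \<mu>\<^sup>2 * path_prob N v)"
  proof (intro sum.cong refl)
    fix v
    have yy: "k \<bullet> (rvec (last v) - ?m) = y v - \<mu>" by (simp add: y_def \<mu>_def inner_diff_right)
    show "path_prob N v * (k \<bullet> (rvec (last v) - ?m))\<^sup>2
      = path_prob N v * (y v)\<^sup>2 - 2 * \<mu> * (path_prob N v * y v) + \<mu>\<^sup>2 * path_prob N v"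
      unfolding yy by (simp add: power2_eq_square algebra_simps)
  qed
  also have "\<dots> = (\<Sum>v\<in>?V. path_prob N v * (y v)\<^sup>2) - 2 * \<mu> * \<mu> + \<mu>\<^sup>2 * 1"
    using inner_mean[OF assms, of N k, folded y_def \<mu>_def]
    by (simp only: sum.distrib sum_subtractf sum_distrib_left[symmetric] sum_path_prob)
  finally show ?thesis unfolding y_def \<mu>_def by (simp add: power2_eq_square)
qed

lemma step_second_moment_sym: "step_second_moment p $ i $ j = step_second_moment p $ j $ i"
  by (simp add: step_second_moment_eq mult_ac)

lemma \<Sigma>_sym: "\<Sigma> $ i $ j = \<Sigma> $ j $ i"
proof -
  have entry: "(\<Sum>m. twisted_coeff (m + 2)) $ i $ j = (\<Sum>m. twisted_coeff (m + 2) $ i $ j)" for i j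
  proof -
    have "bounded_linear (\<lambda>M :: real ^ 'd ^ 'd. M $ i $ j)"
      by (intro bounded_linear_compose[OF bounded_linear_vec_nth bounded_linear_vec_nth])
    from bounded_linear.suminf[OF this summable_twisted_coeff] show ?thesis .
  qed
  have "twisted_coeff m $ i $ j = twisted_coeff m $ j $ i" for m
    by (simp add: twisted_coeff_def second_coeff_def algebra_simps)
  then have "(\<Sum>m. twisted_coeff (m + 2)) $ i $ j = (\<Sum>m. twisted_coeff (m + 2)) $ j $ i"
    unfolding entry by (intro arg_cong[where f = suminf] ext)
  then show ?thesis
    unfolding \<Sigma>_def vector_add_component vector_minus_component
    by (simp only: step_second_moment_sym[of i j] outer_def vec_lambda_beta mult.commute)
qed

lemma var_sym: "walk_law p Q \<Longrightarrow> walk_var Q N $ i $ j = walk_var Q N $ j $ i"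
  by (simp add: var_eq mult.commute)

lemma scaled_char_eq:
  assumes "walk_law p Q"
  shows "scaled_char Q \<theta> n k = centred_char n ((1 / sqrt (real n)) *\<^sub>R k)"
proof -
  let ?\<phi> = "\<lambda>x. exp (\<i> * complex_of_real (k \<bullet> (rvec x - real n *\<^sub>R \<theta>) / sqrt (real n)))"
  have "scaled_char Q \<theta> n k = (\<integral>w. ?\<phi> (w n) \<partial>Q)" by (simp add: scaled_char_def)
  also have "\<dots> = (\<Sum>v\<in>extensions L n [0]. path_prob n v *\<^sub>R ?\<phi> (last v))"
    by (rule has_bochner_integral_integral_eq[OF has_bochner_integral_endpoint[OF assms]])
  finally show ?thesis by (simp add: centred_char_def)
qed

lemma d_seq_nonneg: "0 \<le> d_seq b n"
  unfolding d_seq_def using b_nonneg by (intro sum_nonneg mult_nonneg_nonneg) auto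

lemma D_seq_nonneg: "0 \<le> D_seq b n"
  unfolding D_seq_def using d_seq_nonneg by (intro sum_nonneg) auto

lemma A_seq_nonneg: "0 \<le> A_seq \<gamma> b n"
  unfolding A_seq_def a_seq_def using b_nonneg by (intro sum_nonneg mult_nonneg_nonneg) auto

text \<open>
  The time \<open>N\<close> is fixed and the representation is used along the ray \<open>t *\<^sub>R k\<close> with \<open>t\<close> tending to \<open>0\<close>.
\<close>

lemma moments_from_representation:
  assumes Q: "walk_law p Q" and C: "0 < C" and K: "0 \<le> K" and N: "1 \<le> N"
    and rep: "\<And>k. C * (norm k)\<^sup>2 \<le> ln (real N + 1) / real N \<Longrightarrow>
      \<exists>R. centred_char N k = exp (- \<i> * complex_of_real (k \<bullet> total_drift N)
           - complex_of_real (real N * (k \<bullet> (\<Sigma> *v k)) / 2) + R) \<and>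
        cmod R \<le> K * ((norm k)\<^sup>2 * E_seq b N) + K * (norm k ^ 3 * A_seq \<gamma> b N)"
  shows "k \<bullet> (walk_mean Q N - real N *\<^sub>R \<theta>) = - (k \<bullet> total_drift N)"
    and "\<bar>k \<bullet> ((walk_var Q N - real N *\<^sub>R \<Sigma>) *v k)\<bar> \<le> 2 * K * E_seq b N * (norm k)\<^sup>2"
proof -
  define E where "E = K * (norm k)\<^sup>2 * E_seq b N"
  define A where "A = K * norm k ^ 3 * A_seq \<gamma> b N"
  \<comment> \<open>the summand \<open>1\<close> in the denominator takes care of \<open>k = 0\<close>\<close>
  define t\<^sub>0 where "t\<^sub>0 = sqrt (ln (real N + 1) / real N / (C * (norm k)\<^sup>2 + 1))"
  have ln0: "0 < ln (real N + 1)" using N by simp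
  have D0: "0 < C * (norm k)\<^sup>2 + 1" using C by (simp add: add_nonneg_pos)
  have E0: "0 \<le> E" using K E_seq_ge_one[OF N] by (simp add: E_def)
  have A0: "0 \<le> A" using K A_seq_nonneg by (simp add: A_def)
  have t0: "0 < t\<^sub>0" unfolding t\<^sub>0_def using ln0 D0 N by simp
  note cum = cumulants_of_exp_representation[where V = "extensions L N [0 :: int ^ 'd]" and w = "path_prob N"
      and y = "\<lambda>v. k \<bullet> (rvec (last v) - real N *\<^sub>R \<theta>)" and \<mu> = "- (k \<bullet> total_drift N)"
      and q = "real N * (k \<bullet> (\<Sigma> *v k))" and E = E and A = A and t\<^sub>0 = t\<^sub>0,
      OF path_prob_nonneg sum_path_prob t0 E0 A0]
  have hyp: "\<exists>R. (\<Sum>v\<in>extensions L N [0 :: int ^ 'd]. path_prob N v *\<^sub>R exp (\<i> * complex_of_real (t * (k \<bullet> (rvec (last v) - real N *\<^sub>R \<theta>)))))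
        = exp (\<i> * complex_of_real (t * - (k \<bullet> total_drift N)) - complex_of_real (t\<^sup>2 * (real N * (k \<bullet> (\<Sigma> *v k))) / 2) + R)
        \<and> cmod R \<le> t\<^sup>2 * E + t ^ 3 * A" if t: "0 < t" "t \<le> t\<^sub>0" for t
  proof -
    have "t\<^sup>2 \<le> t\<^sub>0\<^sup>2" using t by (intro power_mono) auto
    also have "t\<^sub>0\<^sup>2 = ln (real N + 1) / real N / (C * (norm k)\<^sup>2 + 1)"
      unfolding t\<^sub>0_def using ln0 D0 by (intro real_sqrt_pow2) simp
    finally have "t\<^sup>2 * (C * (norm k)\<^sup>2 + 1) \<le> ln (real N + 1) / real N"
      using D0 by (simp only: pos_le_divide_eq)
    moreover have "t\<^sup>2 * (C * (norm k)\<^sup>2 + 1) = C * (norm (t *\<^sub>R k))\<^sup>2 + t\<^sup>2"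
      by (simp add: power_mult_distrib algebra_simps)
    ultimately have "C * (norm (t *\<^sub>R k))\<^sup>2 \<le> ln (real N + 1) / real N"
      using zero_le_power2[of t] by linarith
    from rep[OF this] obtain R where R: "centred_char N (t *\<^sub>R k) = exp (- \<i> * complex_of_real ((t *\<^sub>R k) \<bullet> total_drift N)
           - complex_of_real (real N * ((t *\<^sub>R k) \<bullet> (\<Sigma> *v (t *\<^sub>R k))) / 2) + R)"
      and R_le: "cmod R \<le> K * ((norm (t *\<^sub>R k))\<^sup>2 * E_seq b N) + K * (norm (t *\<^sub>R k) ^ 3 * A_seq \<gamma> b N)" by blast
    have quad: "(t *\<^sub>R k) \<bullet> (\<Sigma> *v (t *\<^sub>R k)) = t\<^sup>2 * (k \<bullet> (\<Sigma> *v k))"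
      by (simp add: matrix_vector_mult_scaleR power2_eq_square)
    from R[unfolded quad] have "(\<Sum>v\<in>extensions L N [0 :: int ^ 'd]. path_prob N v *\<^sub>R exp (\<i> * complex_of_real (t * (k \<bullet> (rvec (last v) - real N *\<^sub>R \<theta>)))))
        = exp (\<i> * complex_of_real (t * - (k \<bullet> total_drift N)) - complex_of_real (t\<^sup>2 * (real N * (k \<bullet> (\<Sigma> *v k))) / 2) + R)"
      by (simp add: centred_char_def mult_ac)
    moreover have "cmod R \<le> t\<^sup>2 * E + t ^ 3 * A"
      using R_le t by (simp add: E_def A_def power_mult_distrib mult_ac)
    ultimately show ?thesis by blast
  qed
  show mean: "k \<bullet> (walk_mean Q N - real N *\<^sub>R \<theta>) = - (k \<bullet> total_drift N)"
    using cum(1)[OF hyp] by (simp add: inner_mean[OF Q])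
  have "k \<bullet> ((walk_var Q N - real N *\<^sub>R \<Sigma>) *v k)
     = (\<Sum>v\<in>extensions L N [0]. path_prob N v * (k \<bullet> (rvec (last v) - real N *\<^sub>R \<theta>))\<^sup>2)
       - (- (k \<bullet> total_drift N))\<^sup>2 - real N * (k \<bullet> (\<Sigma> *v k))"
    using var_quadratic[OF Q, of k N] unfolding mean
    by (simp add: matrix_vector_mult_diff_rdistrib inner_diff_right scaleR_matrix_vector_assoc[symmetric])
  then show "\<bar>k \<bullet> ((walk_var Q N - real N *\<^sub>R \<Sigma>) *v k)\<bar> \<le> 2 * K * E_seq b N * (norm k)\<^sup>2"
    using cum(2)[OF hyp] by (simp add: E_def mult_ac)
qed

theorem central_limit_bounds:
  assumes Q: "walk_law p Q" and \<gamma>: "0 < \<gamma>" "\<gamma> < 1" and C\<^sub>a: "1 \<le> C\<^sub>a"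
    and a_le: "\<And>n. 1 \<le> n \<Longrightarrow> a_seq \<gamma> b n \<le> C\<^sub>a * sqrt (real n / ln (real n + 1))"
  shows "mean_asymptotics Q \<theta>" "variance_asymptotics Q \<Sigma> b" "log_char_asymptotics Q \<theta> \<Sigma> \<gamma> b"
proof -
  obtain C K where C: "0 < C" and K: "0 \<le> K"
    and rep: "\<And>N k. 1 \<le> N \<Longrightarrow> C * (norm k)\<^sup>2 \<le> ln (real N + 1) / real N \<Longrightarrow>
      \<exists>R. centred_char N k = exp (- \<i> * complex_of_real (k \<bullet> total_drift N)
           - complex_of_real (real N * (k \<bullet> (\<Sigma> *v k)) / 2) + R) \<and>
        cmod R \<le> K * ((norm k)\<^sup>2 * E_seq b N) + K * (norm k ^ 3 * A_seq \<gamma> b N)"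
    using centred_char_exp_representation[OF \<gamma> C\<^sub>a a_le] by blast
  note moments = moments_from_representation[OF Q C K _ rep]
  have et: "0 \<le> e * total" using total_drift_le[of 0] norm_ge_zero order_trans by blast
  show "mean_asymptotics Q \<theta>"
    unfolding mean_asymptotics_def
  proof (intro exI[of _ "e * total"] allI impI)
    fix n :: nat assume n: "1 \<le> n"
    have "walk_mean Q n - real n *\<^sub>R \<theta> = - total_drift n"
      by (rule vector_eq_rdot[THEN iffD1]) (use moments(1)[OF n] n in \<open>simp add: inner_commute\<close>)
    then show "norm (walk_mean Q n - real n *\<^sub>R \<theta>) \<le> real n * (e * total * (1 / real n))"
      using total_drift_le[of n] n by simp
  qed
  show "variance_asymptotics Q \<Sigma> b"
    unfolding variance_asymptotics_def
  proof (intro exI[of _ "real CARD('d) * real CARD('d) * (6 * K)"] allI impI)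
    fix n :: nat assume n: "1 \<le> n"
    have "mat_norm (walk_var Q n - real n *\<^sub>R \<Sigma>) \<le> real CARD('d) * real CARD('d) * (3 * (2 * K * E_seq b n))"
    proof (rule entries_le_of_quadratic_le)
      show "(walk_var Q n - real n *\<^sub>R \<Sigma>) $ i $ j = (walk_var Q n - real n *\<^sub>R \<Sigma>) $ j $ i" for i j
        using var_sym[OF Q, of n i j] \<Sigma>_sym[of i j] by simp
      show "0 \<le> 2 * K * E_seq b n" using K E_seq_ge_one[OF n] by simp
      show "\<bar>k \<bullet> ((walk_var Q n - real n *\<^sub>R \<Sigma>) *v k)\<bar> \<le> 2 * K * E_seq b n * (norm k)\<^sup>2" for k
        using moments(2)[OF n] n by simp
    qed
    moreover have "0 \<le> real CARD('d) * real CARD('d) * (6 * K) * D_seq b n"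
      using K D_seq_nonneg by simp
    ultimately show "mat_norm (walk_var Q n - real n *\<^sub>R \<Sigma>)
      \<le> real CARD('d) * real CARD('d) * (6 * K) * D_seq b n + real CARD('d) * real CARD('d) * (6 * K) * E_seq b n"
      by (simp add: mult_ac)
  qed
  show "log_char_asymptotics Q \<theta> \<Sigma> \<gamma> b"
    unfolding log_char_asymptotics_def
  proof (rule exI[of _ C], intro conjI C, rule exI[of _ "e * total + K"], intro allI impI conjI)
    fix k :: "real ^ 'd" and n :: nat
    assume n: "1 \<le> n" and kn: "exp (C * (norm k)\<^sup>2) \<le> real n"
    let ?\<kappa> = "(1 / sqrt (real n)) *\<^sub>R k"
    define X where "X = exp (C * (norm k)\<^sup>2)"
    have X1: "1 \<le> X" using C by (simp add: X_def)
    have n0: "0 < real n" using n by simp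
    have norm: "norm ?\<kappa> = norm k / sqrt (real n)" by simp
    have norm2: "(norm ?\<kappa>)\<^sup>2 = (norm k)\<^sup>2 / real n" using n0 by (simp add: power_divide)
    have p1: "real n powr (- 1 / 2) = 1 / sqrt (real n)"
    proof -
      have "real n powr (- (1 / 2)) = inverse (real n powr (1 / 2))" by (rule powr_minus)
      then show ?thesis using n0 by (simp add: powr_half_sqrt inverse_eq_divide)
    qed
    have p3: "real n powr (- 3 / 2) = 1 / (real n * sqrt (real n))"
    proof -
      have "real n powr (3 / 2) = real n powr 1 * real n powr (1 / 2)"
        using powr_add[of "real n" 1 "1 / 2"] by simp
      moreover have "real n powr (- (3 / 2)) = inverse (real n powr (3 / 2))" by (rule powr_minus)
      ultimately show ?thesis using n0 by (simp add: powr_half_sqrt inverse_eq_divide)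
    qed
    have norm3: "norm ?\<kappa> ^ 3 = norm k ^ 3 * real n powr (- 3 / 2)"
      unfolding p3 norm using n0 by (simp add: power_divide power3_eq_cube)
    have "C * (norm k)\<^sup>2 \<le> ln (real n)" using kn n0 by (simp add: ln_ge_iff)
    also have "\<dots> \<le> ln (real n + 1)" using n0 by simp
    finally have "C * (norm ?\<kappa>)\<^sup>2 \<le> ln (real n + 1) / real n"
      unfolding norm2 using n0 by (simp add: divide_right_mono)
    from rep[OF n this] obtain R where R: "centred_char n ?\<kappa> = exp (- \<i> * complex_of_real (?\<kappa> \<bullet> total_drift n)
           - complex_of_real (real n * (?\<kappa> \<bullet> (\<Sigma> *v ?\<kappa>)) / 2) + R)"
      and R_le: "cmod R \<le> K * ((norm ?\<kappa>)\<^sup>2 * E_seq b n) + K * (norm ?\<kappa> ^ 3 * A_seq \<gamma> b n)" by blast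
    have quad: "real n * (?\<kappa> \<bullet> (\<Sigma> *v ?\<kappa>)) = k \<bullet> (\<Sigma> *v k)"
      using n0 by (simp add: matrix_vector_mult_scaleR)
    define z where "z = - \<i> * complex_of_real (?\<kappa> \<bullet> total_drift n) - complex_of_real (k \<bullet> (\<Sigma> *v k) / 2) + R"
    have char: "scaled_char Q \<theta> n k = exp z"
      unfolding scaled_char_eq[OF Q] R quad z_def ..
    then show "scaled_char Q \<theta> n k \<noteq> 0" by simp
    have "cmod (Ln (scaled_char Q \<theta> n k) - complex_of_real (- 1 / 2 * (k \<bullet> (\<Sigma> *v k))))
       \<le> cmod (z - complex_of_real (- 1 / 2 * (k \<bullet> (\<Sigma> *v k))))"
      unfolding char by (rule cmod_Ln_exp_minus_real_le)
    also have "\<dots> = cmod (- \<i> * complex_of_real (?\<kappa> \<bullet> total_drift n) + R)" by (simp add: z_def)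
    also have "\<dots> \<le> \<bar>?\<kappa> \<bullet> total_drift n\<bar> + cmod R"
      by (rule order_trans[OF norm_triangle_ineq]) (simp add: norm_mult norm_divide)
    also have "\<dots> \<le> norm ?\<kappa> * (e * total) + (K * ((norm ?\<kappa>)\<^sup>2 * E_seq b n) + K * (norm ?\<kappa> ^ 3 * A_seq \<gamma> b n))"
    proof (intro add_mono R_le)
      have "\<bar>?\<kappa> \<bullet> total_drift n\<bar> \<le> norm ?\<kappa> * norm (total_drift n)" by (rule Cauchy_Schwarz_ineq2)
      also have "\<dots> \<le> norm ?\<kappa> * (e * total)" using total_drift_le by (intro mult_left_mono) auto
      finally show "\<bar>?\<kappa> \<bullet> total_drift n\<bar> \<le> norm ?\<kappa> * (e * total)" .
    qed
    also have "\<dots> \<le> (e * total + K) * (norm k * X * real n powr (- 1 / 2))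
            + (e * total + K) * ((norm k) ^ 3 * real n powr (- 3 / 2) * A_seq \<gamma> b n)
            + (e * total + K) * ((norm k)\<^sup>2 * X * (1 / real n) * (D_seq b n + E_seq b n))"
    proof -
      have "norm ?\<kappa> * (e * total) \<le> (e * total + K) * (norm k * X * real n powr (- 1 / 2))"
      proof -
        have "norm k * 1 \<le> norm k * X" using X1 by (intro mult_left_mono) auto
        then have "norm k / sqrt (real n) \<le> norm k * X / sqrt (real n)" by (intro divide_right_mono) auto
        then have "(norm k / sqrt (real n)) * (e * total) \<le> (norm k * X / sqrt (real n)) * (e * total + K)"
          using et K X1 by (intro mult_mono) auto
        then show ?thesis unfolding norm p1 by (simp add: mult_ac)
      qed
      moreover have "K * (norm ?\<kappa> ^ 3 * A_seq \<gamma> b n) \<le> (e * total + K) * ((norm k) ^ 3 * real n powr (- 3 / 2) * A_seq \<gamma> b n)"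
        unfolding norm3 using et A_seq_nonneg by (intro mult_right_mono) auto
      moreover have "K * ((norm ?\<kappa>)\<^sup>2 * E_seq b n) \<le> (e * total + K) * ((norm k)\<^sup>2 * X * (1 / real n) * (D_seq b n + E_seq b n))"
      proof -
        have "(norm k)\<^sup>2 * 1 \<le> (norm k)\<^sup>2 * X" using X1 by (intro mult_left_mono) auto
        then have "(norm k)\<^sup>2 * 1 * (1 / real n) \<le> (norm k)\<^sup>2 * X * (1 / real n)" by (intro mult_right_mono) auto
        then have "(norm k)\<^sup>2 * 1 * (1 / real n) * E_seq b n \<le> (norm k)\<^sup>2 * X * (1 / real n) * (D_seq b n + E_seq b n)"
          using D_seq_nonneg[of n] E_seq_ge_one[OF n] X1 by (intro mult_mono) auto
        then have "K * ((norm k)\<^sup>2 * 1 * (1 / real n) * E_seq b n) \<le> K * ((norm k)\<^sup>2 * X * (1 / real n) * (D_seq b n + E_seq b n))"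
          using K by (intro mult_left_mono)
        also have "\<dots> \<le> (e * total + K) * ((norm k)\<^sup>2 * X * (1 / real n) * (D_seq b n + E_seq b n))"
          using et X1 n0 D_seq_nonneg[of n] E_seq_ge_one[OF n] by (intro mult_right_mono mult_nonneg_nonneg add_nonneg_nonneg) auto
        finally show ?thesis unfolding norm2 by simp
      qed
      ultimately show ?thesis by linarith
    qed
    finally show "cmod (Ln (scaled_char Q \<theta> n k) - complex_of_real (- 1 / 2 * (k \<bullet> (\<Sigma> *v k))))
      \<le> (e * total + K) * (norm k * exp (C * (norm k)\<^sup>2) * real n powr (- 1 / 2))
            + (e * total + K) * ((norm k) ^ 3 * real n powr (- 3 / 2) * A_seq \<gamma> b n)
            + (e * total + K) * ((norm k)\<^sup>2 * exp (C * (norm k)\<^sup>2) * (1 / real n) * (D_seq b n + E_seq b n))"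
      unfolding X_def .
  qed
qed

end

text \<open>
  Makes the constant nonnegative, as \<open>\<epsilon> \<beta>\<close> has no prescribed sign.
\<close>

lemma expansion_bounds_abs:
  assumes "expansion_bounds p e b" and b: "\<And>m. 1 \<le> m \<Longrightarrow> 0 \<le> b m"
  shows "expansion_bounds p \<bar>e\<bar> b"
proof -
  have mono: "x \<le> \<bar>e\<bar> * y * z * b m" if "x \<le> e * y * z * b m" "2 \<le> m" "0 \<le> y" "0 \<le> z" for x y z m
  proof -
    have "e * y * z * b m \<le> \<bar>e\<bar> * y * z * b m" using that b[of m] by (intro mult_right_mono) auto
    with that show ?thesis by linarith
  qed
  have mono1: "x \<le> \<bar>e\<bar> * b m" if "x \<le> e * b m" "2 \<le> m" for x m
    using mono[of x 1 1 m] that by simp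
  have mono2: "x \<le> \<bar>e\<bar> * real m * b m" if "x \<le> e * real m * b m" "2 \<le> m" for x m
    using mono[of x "real m" 1 m] that by simp
  from assms(1) show ?thesis
    unfolding expansion_bounds_def by (auto intro!: mono mono1 mono2)
qed

theorem theorem5p1:
  fixes p :: "real \<Rightarrow> (int ^ 'd) list \<Rightarrow> (int ^ 'd) pmf"
    and Q :: "real \<Rightarrow> (nat \<Rightarrow> int ^ 'd) measure"
    and L \<gamma> C\<^sub>a :: real
    and b :: "nat \<Rightarrow> real"
    and \<epsilon> :: "real \<Rightarrow> real"
  assumes "\<And>\<beta>. \<beta> \<ge> 0 \<Longrightarrow> translation_invariant (p \<beta>)"
    and "\<And>\<beta>. \<beta> \<ge> 0 \<Longrightarrow> range_at_most (p \<beta>) L"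
    and "\<And>\<beta>. \<beta> \<ge> 0 \<Longrightarrow> walk_law (p \<beta>) (Q \<beta>)"
    and "\<And>m n. 1 \<le> m \<Longrightarrow> m \<le> n \<Longrightarrow> b n \<le> b m"
    and "b 1 \<ge> 1"
    and "(\<epsilon> \<longlongrightarrow> 0) (at_right 0)"
    and "\<And>\<beta>. \<beta> \<ge> 0 \<Longrightarrow> expansion_bounds (p \<beta>) (\<epsilon> \<beta>) b"
    and "summable (\<lambda>m. real (Suc m) * b (Suc m))"
    and "0 < \<gamma>" and "\<gamma> < 1 / 2"
    and "d_seq b \<longlonglongrightarrow> 0"
    and "C\<^sub>a \<ge> 1"
    and "\<And>n. n \<ge> 1 \<Longrightarrow> a_seq \<gamma> b n \<le> C\<^sub>a * sqrt (real n / ln (real n + 1))"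
  shows "\<exists>\<beta>\<^sub>0>0. \<exists>(\<theta> :: real \<Rightarrow> real ^ 'd) (S :: real \<Rightarrow> real ^ 'd ^ 'd).
    \<forall>\<beta>. 0 \<le> \<beta> \<and> \<beta> \<le> \<beta>\<^sub>0 \<longrightarrow>
      mean_asymptotics (Q \<beta>) (\<theta> \<beta>) \<and>
      variance_asymptotics (Q \<beta>) (S \<beta>) b \<and>
      log_char_asymptotics (Q \<beta>) (\<theta> \<beta>) (S \<beta>) \<gamma> b \<and>
      theta_formula (p \<beta>) (\<theta> \<beta>) \<and>
      covariance_formula (p \<beta>) (\<theta> \<beta>) (S \<beta>)"
proof -
  interpret decaying_sequence b
    using assms(4,5,8) by unfold_locales auto
  have each: "\<exists>\<theta> S. mean_asymptotics (Q \<beta>) \<theta> \<and> variance_asymptotics (Q \<beta>) S b \<and>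
      log_char_asymptotics (Q \<beta>) \<theta> S \<gamma> b \<and> theta_formula (p \<beta>) \<theta> \<and> covariance_formula (p \<beta>) \<theta> S"
    if \<beta>: "0 \<le> \<beta>" for \<beta>
  proof -
    interpret expansion_walk "p \<beta>" L b "\<bar>\<epsilon> \<beta>\<bar>"
      using assms(1,2)[OF \<beta>] expansion_bounds_abs[OF assms(7)[OF \<beta>] b_nonneg] by unfold_locales auto
    have "\<gamma> < 1" using assms(10) by simp
    from central_limit_bounds[OF assms(3)[OF \<beta>] assms(9) this assms(12) assms(13)]
      theta_formula covariance_formula show ?thesis by blast
  qed
  then obtain \<theta> S where "\<And>\<beta>. 0 \<le> \<beta> \<Longrightarrow> mean_asymptotics (Q \<beta>) (\<theta> \<beta>) \<and> variance_asymptotics (Q \<beta>) (S \<beta>) b \<and>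
      log_char_asymptotics (Q \<beta>) (\<theta> \<beta>) (S \<beta>) \<gamma> b \<and> theta_formula (p \<beta>) (\<theta> \<beta>) \<and> covariance_formula (p \<beta>) (\<theta> \<beta>) (S \<beta>)"
    by metis
  \<comment> \<open>the assertions hold for each \<open>\<beta> \<ge> 0\<close>, with constants depending on \<open>\<beta>\<close>, so \<open>1\<close> is a possible \<open>\<beta>\<^sub>0\<close>\<close>
  then show ?thesis by (intro exI[of _ 1] conjI exI[of _ \<theta>] exI[of _ S]) auto
qed

end
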